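(* Minimum Weight Non-Terminal Spanning Tree, restricted to instances whose edge weight function $w$ takes positive integer values with $\max_{e\in E} w(e) = n^{O(1)}$, can be solved in time $O^*(2^k)$ and polynomial space, where $k=|V_{\rm NT}|$ and $n=|V|$.
   Context: Minimum Weight Non-Terminal Spanning Tree: given a connected undirected graph $G=(V,E)$, an edge weight function $w$ on $E$, and $V_{\rm NT}\subseteq V$, find a spanning tree $T$ of $G$ in which every vertex of $V_{\rm NT}$ has degree at least $2$, minimizing $w(E(T))=\sum_{e\in E(T)}w(e)$ (or report that none exists). The notation $O^*(\cdot)$ suppresses factors polynomial in the input size. *)

theory Defs
  imports Complex_Main "HOL-Library.Log_Nat" "HOL-Computational_Algebra.Polynomial"
begin

section \<open>Spanning trees with prescribed non-terminals\<close>

text \<open>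
  Graphs are finite, simple, undirected and nonempty; edges are two-element vertex sets.
  A tree is given by its edge set alone, its vertex set being the whole of \<open>V\<close>.
  (The trees of the AFP entry Graph-Theory are not used: they exclude directed cycles
  only, and in a symmetric digraph each edge already forms a directed cycle of length two.)
\<close>

definition simple_graph :: "'a set \<Rightarrow> 'a set set \<Rightarrow> bool" where
  "simple_graph V E \<longleftrightarrow> finite V \<and> V \<noteq> {} \<and> (\<forall>e\<in>E. e \<subseteq> V \<and> card e = 2)"

definition adjacency :: "'a set set \<Rightarrow> ('a \<times> 'a) set" where
  "adjacency E = {(u, v). {u, v} \<in> E}"

definition connected_graph :: "'a set \<Rightarrow> 'a set set \<Rightarrow> bool" where
  "connected_graph V E \<longleftrightarrow> simple_graph V E \<and> (\<forall>u\<in>V. \<forall>v\<in>V. (u, v) \<in> (adjacency E)\<^sup>*)"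

text \<open>A cycle is the list of its distinct vertices; the closing edge joins the last to the first.\<close>

definition graph_cycle :: "'a set set \<Rightarrow> 'a list \<Rightarrow> bool" where
  "graph_cycle E vs \<longleftrightarrow> 3 \<le> length vs \<and> distinct vs \<and>
     (\<forall>i<length vs. {vs ! i, vs ! (Suc i mod length vs)} \<in> E)"

definition is_tree :: "'a set \<Rightarrow> 'a set set \<Rightarrow> bool" where
  "is_tree V F \<longleftrightarrow> connected_graph V F \<and> (\<nexists>vs. graph_cycle F vs)"

definition spanning_tree :: "'a set \<Rightarrow> 'a set set \<Rightarrow> 'a set set \<Rightarrow> bool" where
  "spanning_tree V E F \<longleftrightarrow> F \<subseteq> E \<and> is_tree V F"

definition degree_in :: "'a set set \<Rightarrow> 'a \<Rightarrow> nat" where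
  "degree_in F v = card {e \<in> F. v \<in> e}"

definition nt_spanning_tree :: "'a set \<Rightarrow> 'a set set \<Rightarrow> 'a set \<Rightarrow> 'a set set \<Rightarrow> bool" where
  "nt_spanning_tree V E NT F \<longleftrightarrow> spanning_tree V E F \<and> (\<forall>v\<in>NT. 2 \<le> degree_in F v)"

definition min_nt_spanning_tree ::
  "'a set \<Rightarrow> 'a set set \<Rightarrow> ('a set \<Rightarrow> nat) \<Rightarrow> 'a set \<Rightarrow> 'a set set \<Rightarrow> bool" where
  "min_nt_spanning_tree V E w NT F \<longleftrightarrow> nt_spanning_tree V E NT F \<and>
     (\<forall>F'. nt_spanning_tree V E NT F' \<longrightarrow> sum w F \<le> sum w F')"


section \<open>A random access machine with logarithmic costs\<close>

text \<open>
  Structured programs for a RAM under the logarithmic cost criterion: the memory consists of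
  integer cells \<open>x[i]\<close>, with \<open>x\<close> one of the finitely many array names occurring in
  the program and \<open>i\<close> an integer computed at run time.  Integers are unbounded, but every
  constant, address, loaded value and operation result is charged its binary length, so a
  program cannot profit from manipulating long numbers.  A Turing machine simulates a run of
  time \<open>T\<close> and space \<open>S\<close> in space polynomial in \<open>S\<close> and in time \<open>T\<close> times a
  polynomial in \<open>S\<close>.
\<close>

type_synonym state = "string \<Rightarrow> int \<Rightarrow> int"

datatype binop = Plus | Minus | Times | Div | Mod | Less | Equal

datatype expr = Const int | Load string expr | Op binop expr expr

datatype prog =
    Skip
  | Store string expr expr
  | Seq prog prog
  | Cond expr prog prog
  | While expr prog

text \<open>
  Division and remainder are those of type \<open>int\<close> (rounding towards minus infinity, with
  \<open>a div 0 = 0\<close> and \<open>a mod 0 = a\<close>); comparisons yield 1 or 0.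
\<close>

fun apply_op :: "binop \<Rightarrow> int \<Rightarrow> int \<Rightarrow> int" where
  "apply_op Plus a b = a + b"
| "apply_op Minus a b = a - b"
| "apply_op Times a b = a * b"
| "apply_op Div a b = a div b"
| "apply_op Mod a b = a mod b"
| "apply_op Less a b = (if a < b then 1 else 0)"
| "apply_op Equal a b = (if a = b then 1 else 0)"

fun val :: "expr \<Rightarrow> state \<Rightarrow> int" where
  "val (Const a) s = a"
| "val (Load x i) s = s x (val i s)"
| "val (Op f a b) s = apply_op f (val a s) (val b s)"

definition bits :: "int \<Rightarrow> nat" where
  "bits a = nat (bitlen \<bar>a\<bar>)"

text \<open>The arguments of an operation and the addresses are charged as results of subexpressions.\<close>

fun cost :: "expr \<Rightarrow> state \<Rightarrow> nat" where
  "cost (Const a) s = 1 + bits a"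
| "cost (Load x i) s = cost i s + 1 + bits (s x (val i s))"
| "cost (Op f a b) s = cost a s + cost b s + 1 + bits (apply_op f (val a s) (val b s))"

text \<open>
  The space of a state is the total length of the addresses and contents of its nonzero cells,
  of which there are only finitely many in every run considered (lemma \<open>exec_finite\<close>).
\<close>

definition used_cells :: "state \<Rightarrow> (string \<times> int) set" where
  "used_cells s = {(x, i). s x i \<noteq> 0}"

definition state_space :: "state \<Rightarrow> nat" where
  "state_space s = (\<Sum>(x, i)\<in>used_cells s. 1 + bits i + bits (s x i))"

text \<open>
  \<open>exec c s t T S\<close>: started in \<open>s\<close>, the program \<open>c\<close> halts in \<open>t\<close> after time \<open>T\<close>, and
  \<open>S\<close> is the maximal space needed at any moment of the run.  The intermediate results of
  expression evaluation are charged to the space as well, through their cost.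
\<close>

inductive exec :: "prog \<Rightarrow> state \<Rightarrow> state \<Rightarrow> nat \<Rightarrow> nat \<Rightarrow> bool" where
  Skip: "exec Skip s s 1 (state_space s)"
| Store: "t = s(x := (s x)(val i s := val a s)) \<Longrightarrow>
    exec (Store x i a) s t (1 + cost i s + cost a s)
      (max (state_space s) (state_space t) + cost i s + cost a s)"
| Seq: "exec c s s' T1 S1 \<Longrightarrow> exec d s' t T2 S2 \<Longrightarrow>
    exec (Seq c d) s t (T1 + T2) (max S1 S2)"
| CondTrue: "val b s \<noteq> 0 \<Longrightarrow> exec c s t T S \<Longrightarrow>
    exec (Cond b c d) s t (1 + cost b s + T) (max (state_space s + cost b s) S)"
| CondFalse: "val b s = 0 \<Longrightarrow> exec d s t T S \<Longrightarrow>
    exec (Cond b c d) s t (1 + cost b s + T) (max (state_space s + cost b s) S)"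
| WhileFalse: "val b s = 0 \<Longrightarrow>
    exec (While b c) s s (1 + cost b s) (state_space s + cost b s)"
| WhileTrue: "val b s \<noteq> 0 \<Longrightarrow> exec c s s' T1 S1 \<Longrightarrow> exec (While b c) s' t T2 S2 \<Longrightarrow>
    exec (While b c) s t (1 + cost b s + T1 + T2)
      (max (state_space s + cost b s) (max S1 S2))"

inductive_cases exec_SkipE: "exec Skip s t T S"
inductive_cases exec_StoreE: "exec (Store x i a) s t T S"
inductive_cases exec_SeqE: "exec (Seq c d) s t T S"
inductive_cases exec_CondE: "exec (Cond b c d) s t T S"
inductive_cases exec_WhileE: "exec (While b c) s t T S"

lemma exec_deterministic:
  "exec c s t T S \<Longrightarrow> exec c s t' T' S' \<Longrightarrow> t' = t \<and> T' = T \<and> S' = S"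
proof (induction arbitrary: t' T' S' rule: exec.induct)
  case Skip
  then show ?case by (auto elim: exec_SkipE)
next
  case (Store t s x i a)
  from Store.prems Store.hyps show ?case by (auto elim: exec_StoreE)
next
  case (Seq c s s' T1 S1 d t T2 S2)
  from Seq.prems show ?case by (rule exec_SeqE) (auto dest!: Seq.IH)
next
  case (CondTrue b s c t T S d)
  from CondTrue.prems show ?case
    by (rule exec_CondE) (auto dest: CondTrue.IH simp: CondTrue.hyps(1))
next
  case (CondFalse b s d t T S c)
  from CondFalse.prems show ?case
    by (rule exec_CondE) (auto dest: CondFalse.IH simp: CondFalse.hyps(1))
next
  case (WhileFalse b s c)
  from WhileFalse.prems show ?case
    by (rule exec_WhileE) (use WhileFalse.hyps in simp_all)
next
  case (WhileTrue b s c s' T1 S1 t T2 S2)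
  from WhileTrue.prems show ?case
    by (rule exec_WhileE) (auto dest!: WhileTrue.IH simp: WhileTrue.hyps(1))
qed

lemma exec_finite:
  "exec c s t T S \<Longrightarrow> finite (used_cells s) \<Longrightarrow> finite (used_cells t)"
proof (induction rule: exec.induct)
  case (Store t s x i a)
  have "used_cells t \<subseteq> insert (x, val i s) (used_cells s)"
    using Store.hyps by (auto simp: used_cells_def split: if_splits)
  then show ?case
    using Store.prems finite_subset by blast
qed auto


section \<open>Instances as inputs\<close>

text \<open>
  The vertices are \<open>0, \<dots>, n - 1\<close>.  The input consists of the number \<open>n\<close>, the weighted
  adjacency matrix in row-major order, where 0 marks a non-edge (weights being positive), and
  the characteristic vector of the set of non-terminals.  All other cells are 0.
\<close>

definition encode :: "nat \<Rightarrow> nat set set \<Rightarrow> (nat set \<Rightarrow> nat) \<Rightarrow> nat set \<Rightarrow> state" where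
  "encode n E w NT = (\<lambda>x i.
     if x = ''n'' \<and> i = 0 then int n
     else if x = ''weight'' \<and> (\<exists>u<n. \<exists>v<n. i = int (u * n + v) \<and> {u, v} \<in> E)
       then int (w {nat i div n, nat i mod n})
     else if x = ''nonterminal'' \<and> (\<exists>v\<in>NT. i = int v) then 1
     else 0)"

lemma finite_used_cells_encode:
  assumes "finite NT"
  shows "finite (used_cells (encode n E w NT))"
proof (rule finite_subset)
  show "used_cells (encode n E w NT) \<subseteq> {(''n'', 0)} \<union>
      (\<lambda>(u, v). (''weight'', int (u * n + v))) ` ({..<n} \<times> {..<n}) \<union>
      (\<lambda>v. (''nonterminal'', int v)) ` NT"
    by (fastforce simp: used_cells_def encode_def image_iff split: if_splits)
qed (use assms in auto)

definition input_size :: "nat \<Rightarrow> nat set set \<Rightarrow> (nat set \<Rightarrow> nat) \<Rightarrow> nat" where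
  "input_size n E w = n + (\<Sum>e\<in>E. bits (int (w e)))"

text \<open>
  The answer: \<open>found[0]\<close> tells whether a feasible tree exists, and in this case the upper
  triangle of the matrix \<open>tree\<close> marks the edges of the tree returned.
\<close>

definition decode_tree :: "nat \<Rightarrow> state \<Rightarrow> nat set set" where
  "decode_tree n t = {{u, v} |u v. u < v \<and> v < n \<and> t ''tree'' (int (u * n + v)) = 1}"

definition correct_answer ::
  "nat \<Rightarrow> nat set set \<Rightarrow> (nat set \<Rightarrow> nat) \<Rightarrow> nat set \<Rightarrow> state \<Rightarrow> bool" where
  "correct_answer n E w NT t \<longleftrightarrow>
     (if \<exists>F. nt_spanning_tree {..<n} E NT F
      then t ''found'' 0 = 1 \<and> min_nt_spanning_tree {..<n} E w NT (decode_tree n t)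
      else t ''found'' 0 = 0)"

end

theory Submission
  imports Defs "Jordan_Normal_Form.Determinant" "HOL-Number_Theory.Cong"
begin

text \<open>
  Root a spanning tree at a vertex outside \<open>NT\<close>; it then is an acyclic map sending every other vertex
  to its parent, and it is feasible iff every non-terminal is a parent.  By inclusion-exclusion over
  the sets \<open>X \<subseteq> NT\<close> of vertices forbidden as parents, the generating function of the feasible trees
  by weight is an alternating sum of \<open>2\<^sup>k\<close> generating functions of acyclic maps, each of which is a
  determinant (matrix-tree theorem for directed weights).  The generating function is evaluated at a
  power of two exceeding all coefficients, so that the coefficients can be read off as digits.  Adding
  a term for vertices without parent makes the matrices congruent to the identity modulo 2, hence
  Gaussian elimination modulo a large power of two never meets a pivot that is not invertible, and
  all numbers have polynomial length because the weights are polynomially bounded.  An optimal tree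
  is found by deleting edges as long as the optimal weight is still attained.
\<close>

text \<open>The root must avoid \<open>NT\<close> because being a parent means degree at least two
  only for a vertex that also has a parent edge. If \<open>NT\<close> is the whole vertex set there
  is no such root, but then nothing is feasible and no map qualifies either: n - 1 children cannot
  have n different parents. The parentless term has a price: the determinants count proper forests
  as well. Each edge therefore gets the exponent \<open>K + w e\<close>, with \<open>K\<close> above
  the total weight of any forest, so that proper forests have exponents below
  \<open>K * (n - 1)\<close> and a single division removes them. Cancellation is confined to the
  inclusion-exclusion sum. Its total is a sum of positive powers below the modulus, so the residue
  determines it exactly, and a nonzero digit always witnesses a tree. Modulo a power of two the
  inverse of an odd pivot \<open>p\<close> is a truncated geometric series in the even number
  \<open>1 - p\<close>, which keeps the elimination within plain integer arithmetic on short
  numbers.\<close>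

section \<open>Determinants and acyclic maps\<close>

text \<open>The value \<open>n\<close> marks a vertex without parent.\<close>

definition parent_maps :: "nat \<Rightarrow> (nat \<Rightarrow> nat) set" where
  "parent_maps n = {f. (\<forall>u\<in>{0..<n}. f u \<in> {..n}) \<and> (\<forall>u. u \<notin> {0..<n} \<longrightarrow> f u = u)}"

text \<open>The rank \<open>h\<close> falls along every parent edge. In this form acyclicity serves
  directly as an induction measure towards the root and as an ordering of the rows.\<close>

definition acyclic_maps :: "nat \<Rightarrow> (nat \<Rightarrow> nat) set" where
  "acyclic_maps n = {f \<in> parent_maps n. \<exists>h::nat \<Rightarrow> nat. \<forall>u<n. f u < n \<longrightarrow> h (f u) < h u}"

lemma finite_parent_maps: "finite (parent_maps n)"
  unfolding parent_maps_def by (rule finite_bounded_functions) auto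

lemma finite_acyclic_maps: "finite (acyclic_maps n)"
  using finite_parent_maps by (rule finite_subset[rotated]) (auto simp: acyclic_maps_def)

lemma card_parent_maps_le: "card (parent_maps n) \<le> (n + 1) ^ n"
proof -
  have "card (parent_maps n) \<le> card ({0..<n} \<rightarrow>\<^sub>E {..n})"
  proof (rule card_inj_on_le[where f = "\<lambda>f. restrict f {0..<n}"])
    show "inj_on (\<lambda>f. restrict f {0..<n}) (parent_maps n)"
    proof (rule inj_onI, rule ext)
      fix f g x assume *: "f \<in> parent_maps n" "g \<in> parent_maps n"
        "restrict f {0..<n} = restrict g {0..<n}"
      show "f x = g x"
      proof (cases "x \<in> {0..<n}")
        case True
        then show ?thesis using fun_cong[OF *(3), of x] by simp
      next
        case False
        then show ?thesis using * by (simp add: parent_maps_def)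
      qed
    qed
  qed (auto simp: parent_maps_def intro!: finite_PiE)
  also have "\<dots> = (n + 1) ^ n"
    by (simp add: card_PiE)
  finally show ?thesis .
qed

text \<open>If every orbit left \<open>{..<n}\<close>, the number of steps before it does would be a
  rank. So the set \<open>C\<close> of vertices whose orbit stays inside is nonempty and mapped into
  itself, and a minimal set of this kind equals its image, because the image is again of this
  kind.\<close>

lemma cyclic_set_exists:
  fixes f :: "nat \<Rightarrow> nat"
  assumes "\<nexists>h::nat \<Rightarrow> nat. \<forall>u<n. f u < n \<longrightarrow> h (f u) < h u"
  shows "\<exists>D. D \<noteq> {} \<and> D \<subseteq> {..<n} \<and> f ` D = D"
proof -
  define C where "C = {u. \<forall>k. (f ^^ k) u < n}"
  have "C \<noteq> {}"
  proof
    assume "C = {}"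
    then have ex: "\<exists>k. \<not> (f ^^ k) u < n" for u
      unfolding C_def by blast
    define h where "h u = (LEAST k. \<not> (f ^^ k) u < n)" for u
    have "h (f u) < h u" if "u < n" for u
    proof -
      have h: "\<not> (f ^^ h u) u < n"
        unfolding h_def by (rule LeastI_ex[OF ex])
      then obtain k where k: "h u = Suc k"
        using h \<open>u < n\<close> by (cases "h u") auto
      have "\<not> (f ^^ k) (f u) < n"
        using h unfolding k by (simp add: funpow_swap1)
      then have "h (f u) \<le> k"
        unfolding h_def by (rule Least_le)
      then show ?thesis using k by simp
    qed
    with assms show False by blast
  qed
  define T where "T = {D. D \<noteq> {} \<and> D \<subseteq> {..<n} \<and> f ` D \<subseteq> D}"
  have "C \<in> T"
  proof -
    have "u < n" if "u \<in> C" for u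
      using that[unfolded C_def] by (auto dest: spec[of _ 0])
    moreover have "f u \<in> C" if "u \<in> C" for u
      unfolding C_def
    proof (clarify)
      fix k
      have "(f ^^ Suc k) u < n" using that unfolding C_def by blast
      then show "(f ^^ k) (f u) < n" by (simp add: funpow_swap1)
    qed
    ultimately show ?thesis using \<open>C \<noteq> {}\<close> unfolding T_def by blast
  qed
  moreover have "finite T"
    by (rule finite_subset[of _ "Pow {..<n}"]) (auto simp: T_def)
  ultimately obtain D where D: "D \<in> T" and min: "\<And>D'. D' \<in> T \<Longrightarrow> D' \<subseteq> D \<Longrightarrow> D' = D"
    using finite_has_minimal2[of T C] by blast
  have "f ` D \<in> T" using D unfolding T_def by blast
  then have "f ` D = D"
    using D by (intro min) (auto simp: T_def)
  then show ?thesis using D unfolding T_def by blast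
qed

text \<open>Ordered by rank the matrix is triangular with unit diagonal. In the Leibniz formula: at
  a moved vertex \<open>u\<close> of least rank, \<open>p u\<close> is moved too, hence has rank at
  least \<open>h u\<close> and is not the parent of \<open>u\<close>, so the entry at
  \<open>(u, p u)\<close> vanishes.\<close>

lemma det_acyclic_map:
  fixes f :: "nat \<Rightarrow> nat"
  assumes "\<forall>u<n. f u < n \<longrightarrow> h (f u) < (h u :: nat)"
  shows "det (mat\<^sub>r n n (\<lambda>u. vec n (\<lambda>v. of_bool (u = v) - of_bool (f u = v)))) = (1::int)"
    (is "det ?A = 1")
proof -
  have A: "?A \<in> carrier_mat n n" by simp
  let ?t = "\<lambda>p. signof p * (\<Prod>i = 0..<n. ?A $$ (i, p i))"
  have zero: "?t p = 0" if p: "p permutes {0..<n}" and "p \<noteq> id" for p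
  proof -
    have "\<exists>u. p u \<noteq> u" using that by auto
    then obtain u where u: "p u \<noteq> u" and min: "\<And>v. p v \<noteq> v \<Longrightarrow> h u \<le> h v"
      using arg_min_natI[of "\<lambda>u. p u \<noteq> u" _ h] arg_min_nat_le[of "\<lambda>u. p u \<noteq> u" _ h] by blast
    have un: "u < n" using u p by (metis atLeastLessThan_iff permutes_not_in zero_le)
    then have pn: "p u < n" using permutes_in_image[OF p, of u] by simp
    have "p (p u) \<noteq> p u" using u permutes_inj[OF p] by (metis injD)
    then have "h u \<le> h (p u)" by (rule min)
    then have "f u \<noteq> p u" using assms un pn by fastforce
    then have "?A $$ (u, p u) = 0" using u un pn by (simp add: of_bool_def)
    then have "(\<Prod>i = 0..<n. ?A $$ (i, p i)) = 0"
      using un by (intro prod_zero) auto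
    then show ?thesis by simp
  qed
  have "det ?A = (\<Sum>p | p permutes {0..<n}. ?t p)" by (rule det_def'[OF A])
  also have "\<dots> = (\<Sum>p\<in>{id}. ?t p)"
  proof (rule sum.mono_neutral_right)
    show "\<forall>p\<in>{p. p permutes {0..<n}} - {id}. ?t p = 0"
      using zero by blast
  qed (simp_all add: finite_permutations permutes_id)
  also have "\<dots> = (\<Prod>i = 0..<n. ?A $$ (i, i))" by (simp add: sign_id)
  also have "\<dots> = 1"
  proof (rule prod.neutral, clarify)
    fix i assume "i \<in> {0..<n}"
    then have "f i \<noteq> i" using assms by fastforce
    then show "?A $$ (i, i) = 1" using \<open>i \<in> {0..<n}\<close> by simp
  qed
  finally show ?thesis .
qed

text \<open>The rows along a cycle add up to zero.\<close>

lemma det_cyclic_map: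
  fixes f :: "nat \<Rightarrow> nat"
  assumes D: "D \<noteq> {}" "D \<subseteq> {..<n}" "f ` D = D"
  shows "det (mat\<^sub>r n n (\<lambda>u. vec n (\<lambda>v. of_bool (u = v) - of_bool (f u = v)))) = (0::int)"
    (is "det ?A = 0")
proof -
  have A: "?A \<in> carrier_mat n n" by simp
  have fin: "finite D" using D(2) finite_subset by blast
  have inj: "inj_on f D" using D(3) fin by (simp add: eq_card_imp_inj_on)
  define v where "v = vec n (\<lambda>u. of_bool (u \<in> D) :: int)"
  have v: "v \<in> carrier_vec n" unfolding v_def by simp
  obtain d where d: "d \<in> D" using D(1) by blast
  have "v $ d = 1" using d D(2) unfolding v_def by auto
  then have "v \<noteq> 0\<^sub>v n" using d D(2) by auto
  moreover have "transpose_mat ?A *\<^sub>v v = 0\<^sub>v n"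
  proof (rule eq_vecI)
    fix w assume "w < dim_vec (0\<^sub>v n :: int vec)"
    then have w: "w < n" by simp
    have "(transpose_mat ?A *\<^sub>v v) $ w
        = (\<Sum>u = 0..<n. (of_bool (u = w) - of_bool (f u = w)) * of_bool (u \<in> D))"
      using w unfolding v_def by (simp add: scalar_prod_def)
    also have "\<dots> = (\<Sum>u\<in>D. of_bool (u = w) - of_bool (f u = w))"
      using D(2) by (intro sum.mono_neutral_cong_right) auto
    also have "\<dots> = (\<Sum>u\<in>D. of_bool (u = w)) - (\<Sum>u\<in>D. of_bool (f u = w))"
      by (rule sum_subtractf)
    also have "(\<Sum>u\<in>D. of_bool (f u = w)) = (\<Sum>u\<in>f ` D. of_bool (u = w) :: int)"
      by (simp add: sum.reindex[OF inj])
    finally show "(transpose_mat ?A *\<^sub>v v) $ w = 0\<^sub>v n $ w" using D(3) w by simp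
  qed simp
  ultimately have "det (transpose_mat ?A) = 0"
    using v A by (subst det_0_iff_vec_prod_zero[of _ n]) (blast intro: transpose_carrier_mat[THEN iffD2])+
  then show ?thesis by (simp only: det_transpose[OF A])
qed

text \<open>The directed Laplacian of the vertices up to \<open>n\<close> with row and column
  \<open>n\<close> deleted: \<open>b u n\<close> occurs in the diagonal only, and a loop weight
  \<open>b u u\<close> cancels.\<close>

definition laplace_matrix :: "nat \<Rightarrow> (nat \<Rightarrow> nat \<Rightarrow> int) \<Rightarrow> int mat" where
  "laplace_matrix n b = mat n n (\<lambda>(u, v). (if u = v then (\<Sum>w\<le>n. b u w) else 0) - b u v)"

text \<open>
  Every row is the combination with coefficients \<open>b u w\<close> of the differences of unit vectors
  belonging to the possible parents \<open>w\<close> of \<open>u\<close>; multilinearity expands the determinant over all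
  choices of parents.
\<close>

theorem det_laplace_matrix:
  "det (laplace_matrix n b) = (\<Sum>f\<in>acyclic_maps n. \<Prod>u = 0..<n. b u (f u))"
proof -
  let ?e = "\<lambda>u w. vec n (\<lambda>v. of_bool (u = v) - of_bool (w = v)) :: int vec"
  let ?a = "\<lambda>u w. b u w \<cdot>\<^sub>v ?e u w"
  have a: "?a \<in> {0..<n} \<rightarrow> {..n} \<rightarrow> carrier_vec n" by auto
  have "laplace_matrix n b = mat\<^sub>r n n (\<lambda>u. finsum_vec TYPE(int) n (?a u) {..n})"
  proof (rule eq_matI)
    fix u v assume "u < dim_row (mat\<^sub>r n n (\<lambda>u. finsum_vec TYPE(int) n (?a u) {..n}))"
      "v < dim_col (mat\<^sub>r n n (\<lambda>u. finsum_vec TYPE(int) n (?a u) {..n}))"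
    then have uv: "u < n" "v < n" by auto
    have "finsum_vec TYPE(int) n (?a u) {..n} $ v = (\<Sum>w\<le>n. ?a u w $ v)"
      using uv by (subst index_finsum_vec) auto
    also have "\<dots> = (\<Sum>w\<le>n. (if u = v then b u w else 0) - (if w = v then b u w else 0))"
      using uv by (intro sum.cong) (auto simp: algebra_simps)
    also have "\<dots> = (if u = v then (\<Sum>w\<le>n. b u w) else 0) - b u v"
      using uv by (simp add: sum_subtractf)
    finally show "laplace_matrix n b $$ (u, v)
        = mat\<^sub>r n n (\<lambda>u. finsum_vec TYPE(int) n (?a u) {..n}) $$ (u, v)"
      using uv by (simp add: laplace_matrix_def)
  qed (auto simp: laplace_matrix_def)
  then have "det (laplace_matrix n b)
      = (\<Sum>f\<in>parent_maps n. det (mat\<^sub>r n n (\<lambda>u. ?a u (f u))))"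
    \<comment> \<open>The identity outside \<open>{0..<n}\<close> in \<open>parent_maps\<close> is
      the normal form in which this expansion indexes the choice functions.\<close>
    using det_linear_rows_sum[OF _ a] by (simp add: parent_maps_def)
  also have "\<dots> = (\<Sum>f\<in>parent_maps n. (\<Prod>u = 0..<n. b u (f u)) * det (mat\<^sub>r n n (\<lambda>u. ?e u (f u))))"
    by (intro sum.cong refl det_rows_mul) auto
  also have "\<dots> = (\<Sum>f\<in>acyclic_maps n. \<Prod>u = 0..<n. b u (f u))"
  proof (rule sum.mono_neutral_cong_right)
    show "\<forall>f\<in>parent_maps n - acyclic_maps n.
        (\<Prod>u = 0..<n. b u (f u)) * det (mat\<^sub>r n n (\<lambda>u. ?e u (f u))) = 0"
    proof
      fix f assume "f \<in> parent_maps n - acyclic_maps n"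
      then have "\<nexists>h::nat \<Rightarrow> nat. \<forall>u<n. f u < n \<longrightarrow> h (f u) < h u"
        unfolding acyclic_maps_def by blast
      from cyclic_set_exists[OF this] obtain D where D: "D \<noteq> {}" "D \<subseteq> {..<n}" "f ` D = D"
        by blast
      show "(\<Prod>u = 0..<n. b u (f u)) * det (mat\<^sub>r n n (\<lambda>u. ?e u (f u))) = 0"
        by (simp only: det_cyclic_map[OF D] mult_zero_right)
    qed
  next
    fix f assume "f \<in> acyclic_maps n"
    then obtain h :: "nat \<Rightarrow> nat" where "\<forall>u<n. f u < n \<longrightarrow> h (f u) < h u"
      unfolding acyclic_maps_def by blast
    then show "(\<Prod>u = 0..<n. b u (f u)) * det (mat\<^sub>r n n (\<lambda>u. ?e u (f u)))
        = (\<Prod>u = 0..<n. b u (f u))"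
      by (simp only: det_acyclic_map mult_1_right)
  qed (auto simp: finite_parent_maps acyclic_maps_def)
  finally show ?thesis .
qed

section \<open>Spanning trees as parent maps\<close>

lemma distinct_path_exists:
  assumes "(a, b) \<in> (adjacency G)\<^sup>*"
  shows "\<exists>vs. vs \<noteq> [] \<and> hd vs = a \<and> last vs = b \<and> distinct vs \<and> successively (\<lambda>x y. {x, y} \<in> G) vs"
  using assms
proof (induction rule: converse_rtrancl_induct)
  case base
  show ?case by (rule exI[of _ "[b]"]) simp
next
  case (step a y)
  then obtain vs where vs: "vs \<noteq> []" "hd vs = y" "last vs = b" "distinct vs"
    "successively (\<lambda>x y. {x, y} \<in> G) vs" by blast
  show ?case
  proof (cases "a \<in> set vs")
    case True
    then obtain xs ys where "vs = xs @ a # ys" using split_list by fast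
    then show ?thesis using vs
      by (intro exI[of _ "a # ys"]) (auto simp: successively_append_iff)
  next
    case False
    then show ?thesis using vs step(1)
      by (intro exI[of _ "a # vs"]) (auto simp: adjacency_def successively_Cons)
  qed
qed

lemma graph_cycle_if_path_avoids_edge:
  assumes "(a, b) \<in> (adjacency G)\<^sup>*" "G \<subseteq> F" "{a, b} \<in> F" "{a, b} \<notin> G" "a \<noteq> b"
  shows "\<exists>vs. graph_cycle F vs"
proof -
  obtain vs where vs: "vs \<noteq> []" "hd vs = a" "last vs = b" "distinct vs"
    "successively (\<lambda>x y. {x, y} \<in> G) vs" using distinct_path_exists[OF assms(1)] by blast
  have nth: "{vs ! i, vs ! Suc i} \<in> G" if "Suc i < length vs" for i
    using vs(5) that by (simp add: successively_conv_nth)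
  have ends: "vs ! 0 = a" "vs ! (length vs - 1) = b"
    using vs by (simp_all add: hd_conv_nth last_conv_nth)
  have "length vs \<noteq> 0" using vs by simp
  moreover have "length vs \<noteq> 1" using ends assms(5) by auto
  moreover have "length vs \<noteq> 2" using ends nth[of 0] assms(4) by auto
  ultimately have len: "3 \<le> length vs" by linarith
  have "{vs ! i, vs ! (Suc i mod length vs)} \<in> F" if "i < length vs" for i
  proof (cases "Suc i < length vs")
    case True
    then show ?thesis using nth assms(2) by auto
  next
    case False
    then have "i = length vs - 1" "Suc i = length vs" using that by simp_all
    then have "vs ! i = b" "vs ! (Suc i mod length vs) = a" using ends by simp_all
    then show ?thesis using assms(3) by (simp add: insert_commute)
  qed
  then show ?thesis using len vs(4) unfolding graph_cycle_def by blast
qed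

lemma adjacency_rtrancl_sym: "(a, b) \<in> (adjacency G)\<^sup>* \<Longrightarrow> (b, a) \<in> (adjacency G)\<^sup>*"
  by (rule symD[OF sym_rtrancl]) (auto simp: sym_def adjacency_def insert_commute)

text \<open>A vertex of maximal rank on a cycle would have two parents.\<close>

lemma parent_edges_acyclic:
  fixes h :: "'a \<Rightarrow> nat"
  assumes "\<And>u. u \<in> U \<Longrightarrow> h (f u) < h u"
  shows "\<not> graph_cycle ((\<lambda>u. {u, f u}) ` U) vs"
proof
  assume c: "graph_cycle ((\<lambda>u. {u, f u}) ` U) vs"
  then have len: "3 \<le> length vs" and dist: "distinct vs"
    and edge: "\<And>i. i < length vs \<Longrightarrow> {vs ! i, vs ! (Suc i mod length vs)} \<in> (\<lambda>u. {u, f u}) ` U"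
    unfolding graph_cycle_def by auto
  let ?l = "length vs"
  \<comment> \<open>Ranks fall along parent edges, so of two adjacent vertices the one of larger
    rank is the child.\<close>
  have par: "y = f x" if "{x, y} \<in> (\<lambda>u. {u, f u}) ` U" "h y \<le> h x" for x y
    using that assms by (fastforce simp: doubleton_eq_iff)
  have "finite (set vs)" "set vs \<noteq> {}" using len by auto
  then have "Max (h ` set vs) \<in> h ` set vs" by (intro Max_in) auto
  then obtain x where x: "x \<in> set vs" "h x = Max (h ` set vs)" by auto
  then have max: "h y \<le> h x" if "y \<in> set vs" for y using that by simp
  from x obtain i where i: "i < ?l" "vs ! i = x" by (metis in_set_conv_nth)
  define j where "j = (if i = 0 then ?l - 1 else i - 1)"
  have j: "j < ?l" "Suc j mod ?l = i" using i len unfolding j_def by auto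
  define k where "k = Suc i mod ?l"
  have k: "k < ?l" unfolding k_def using len by (intro mod_less_divisor) linarith
  have "vs ! k = f x"
    using edge[OF i(1)] max[OF nth_mem[OF k]] i(2) unfolding k_def by (intro par) auto
  moreover have "vs ! j = f x"
    using edge[OF j(1)] max[OF nth_mem[OF j(1)]] i(2) unfolding j(2)
    by (intro par) (auto simp: insert_commute)
  ultimately have "k = j" using dist k j(1) by (metis nth_eq_iff_index_eq)
  \<comment> \<open>The neighbours of \<open>x\<close> on the cycle occupy the positions
    \<open>Suc i\<close> and \<open>i - 1\<close> modulo the length, which differ for length at
    least 3.\<close>
  then show False using i len unfolding k_def j_def
    by (auto simp: mod_Suc split: if_splits)
qed

text \<open>Vertices other than \<open>r\<close> may take the value \<open>n\<close> as well. These
  proper forests come in through the parentless term of the matrices and are told apart from trees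
  later by their exponents.\<close>

definition forest_maps :: "nat \<Rightarrow> nat set set \<Rightarrow> nat \<Rightarrow> nat set \<Rightarrow> (nat \<Rightarrow> nat) set" where
  "forest_maps n E r NT = {f \<in> acyclic_maps n. f r = n \<and> (\<forall>u<n. f u < n \<longrightarrow> {u, f u} \<in> E) \<and>
     NT \<subseteq> f ` {..<n}}"

definition tree_maps :: "nat \<Rightarrow> nat set set \<Rightarrow> nat \<Rightarrow> nat set \<Rightarrow> (nat \<Rightarrow> nat) set" where
  "tree_maps n E r NT = {f \<in> forest_maps n E r NT. \<forall>u<n. u \<noteq> r \<longrightarrow> f u < n}"

definition map_weight :: "nat \<Rightarrow> nat \<Rightarrow> (nat set \<Rightarrow> nat) \<Rightarrow> (nat \<Rightarrow> nat) \<Rightarrow> nat" where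
  "map_weight n r w f = (\<Sum>u\<in>{..<n} - {r}. w {u, f u})"

text \<open>Outside the root the degree is one plus the number of children, so being a parent
  amounts to degree at least two. The root lacks a parent edge and could have degree one, hence the
  condition on \<open>r\<close>.\<close>

lemma tree_of_tree_map:
  assumes f: "f \<in> tree_maps n E r NT" and r: "r < n"
    and NTn: "NT \<subseteq> {..<n}" and rNT: "r \<in> NT \<Longrightarrow> NT = {..<n}"
  shows "\<exists>F. nt_spanning_tree {..<n} E NT F \<and> sum w F = map_weight n r w f"
proof -
  let ?U = "{..<n} - {r}"
  let ?e = "\<lambda>u. {u, f u}"
  let ?F = "?e ` ?U"
  obtain h :: "nat \<Rightarrow> nat" where h: "\<And>u. u < n \<Longrightarrow> f u < n \<Longrightarrow> h (f u) < h u"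
    using f unfolding tree_maps_def forest_maps_def acyclic_maps_def by blast
  have fr: "f r = n" and edge: "\<And>u. u < n \<Longrightarrow> f u < n \<Longrightarrow> {u, f u} \<in> E"
    and NT: "NT \<subseteq> f ` {..<n}" and fn: "\<And>u. u < n \<Longrightarrow> u \<noteq> r \<Longrightarrow> f u < n"
    using f unfolding tree_maps_def forest_maps_def by auto
  have hU: "h (f u) < h u" if "u \<in> ?U" for u using that h fn by auto
  have ne: "f u \<noteq> u" if "u \<in> ?U" for u using hU[OF that] by auto
  have inj: "inj_on ?e ?U"
  proof (rule inj_onI)
    fix u v assume u: "u \<in> ?U" and v: "v \<in> ?U" and eq: "?e u = ?e v"
    show "u = v"
    proof (rule ccontr)
      assume "u \<noteq> v"
      then have "u = f v" "f u = v" using eq by (auto simp: doubleton_eq_iff)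
      then show False using hU[OF u] hU[OF v] by simp
    qed
  qed
  \<comment> \<open>No map qualifies for \<open>NT = {..<n}\<close>: the root has no parent, and the
    other n - 1 vertices have at most n - 1 parents.\<close>
  have "NT \<noteq> {..<n}"
  proof
    assume "NT = {..<n}"
    then have "{..<n} \<subseteq> f ` ?U" using NT fr by fastforce
    then have "card {..<n} \<le> card (f ` ?U)" by (intro card_mono) auto
    also have "\<dots> \<le> card ?U" by (intro card_image_le) auto
    finally show False using r by simp
  qed
  then have rNT: "r \<notin> NT" using rNT by blast
  have to_r: "(u, r) \<in> (adjacency ?F)\<^sup>*" if "u < n" for u
    using that
  proof (induction "h u" arbitrary: u rule: less_induct)
    case less
    show ?case
    proof (cases "u = r")
      case False
      then have u: "u \<in> ?U" using less by simp
      then have "(f u, r) \<in> (adjacency ?F)\<^sup>*" using hU fn by (intro less) auto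
      moreover have "(u, f u) \<in> adjacency ?F" using u unfolding adjacency_def by auto
      ultimately show ?thesis by (rule converse_rtrancl_into_rtrancl[rotated])
    qed simp
  qed
  have "connected_graph {..<n} ?F"
    unfolding connected_graph_def simple_graph_def
  proof (intro conjI ballI)
    show "(u, v) \<in> (adjacency ?F)\<^sup>*" if "u \<in> {..<n}" "v \<in> {..<n}" for u v
      using that to_r adjacency_rtrancl_sym by (meson lessThan_iff rtrancl_trans)
    show "card e = 2" if "e \<in> ?F" for e
      using that ne by (auto simp: card_2_iff)
  qed (use r fn in auto)
  then have "is_tree {..<n} ?F"
    unfolding is_tree_def using parent_edges_acyclic[of ?U h f] hU by blast
  moreover have "2 \<le> degree_in ?F v" if v: "v \<in> NT" for v
  proof -
    have "v \<noteq> r" using v rNT by blast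
    obtain u where u: "u < n" "v = f u" using v NT by auto
    have "v < n" using v NTn by blast
    then have vU: "v \<in> ?U" using \<open>v \<noteq> r\<close> by simp
    have uU: "u \<in> ?U" using u \<open>v < n\<close> fr by auto
    have "?e u \<noteq> ?e v" using inj_onD[OF inj _ uU vU] ne[OF uU] u(2) by auto
    then have "card {?e u, ?e v} = 2" by simp
    moreover have "{?e u, ?e v} \<subseteq> {e \<in> ?F. v \<in> e}" using uU vU u by auto
    moreover have "finite {e \<in> ?F. v \<in> e}" by simp
    ultimately show ?thesis unfolding degree_in_def by (metis (no_types, lifting) card_mono)
  qed
  moreover have "?F \<subseteq> E" using edge fn by auto
  moreover have "sum w ?F = map_weight n r w f"
    unfolding map_weight_def by (simp add: sum.reindex[OF inj])
  ultimately show ?thesis unfolding nt_spanning_tree_def spanning_tree_def by blast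
qed

text \<open>
  Orient every edge of the tree towards the root along shortest paths; the parent edges already
  connect the graph, so any further edge would close a cycle.
\<close>

lemma tree_map_of_tree:
  assumes F: "nt_spanning_tree {..<n} E NT F" and r: "r < n" and NT: "NT \<subseteq> {..<n}"
  shows "\<exists>f\<in>tree_maps n E r NT. map_weight n r w f = sum w F"
proof -
  have FE: "F \<subseteq> E" and acyc: "\<nexists>vs. graph_cycle F vs" and deg: "\<And>v. v \<in> NT \<Longrightarrow> 2 \<le> degree_in F v"
    and conn: "\<And>u v. u < n \<Longrightarrow> v < n \<Longrightarrow> (u, v) \<in> (adjacency F)\<^sup>*"
    and Fe: "\<And>e. e \<in> F \<Longrightarrow> e \<subseteq> {..<n} \<and> card e = 2"
    using F unfolding nt_spanning_tree_def spanning_tree_def is_tree_def connected_graph_def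
      simple_graph_def by auto
  let ?U = "{..<n} - {r}"
  define d where "d u = (LEAST k. (u, r) \<in> adjacency F ^^ k)" for u
  have d: "(u, r) \<in> adjacency F ^^ d u" if "u < n" for u
  proof -
    have "\<exists>k. (u, r) \<in> adjacency F ^^ k" using conn[OF that r] by (simp add: rtrancl_power)
    then show ?thesis unfolding d_def by (rule LeastI_ex)
  qed
  have "\<exists>v. {u, v} \<in> F \<and> d v < d u" if "u \<in> ?U" for u
  proof -
    obtain k where k: "d u = Suc k"
      using d[of u] \<open>u \<in> ?U\<close> by (cases "d u") auto
    then have "(u, r) \<in> adjacency F ^^ Suc k" using d[of u] \<open>u \<in> ?U\<close> by simp
    then obtain v where v: "(u, v) \<in> adjacency F" "(v, r) \<in> adjacency F ^^ k"
      using relpow_Suc_D2 by metis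
    then have "d v \<le> k" unfolding d_def by (intro Least_le)
    then show ?thesis using v k unfolding adjacency_def by auto
  qed
  then obtain p where p: "\<And>u. u \<in> ?U \<Longrightarrow> {u, p u} \<in> F \<and> d (p u) < d u" by metis
  have pn: "p u < n" if "u \<in> ?U" for u using p[OF that] Fe[of "{u, p u}"] by auto
  \<comment> \<open>The last branch meets the demand of \<open>parent_maps\<close> that a map be the
    identity outside the vertices.\<close>
  define f where "f u = (if u \<in> ?U then p u else if u = r then n else u)" for u
  have fU: "f u = p u" if "u \<in> ?U" for u using that unfolding f_def by simp
  let ?e = "\<lambda>u. {u, f u}"
  let ?F = "?e ` ?U"
  have sub: "?F \<subseteq> F" using p fU by auto
  have hU: "d (f u) < d u" if "u \<in> ?U" for u using p fU that by auto
  have to_r: "(u, r) \<in> (adjacency ?F)\<^sup>*" if "u < n" for u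
    using that
  proof (induction "d u" arbitrary: u rule: less_induct)
    case less
    show ?case
    proof (cases "u = r")
      case False
      then have u: "u \<in> ?U" using less by simp
      then have "(f u, r) \<in> (adjacency ?F)\<^sup>*" using hU pn fU by (intro less) auto
      moreover have "(u, f u) \<in> adjacency ?F" using u unfolding adjacency_def by auto
      ultimately show ?thesis by (rule converse_rtrancl_into_rtrancl[rotated])
    qed simp
  qed
  have FF: "?F = F"
  proof (rule ccontr)
    assume "?F \<noteq> F"
    then obtain e where e: "e \<in> F" "e \<notin> ?F" using sub by blast
    then obtain a b where ab: "e = {a, b}" "a \<noteq> b" "a < n" "b < n"
      using Fe[of e] by (auto simp: card_2_iff)
    have "(a, b) \<in> (adjacency ?F)\<^sup>*"
      using to_r[OF ab(3)] adjacency_rtrancl_sym[OF to_r[OF ab(4)]] by (rule rtrancl_trans)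
    from graph_cycle_if_path_avoids_edge[OF this sub _ _ ab(2)] show False
      using e acyc unfolding ab by blast
  qed
  have inj: "inj_on ?e ?U"
  proof (rule inj_onI)
    fix u v assume u: "u \<in> ?U" and v: "v \<in> ?U" and eq: "?e u = ?e v"
    show "u = v"
    proof (rule ccontr)
      assume "u \<noteq> v"
      then have "u = f v" "f u = v" using eq by (auto simp: doubleton_eq_iff)
      then show False using hU[OF u] hU[OF v] by simp
    qed
  qed
  \<comment> \<open>A vertex that is nobody's parent is on no edge but its own parent edge, so its
    degree is at most one.\<close>
  have "NT \<subseteq> f ` {..<n}"
  proof
    fix v assume v: "v \<in> NT"
    show "v \<in> f ` {..<n}"
    proof (rule ccontr)
      assume nv: "v \<notin> f ` {..<n}"
      have "{e \<in> F. v \<in> e} \<subseteq> {?e v}"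
        using nv unfolding FF[symmetric] by auto
      then have "card {e \<in> F. v \<in> e} \<le> card {?e v}" by (intro card_mono) auto
      then show False using deg[OF v] unfolding degree_in_def by simp
    qed
  qed
  moreover have "f \<in> acyclic_maps n"
    unfolding acyclic_maps_def parent_maps_def
  proof (intro CollectI conjI exI[of _ d])
    show "\<forall>u<n. f u < n \<longrightarrow> d (f u) < d u"
      using hU unfolding f_def by auto
  qed (use r pn in \<open>auto simp: f_def intro: less_imp_le\<close>)
  moreover have "\<forall>u<n. f u < n \<longrightarrow> {u, f u} \<in> E"
    using sub FE unfolding f_def by auto
  moreover have "f r = n" unfolding f_def by simp
  ultimately have "f \<in> tree_maps n E r NT"
    unfolding tree_maps_def forest_maps_def using pn fU by auto
  moreover have "map_weight n r w f = sum w F"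
    unfolding map_weight_def FF[symmetric] by (simp add: sum.reindex[OF inj])
  ultimately show ?thesis by blast
qed

section \<open>Inclusion-exclusion over sets of forbidden parents\<close>

lemma sum_Pow_alternating:
  assumes "finite A"
  shows "(\<Sum>X\<in>Pow A. (-1) ^ card X :: int) = of_bool (A = {})"
proof -
  have "(\<Sum>X\<in>Pow A. (-1) ^ card X :: int) = (\<Sum>X\<in>Pow A. (\<Prod>x\<in>X. - 1) * (\<Prod>x\<in>A - X. 1))"
    by simp
  also have "\<dots> = (\<Prod>x\<in>A. - 1 + 1)" by (rule prod_add[OF assms, symmetric])
  also have "\<dots> = of_bool (A = {})" using assms by (auto simp: card_eq_0_iff)
  finally show ?thesis .
qed

text \<open>With \<open>A\<close> the non-terminals and \<open>B\<close> the set of parents of a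
  map, this is the sieve that keeps exactly the maps under which every non-terminal is a
  parent.\<close>

lemma sum_Pow_alternating_disjoint:
  assumes "finite A"
  shows "(\<Sum>X\<in>Pow A. (-1) ^ card X * of_bool (X \<inter> B = {}) :: int) = of_bool (A \<subseteq> B)"
proof -
  have "(\<Sum>X\<in>Pow A. (-1) ^ card X * of_bool (X \<inter> B = {}) :: int)
      = (\<Sum>X\<in>Pow (A - B). (-1) ^ card X)"
    using assms by (intro sum.mono_neutral_cong_right) auto
  also have "\<dots> = of_bool (A - B = {})" using assms by (intro sum_Pow_alternating) simp
  finally show ?thesis by simp
qed

text \<open>The value \<open>n\<close> is open to every vertex, with weight 1, and is the only one
  open to the root. When all \<open>b u v\<close> are even, this 1 is what makes the diagonal of the
  Laplacian odd.\<close>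

definition avoid_weight ::
  "nat \<Rightarrow> nat \<Rightarrow> (nat \<Rightarrow> nat \<Rightarrow> int) \<Rightarrow> nat set \<Rightarrow> nat \<Rightarrow> nat \<Rightarrow> int" where
  "avoid_weight n r b X u v = (if v = n then 1 else if u = r \<or> v \<in> X then 0 else b u v)"

definition forest_exponent :: "nat \<Rightarrow> (nat set \<Rightarrow> nat) \<Rightarrow> (nat \<Rightarrow> nat) \<Rightarrow> nat" where
  "forest_exponent n g f = (\<Sum>u | u < n \<and> f u < n. g {u, f u})"

theorem inclusion_exclusion_forests:
  fixes z :: int
  assumes NT: "NT \<subseteq> {..<n}" and r: "r < n"
    and b: "\<And>u v. u < n \<Longrightarrow> v < n \<Longrightarrow> b u v = (if {u, v} \<in> E then z ^ g {u, v} else 0)"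
  shows "(\<Sum>X\<in>Pow NT. (-1) ^ card X * det (laplace_matrix n (avoid_weight n r b X)))
    = (\<Sum>f\<in>forest_maps n E r NT. z ^ forest_exponent n g f)"
proof -
  have fin: "finite NT" using NT finite_subset by blast
  let ?A = "{f \<in> acyclic_maps n. f r = n \<and> (\<forall>u<n. f u < n \<longrightarrow> {u, f u} \<in> E)}"
  \<comment> \<open>The set \<open>X\<close> enters the product only as a disjointness indicator.
    After the sums are exchanged, the sum over \<open>X\<close> is therefore the sieve above and the
    monomial is a constant factor.\<close>
  have prod: "(\<Prod>u = 0..<n. avoid_weight n r b X u (f u))
      = of_bool (f \<in> ?A) * of_bool (X \<inter> f ` {..<n} = {}) * z ^ forest_exponent n g f"
    if f: "f \<in> acyclic_maps n" and X: "X \<in> Pow NT" for f X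
  proof (cases "f \<in> ?A \<and> X \<inter> f ` {..<n} = {}")
    case True
    have "(\<Prod>u = 0..<n. avoid_weight n r b X u (f u))
        = (\<Prod>u = 0..<n. if f u < n then z ^ g {u, f u} else 1)"
    proof (rule prod.cong)
      fix u assume "u \<in> {0..<n}"
      then have u: "u < n" by simp
      have "f u \<le> n" using f u unfolding acyclic_maps_def parent_maps_def by simp
      moreover have "u \<noteq> r" if "f u < n" using True that by auto
      moreover have "f u \<notin> X" using True u by blast
      ultimately show "avoid_weight n r b X u (f u) = (if f u < n then z ^ g {u, f u} else 1)"
        using True u by (auto simp: avoid_weight_def b)
    qed simp
    also have "\<dots> = (\<Prod>u | u < n \<and> f u < n. z ^ g {u, f u})"
      by (subst prod.inter_filter[symmetric]) (auto intro!: prod.cong)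
    also have "\<dots> = z ^ forest_exponent n g f"
      unfolding forest_exponent_def by (simp add: power_sum)
    finally show ?thesis using True by simp
  next
    case False
    have "\<exists>u<n. avoid_weight n r b X u (f u) = 0"
    proof (cases "X \<inter> f ` {..<n} = {}")
      case True
      then have "f \<notin> ?A" using False by blast
      have "f r \<le> n" using f r unfolding acyclic_maps_def parent_maps_def by simp
      from \<open>f \<notin> ?A\<close> consider "f r \<noteq> n" | u where "u < n" "f u < n" "{u, f u} \<notin> E"
        using f by blast
      then show ?thesis
      proof cases
        case 1
        then show ?thesis using r unfolding avoid_weight_def by auto
      next
        case 2
        then show ?thesis by (intro exI[of _ u]) (auto simp: avoid_weight_def b)
      qed
    next
      case False
      then obtain u where "u < n" "f u \<in> X" by blast
      moreover from this have "f u < n" using X NT by blast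
      ultimately show ?thesis unfolding avoid_weight_def by auto
    qed
    then have "(\<Prod>u = 0..<n. avoid_weight n r b X u (f u)) = 0" by (auto intro: prod_zero)
    then show ?thesis using False by auto
  qed
  have "(\<Sum>X\<in>Pow NT. (-1) ^ card X * det (laplace_matrix n (avoid_weight n r b X)))
    = (\<Sum>X\<in>Pow NT. \<Sum>f\<in>acyclic_maps n. (-1) ^ card X *
        (of_bool (f \<in> ?A) * of_bool (X \<inter> f ` {..<n} = {}) * z ^ forest_exponent n g f))"
    by (intro sum.cong refl) (simp add: det_laplace_matrix sum_distrib_left prod del: mem_Collect_eq)
  also have "\<dots> = (\<Sum>f\<in>acyclic_maps n. \<Sum>X\<in>Pow NT. of_bool (f \<in> ?A) * z ^ forest_exponent n g f *
        ((-1) ^ card X * of_bool (X \<inter> f ` {..<n} = {})))"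
    by (subst sum.swap) (simp add: algebra_simps del: mem_Collect_eq)
  also have "\<dots> = (\<Sum>f\<in>acyclic_maps n. of_bool (f \<in> ?A) * z ^ forest_exponent n g f *
        of_bool (NT \<subseteq> f ` {..<n}))"
    by (simp add: sum_distrib_left[symmetric] sum_Pow_alternating_disjoint[OF fin] del: mem_Collect_eq)
  also have "\<dots> = (\<Sum>f\<in>forest_maps n E r NT. z ^ forest_exponent n g f)"
    by (intro sum.mono_neutral_cong_right) (auto simp: finite_acyclic_maps forest_maps_def)
  finally show ?thesis .
qed

section \<open>Exponents read off as digits in base z\<close>

lemma sum_powers_less:
  fixes z :: int
  assumes "finite F" "int (card F) < z" "\<And>f. f \<in> F \<Longrightarrow> g f < N"
  shows "(\<Sum>f\<in>F. z ^ g f) < z ^ N"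
proof (cases "F = {}")
  case True
  then show ?thesis using assms(2) by simp
next
  case False
  then obtain N' where N: "N = Suc N'" using assms(3) by (cases N) auto
  have z: "1 \<le> z" using assms(2) by linarith
  have "(\<Sum>f\<in>F. z ^ g f) \<le> (\<Sum>f\<in>F. z ^ N')"
    using assms(3) z N by (intro sum_mono power_increasing) (auto simp: less_Suc_eq_le)
  also have "\<dots> = int (card F) * z ^ N'" by simp
  also have "\<dots> < z * z ^ N'"
    using z assms(2) by (intro mult_strict_right_mono) auto
  finally show ?thesis using N by simp
qed

text \<open>The terms of exponent below \<open>N\<close> add up to less than \<open>z ^ N\<close>,
  there being fewer than \<open>z\<close> of them; the others are multiples of it. Quotient and
  remainder thus separate the two groups.\<close>

lemma sum_powers_split:
  fixes z :: int
  assumes "finite F" "int (card F) < z"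
  shows "(\<Sum>f\<in>F. z ^ g f) div z ^ N = (\<Sum>f | f \<in> F \<and> N \<le> g f. z ^ (g f - N))" (is ?div)
    and "(\<Sum>f\<in>F. z ^ g f) mod z ^ N = (\<Sum>f | f \<in> F \<and> g f < N. z ^ g f)" (is ?mod)
proof -
  let ?H = "{f \<in> F. N \<le> g f}" and ?L = "{f \<in> F. g f < N}"
  have "(\<Sum>f\<in>F. z ^ g f) = (\<Sum>f\<in>?L. z ^ g f) + (\<Sum>f\<in>?H. z ^ g f)"
    using assms(1) by (subst sum.union_disjoint[symmetric]) (auto intro!: sum.cong)
  also have "(\<Sum>f\<in>?H. z ^ g f) = z ^ N * (\<Sum>f\<in>?H. z ^ (g f - N))"
    unfolding sum_distrib_left by (intro sum.cong) (auto simp flip: power_add)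
  finally have eq: "(\<Sum>f\<in>F. z ^ g f) = (\<Sum>f\<in>?L. z ^ g f) + z ^ N * (\<Sum>f\<in>?H. z ^ (g f - N))" .
  have "card ?L \<le> card F" using assms(1) by (intro card_mono) auto
  then have "(\<Sum>f\<in>?L. z ^ g f) < z ^ N"
    using assms by (intro sum_powers_less) auto
  moreover have "0 \<le> (\<Sum>f\<in>?L. z ^ g f)" using assms(2) by (intro sum_nonneg) auto
  ultimately show ?div ?mod using assms(2) unfolding eq by auto
qed

text \<open>After both cuts a sum of positive powers is left, one for each map whose exponent lies
  in the window. Nothing can cancel, so nonvanishing means that the window is hit.\<close>

lemma digits_nonzero_iff:
  fixes z :: int
  assumes "finite F" "int (card F) < z"
  shows "(\<Sum>f\<in>F. z ^ g f) div z ^ A mod z ^ N \<noteq> 0 \<longleftrightarrow> (\<exists>f\<in>F. A \<le> g f \<and> g f < A + N)"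
proof -
  let ?H = "{f \<in> F. A \<le> g f}"
  have "card ?H \<le> card F" using assms(1) by (intro card_mono) auto
  then have "(\<Sum>f\<in>F. z ^ g f) div z ^ A mod z ^ N
      = (\<Sum>f | f \<in> ?H \<and> g f - A < N. z ^ (g f - A))"
    using assms by (simp add: sum_powers_split)
  moreover have "(\<Sum>f | f \<in> ?H \<and> g f - A < N. z ^ (g f - A)) \<noteq> 0
      \<longleftrightarrow> {f. f \<in> ?H \<and> g f - A < N} \<noteq> {}"
    using assms by (subst sum_nonneg_eq_0_iff) auto
  ultimately show ?thesis by (auto simp: less_diff_conv2 Bex_def add.commute)
qed

section \<open>Separation of spanning trees from proper forests\<close>

lemma forest_exponent_tree_map:
  assumes f: "f \<in> tree_maps n E r NT" and r: "r < n"
  shows "forest_exponent n (\<lambda>e. K + w e) f = K * (n - 1) + map_weight n r w f"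
proof -
  have "{u. u < n \<and> f u < n} = {..<n} - {r}"
    using f unfolding tree_maps_def forest_maps_def by auto
  then show ?thesis
    unfolding forest_exponent_def map_weight_def using r by (simp add: sum.distrib)
qed

text \<open>A missing edge costs \<open>K\<close>, which is more than all weights of the remaining
  edges together can make up for.\<close>

lemma forest_exponent_forest_map:
  assumes f: "f \<in> forest_maps n E r NT" "f \<notin> tree_maps n E r NT" and r: "r < n"
    and w: "\<And>e. e \<in> E \<Longrightarrow> w e \<le> B" and K: "(n - 1) * B < K"
  shows "forest_exponent n (\<lambda>e. K + w e) f < K * (n - 1)"
proof -
  obtain u0 where u0: "u0 < n" "u0 \<noteq> r" "\<not> f u0 < n" and fr: "f r = n"
    and E: "\<And>u. u < n \<Longrightarrow> f u < n \<Longrightarrow> {u, f u} \<in> E"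
    using f unfolding tree_maps_def forest_maps_def by blast
  define A where "A = {u. u < n \<and> f u < n}"
  \<comment> \<open>Neither the root nor \<open>u0\<close> has a parent, so at most n - 2 edges are
    present.\<close>
  have "card A \<le> card ({..<n} - {r, u0})"
    unfolding A_def using fr u0 by (intro card_mono) auto
  also have "\<dots> = n - 2" using r u0 by (simp add: card_Diff_subset)
  finally have A: "card A \<le> n - 2" .
  have n: "2 \<le> n" using r u0 by linarith
  have "forest_exponent n (\<lambda>e. K + w e) f \<le> (\<Sum>u\<in>A. K + B)"
    unfolding forest_exponent_def A_def using w E by (intro sum_mono) auto
  also have "\<dots> = card A * (K + B)" by simp
  also have "\<dots> \<le> (n - 2) * (K + B)" using A by (rule mult_le_mono1)
  also have "\<dots> = (n - 2) * K + (n - 2) * B" by (rule distrib_left)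
  also have "(n - 2) * B \<le> (n - 1) * B" by (intro mult_le_mono1) simp
  also have "(n - 2) * K + (n - 1) * B < (n - 2) * K + K" using K by simp
  also have "\<dots> = K * (n - 1)" using n by (auto simp: algebra_simps dest!: le_Suc_ex simp: numeral_2_eq_2)
  finally show ?thesis by simp
qed

lemma map_weight_less:
  assumes f: "f \<in> tree_maps n E r NT" and r: "r < n"
    and w: "\<And>e. e \<in> E \<Longrightarrow> w e \<le> B" and K: "(n - 1) * B < K"
  shows "map_weight n r w f < K"
proof -
  have "map_weight n r w f \<le> (\<Sum>u\<in>{..<n} - {r}. B)"
    unfolding map_weight_def using f w unfolding tree_maps_def forest_maps_def
    by (intro sum_mono) auto
  also have "\<dots> = (n - 1) * B" using r by simp
  finally show ?thesis using K by simp
qed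

text \<open>This is where the base of the digits comes from: there are at most
  \<open>(n + 1) ^ n\<close> maps, and \<open>n + 1 \<le> 2 ^ n\<close> turns this into
  \<open>2 ^ (n * n)\<close>. The extra factor two gives the strict inequality that the digits
  need.\<close>

lemma card_forest_maps_less:
  assumes "0 < n"
  shows "int (card (forest_maps n E r NT)) < 2 ^ (n * n + 1)"
proof -
  have "card (forest_maps n E r NT) \<le> card (parent_maps n)"
    by (intro card_mono finite_parent_maps) (auto simp: forest_maps_def acyclic_maps_def)
  also have "\<dots> \<le> (n + 1) ^ n" by (rule card_parent_maps_le)
  also have "\<dots> \<le> (2 ^ n) ^ n"
    by (intro power_mono) (simp_all add: Suc_le_eq)
  also have "\<dots> = 2 ^ (n * n)" by (simp add: power_mult)
  also have "\<dots> < 2 ^ (n * n + 1)" by simp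
  finally show ?thesis using of_nat_less_iff[of _ "2 ^ (n * n + 1)", where 'a = int] by simp
qed

definition forest_sum ::
  "nat \<Rightarrow> nat set set \<Rightarrow> nat \<Rightarrow> nat set \<Rightarrow> (nat set \<Rightarrow> nat) \<Rightarrow> nat \<Rightarrow> int" where
  "forest_sum n E r NT w K =
     (\<Sum>f\<in>forest_maps n E r NT. (2 ^ (n * n + 1)) ^ forest_exponent n (\<lambda>e. K + w e) f)"

lemma forest_sum_nonneg: "0 \<le> forest_sum n E r NT w K"
  unfolding forest_sum_def by (intro sum_nonneg) simp

lemma finite_forest_maps: "finite (forest_maps n E r NT)"
  by (rule finite_subset[OF _ finite_acyclic_maps[of n]]) (auto simp: forest_maps_def)

text \<open>At most n - 1 edges contribute \<open>K\<close> each and all weights together less than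
  \<open>K\<close>, so no exponent reaches \<open>K * n\<close>. This bound determines the modulus
  used in the elimination.\<close>

lemma forest_sum_less:
  assumes r: "r < n" and w: "\<And>e. e \<in> E \<Longrightarrow> w e \<le> B" and K: "(n - 1) * B < K"
  shows "forest_sum n E r NT w K < (2 ^ (n * n + 1)) ^ (K * n)"
  unfolding forest_sum_def
proof (rule sum_powers_less[OF finite_forest_maps card_forest_maps_less])
  fix f assume f: "f \<in> forest_maps n E r NT"
  have n: "K * (n - 1) + K = K * n" using r by (cases n) auto
  show "forest_exponent n (\<lambda>e. K + w e) f < K * n"
  proof (cases "f \<in> tree_maps n E r NT")
    case True
    have "map_weight n r w f < K" by (rule map_weight_less[OF True r, of w, OF w K])
    then show ?thesis using forest_exponent_tree_map[OF True r, of K w] n by linarith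
  next
    case False
    show ?thesis using forest_exponent_forest_map[OF f False r, of w, OF w K] n by linarith
  qed
qed (use r in simp)

text \<open>The quotient drops the proper forests, all of exponent below \<open>K * (n - 1)\<close>;
  the remainder drops the trees of weight \<open>N\<close> and more.\<close>

theorem forest_sum_digits:
  assumes NT: "NT \<subseteq> {..<n}" and r: "r < n" and rNT: "r \<in> NT \<Longrightarrow> NT = {..<n}"
    and w: "\<And>e. e \<in> E \<Longrightarrow> w e \<le> B" and K: "(n - 1) * B < K"
  defines "z \<equiv> 2 ^ (n * n + 1)"
  shows "forest_sum n E r NT w K div z ^ (K * (n - 1)) mod z ^ N \<noteq> 0 \<longleftrightarrow>
    (\<exists>F. nt_spanning_tree {..<n} E NT F \<and> sum w F < N)"
proof -
  let ?x = "forest_exponent n (\<lambda>e. K + w e)"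
  have "forest_sum n E r NT w K div z ^ (K * (n - 1)) mod z ^ N \<noteq> 0 \<longleftrightarrow>
    (\<exists>f\<in>forest_maps n E r NT. K * (n - 1) \<le> ?x f \<and> ?x f < K * (n - 1) + N)"
    unfolding forest_sum_def z_def using r
    by (intro digits_nonzero_iff finite_forest_maps card_forest_maps_less) simp
  also have "\<dots> \<longleftrightarrow> (\<exists>f\<in>tree_maps n E r NT. map_weight n r w f < N)"
  proof (intro iffI; elim bexE)
    fix f assume f: "f \<in> forest_maps n E r NT" "K * (n - 1) \<le> ?x f \<and> ?x f < K * (n - 1) + N"
    then have "f \<in> tree_maps n E r NT"
      using forest_exponent_forest_map[OF f(1) _ r, of w, OF _ w K] by fastforce
    then show "\<exists>f\<in>tree_maps n E r NT. map_weight n r w f < N"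
      using f(2) forest_exponent_tree_map[OF _ r, of f E NT K w] by (intro bexI[of _ f]) auto
  next
    fix f assume f: "f \<in> tree_maps n E r NT" "map_weight n r w f < N"
    then show "\<exists>f\<in>forest_maps n E r NT. K * (n - 1) \<le> ?x f \<and> ?x f < K * (n - 1) + N"
      using forest_exponent_tree_map[OF f(1) r, of K w]
      by (intro bexI[of _ f]) (auto simp: tree_maps_def)
  qed
  also have "\<dots> \<longleftrightarrow> (\<exists>F. nt_spanning_tree {..<n} E NT F \<and> sum w F < N)"
    using tree_of_tree_map[OF _ r NT rNT, of _ E w] tree_map_of_tree[OF _ r NT, of E _ w] by metis
  finally show ?thesis .
qed

text \<open>All exponents are below \<open>K * n = K + K * (n - 1)\<close>, so the quotient is below
  \<open>z ^ K\<close> and equals its own remainder modulo \<open>z ^ K\<close>. Feasibility can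
  thus be tested on the quotient itself.\<close>

corollary forest_sum_div_eq_0_iff:
  assumes NT: "NT \<subseteq> {..<n}" and r: "r < n" and rNT: "r \<in> NT \<Longrightarrow> NT = {..<n}"
    and w: "\<And>e. e \<in> E \<Longrightarrow> w e \<le> B" and K: "(n - 1) * B < K"
  defines "z \<equiv> 2 ^ (n * n + 1)"
  shows "forest_sum n E r NT w K div z ^ (K * (n - 1)) = 0 \<longleftrightarrow>
    (\<nexists>F. nt_spanning_tree {..<n} E NT F)"
    and "nt_spanning_tree {..<n} E NT F \<Longrightarrow> sum w F < K"
proof -
  show less: "sum w F < K" if F: "nt_spanning_tree {..<n} E NT F" for F
  proof -
    obtain f where f: "f \<in> tree_maps n E r NT" "map_weight n r w f = sum w F"
      using tree_map_of_tree[OF F r NT, of w] by blast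
    show ?thesis using map_weight_less[OF f(1) r, of w, OF w K] f(2) by simp
  qed
  let ?P = "forest_sum n E r NT w K div z ^ (K * (n - 1))"
  have z: "0 < z" unfolding z_def by simp
  have "K * n = K + K * (n - 1)" using r by (cases n) auto
  then have "forest_sum n E r NT w K < z ^ K * z ^ (K * (n - 1))"
    using forest_sum_less[OF r, of E w, OF w K, of NT] unfolding z_def by (simp only: power_add)
  moreover have "?P * z ^ (K * (n - 1)) \<le> forest_sum n E r NT w K"
    using z by (simp add: minus_mod_eq_div_mult[symmetric])
  ultimately have "?P * z ^ (K * (n - 1)) < z ^ K * z ^ (K * (n - 1))" by linarith
  then have "?P < z ^ K" using z by (simp only: mult_less_cancel_right) simp
  moreover have "0 \<le> ?P" using z by (simp add: forest_sum_nonneg pos_imp_zdiv_nonneg_iff)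
  ultimately have "?P mod z ^ K = ?P" by simp
  then have "?P \<noteq> 0 \<longleftrightarrow> (\<exists>F. nt_spanning_tree {..<n} E NT F \<and> sum w F < K)"
    using forest_sum_digits[OF NT r rNT, of E w, OF _ w K, of K] unfolding z_def by simp
  then show "?P = 0 \<longleftrightarrow> (\<nexists>F. nt_spanning_tree {..<n} E NT F)"
    using less by blast
qed

text \<open>An edge outside \<open>F\<close> could be deleted without losing \<open>F\<close>,
  against criticality. So the remaining edge set does not merely contain an optimal tree; it is
  one.\<close>

lemma min_nt_spanning_tree_if_critical:
  assumes "E' \<subseteq> E" and F: "nt_spanning_tree V E' NT F" "sum w F \<le> W"
    and min: "\<And>F'. nt_spanning_tree V E NT F' \<Longrightarrow> W \<le> sum w F'"
    and crit: "\<And>e F'. e \<in> E' \<Longrightarrow> nt_spanning_tree V (E' - {e}) NT F' \<Longrightarrow> W < sum w F'"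
  shows "min_nt_spanning_tree V E w NT E'"
proof -
  have "F = E'"
  proof (rule ccontr)
    assume "F \<noteq> E'"
    then obtain e where "e \<in> E'" "e \<notin> F"
      using F unfolding nt_spanning_tree_def spanning_tree_def by blast
    then have "nt_spanning_tree V (E' - {e}) NT F"
      using F unfolding nt_spanning_tree_def spanning_tree_def by blast
    from crit[OF \<open>e \<in> E'\<close> this] F(2) show False by simp
  qed
  then have "nt_spanning_tree V E NT E'"
    using F assms(1) unfolding nt_spanning_tree_def spanning_tree_def by blast
  then show ?thesis
    unfolding min_nt_spanning_tree_def using min F(2) \<open>F = E'\<close> order_trans by blast
qed

section \<open>Elimination modulo a power of two\<close>

text \<open>Entries are given by a function so that an array in memory can be inserted
  directly.\<close>

definition fun_det :: "nat \<Rightarrow> (nat \<Rightarrow> nat \<Rightarrow> int) \<Rightarrow> int" where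
  "fun_det n A = det (mat n n (\<lambda>(i, j). A i j))"

lemma fun_det_Leibniz:
  "fun_det n A = (\<Sum>p | p permutes {0..<n}. signof p * (\<Prod>i = 0..<n. A i (p i)))"
proof -
  have "mat n n (\<lambda>(i, j). A i j) \<in> carrier_mat n n" by simp
  from det_def'[OF this] show ?thesis
    unfolding fun_det_def by (auto intro!: sum.cong prod.cong dest: permutes_in_image)
qed

lemma fun_det_cong_mod:
  assumes "\<And>i j. i < n \<Longrightarrow> j < n \<Longrightarrow> A i j mod M = B i j mod M"
  shows "fun_det n A mod M = fun_det n B mod M"
  unfolding fun_det_Leibniz
  by (rule cong_sum[unfolded cong_def], rule cong_mult[unfolded cong_def], simp,
      rule cong_prod[unfolded cong_def])
    (auto intro!: assms dest: permutes_in_image)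

lemma fun_det_row_op:
  assumes "i < n" "k < n" "k \<noteq> i"
  shows "fun_det n (\<lambda>i' j. if i' = i then A i j - f * A k j else A i' j) = fun_det n A"
proof -
  let ?A = "mat n n (\<lambda>(i, j). A i j)"
  have "mat n n (\<lambda>(i', j). if i' = i then A i j - f * A k j else A i' j) = addrow (- f) i k ?A"
    using assms by (intro eq_matI) auto
  moreover have "det (addrow (- f) i k ?A) = det ?A"
    using assms by (intro det_addrow[where n = n]) auto
  ultimately show ?thesis unfolding fun_det_def by simp
qed

lemma fun_det_triangular:
  assumes "\<And>i j. j < i \<Longrightarrow> i < n \<Longrightarrow> A i j = 0"
  shows "fun_det n A = (\<Prod>i<n. A i i)"
proof -
  let ?A = "mat n n (\<lambda>(i, j). A i j)"
  have "upper_triangular ?A" unfolding upper_triangular_def using assms by auto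
  then have "det ?A = prod_list (diag_mat ?A)" by (rule det_upper_triangular[where n = n]) simp
  also have "diag_mat ?A = map (\<lambda>i. A i i) [0..<n]" unfolding diag_mat_def by auto
  finally show ?thesis
    unfolding fun_det_def
    by (simp add: prod.distinct_set_conv_list[symmetric] atLeast0LessThan)
qed

text \<open>The iteration \<open>x \<mapsto> 1 + (1 - p) * x\<close> sums the geometric series for
  \<open>1 / p\<close>: its partial sum of \<open>t\<close> terms, multiplied by \<open>p\<close>,
  is \<open>1 - (1 - p) ^ t\<close>.\<close>

lemma mult_inverse_step:
  fixes p x :: int
  assumes "(p * x) mod M = (1 - (1 - p) ^ t) mod M"
  shows "(p * ((1 + (1 - p) * x) mod M)) mod M = (1 - (1 - p) ^ Suc t) mod M"
proof -
  have "[p * x = 1 - (1 - p) ^ t] (mod M)" using assms unfolding cong_def .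
  then have "[p + (1 - p) * (p * x) = p + (1 - p) * (1 - (1 - p) ^ t)] (mod M)"
    by (intro cong_add cong_mult) auto
  moreover have "p + (1 - p) * (p * x) = p * (1 + (1 - p) * x)" by (simp add: algebra_simps)
  moreover have "p + (1 - p) * (1 - (1 - p) ^ t) = 1 - (1 - p) ^ Suc t" by (simp add: algebra_simps)
  ultimately show ?thesis unfolding cong_def by (simp add: mod_mult_right_eq)
qed

text \<open>For odd \<open>p\<close> the error \<open>(1 - p) ^ t\<close> is divisible by
  \<open>2 ^ t\<close>, hence invisible modulo \<open>2 ^ e\<close> after \<open>e\<close>
  terms.\<close>

lemma mult_inverse_final:
  fixes p x :: int
  assumes "(p * x) mod 2 ^ e = (1 - (1 - p) ^ t) mod 2 ^ e" "odd p" "e \<le> t"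
  shows "[p * x = 1] (mod 2 ^ e)"
proof -
  have "2 dvd 1 - p" using assms(2) by simp
  then have "2 ^ t dvd (1 - p) ^ t" by (rule dvd_power_same)
  then have "2 ^ e dvd (1 - p) ^ t" using assms(3) power_le_dvd by blast
  then have "[1 - (1 - p) ^ t = 1 - 0] (mod 2 ^ e)"
    by (intro cong_diff) (auto simp: cong_0_iff)
  then show ?thesis using assms(1) unfolding cong_def by simp
qed

text \<open>The parity condition keeps the pivots invertible modulo the power of two \<open>M\<close>.\<close>

definition elim_inv ::
  "nat \<Rightarrow> int \<Rightarrow> int \<Rightarrow> nat \<Rightarrow> nat \<Rightarrow> (nat \<Rightarrow> nat \<Rightarrow> int) \<Rightarrow> bool" where
  "elim_inv n M D k i A \<longleftrightarrow>
     (\<forall>i<n. \<forall>j<n. 0 \<le> A i j \<and> A i j < M \<and> (odd (A i j) \<longleftrightarrow> i = j)) \<and>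
     [fun_det n A = D] (mod M) \<and>
     (\<forall>j<k. \<forall>i'<n. j < i' \<longrightarrow> A i' j = 0) \<and> (\<forall>i'<i. k < i' \<longrightarrow> A i' k = 0)"

lemma elim_inv_cong:
  assumes inv: "elim_inv n M D k i A"
    and eq: "\<And>i j. i < n \<Longrightarrow> j < n \<Longrightarrow> B i j = A i j" and k: "k \<le> n" and i: "i \<le> n"
  shows "elim_inv n M D k i B"
proof -
  have "mat n n (\<lambda>(i, j). B i j) = mat n n (\<lambda>(i, j). A i j)" using eq by (intro cong_mat) auto
  then have "fun_det n B = fun_det n A" unfolding fun_det_def by simp
  moreover have "B i' j = 0" if "j < k" "i' < n" "j < i'" for i' j
    using inv that k eq[of i' j] unfolding elim_inv_def by simp
  moreover have "B i' k = 0" if "i' < i" "k < i'" for i'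
    using inv that i eq[of i' k] unfolding elim_inv_def by simp
  ultimately show ?thesis using inv eq unfolding elim_inv_def by simp
qed

text \<open>In the invariant \<open>k\<close> counts the finished columns and \<open>i\<close> the
  rows visited so far in column \<open>k\<close>.\<close>

lemma elim_inv_Suc_col: "elim_inv n M D k n A \<Longrightarrow> elim_inv n M D (Suc k) 0 A"
  unfolding elim_inv_def less_Suc_eq by auto

lemma elim_inv_skip: "elim_inv n M D k i A \<Longrightarrow> i \<le> k \<Longrightarrow> elim_inv n M D k (Suc i) A"
  unfolding elim_inv_def less_Suc_eq by auto

text \<open>The entry to be cleared is off the diagonal, hence even, and so is the multiplier
  \<open>f\<close>. Subtracting an even multiple of the pivot row preserves all parities, in
  particular those of the later pivots. The cleared entry is congruent to 0 and reduced, hence equal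
  to 0.\<close>

lemma elim_inv_row:
  assumes inv: "elim_inv n M D k i A" and k: "k < i" and i: "i < n" and p: "[A k k * p = 1] (mod M)"
    and M: "even M" "0 < M" and f: "f = (A i k * p) mod M"
  defines "B \<equiv> (\<lambda>i' j. if i' = i then (A i j - f * A k j) mod M else A i' j)"
  shows "elim_inv n M D k (Suc i) B"
proof -
  have A: "\<And>i j. i < n \<Longrightarrow> j < n \<Longrightarrow> 0 \<le> A i j \<and> A i j < M \<and> (odd (A i j) \<longleftrightarrow> i = j)"
    and D: "[fun_det n A = D] (mod M)"
    and z: "\<And>j i'. j < k \<Longrightarrow> i' < n \<Longrightarrow> j < i' \<Longrightarrow> A i' j = 0"
    and zk: "\<And>i'. i' < i \<Longrightarrow> k < i' \<Longrightarrow> A i' k = 0"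
    using inv unfolding elim_inv_def by auto
  have "even (A i k)" using A[of i k] k i by auto
  then have ef: "even f" unfolding f using M(1) by (simp add: dvd_mod)
  have B: "0 \<le> B i' j \<and> B i' j < M \<and> (odd (B i' j) \<longleftrightarrow> i' = j)" if "i' < n" "j < n" for i' j
  proof (cases "i' = i")
    case True
    have "even (x mod M) \<longleftrightarrow> even x" for x using M(1) by (meson dvd_mod_iff)
    then show ?thesis using True that A[of i j] ef M unfolding B_def by auto
  qed (use A[OF that] in \<open>simp add: B_def\<close>)
  have "fun_det n B mod M
      = fun_det n (\<lambda>i' j. if i' = i then A i j - f * A k j else A i' j) mod M"
    by (rule fun_det_cong_mod) (simp add: B_def)
  also have "fun_det n (\<lambda>i' j. if i' = i then A i j - f * A k j else A i' j) = fun_det n A"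
    using k i by (intro fun_det_row_op) auto
  finally have "[fun_det n B = D] (mod M)" using D unfolding cong_def by simp
  moreover have "B i' j = 0" if "j < k" "i' < n" "j < i'" for i' j
    using that z[of j i'] z[of j k] k i unfolding B_def by auto
  moreover have "B i' k = 0" if "i' < Suc i" "k < i'" for i'
  proof (cases "i' = i")
    case True
    have "[f * A k k = A i k * p * A k k] (mod M)"
      unfolding f by (intro cong_mult) (auto simp: cong_def)
    also have "A i k * p * A k k = A i k * (A k k * p)" by (simp add: algebra_simps)
    also have "[\<dots> = A i k * 1] (mod M)" by (intro cong_mult p) simp
    finally have "[A i k - f * A k k = A i k - A i k] (mod M)" by (intro cong_diff) auto
    then show ?thesis using True unfolding B_def cong_def by simp
  next
    case False
    then show ?thesis using that zk[of i'] unfolding B_def by simp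
  qed
  ultimately show ?thesis unfolding elim_inv_def using B by blast
qed

lemma elim_inv_final:
  assumes "elim_inv n M D n 0 A"
  shows "[(\<Prod>i<n. A i i) = D] (mod M)"
proof -
  have "fun_det n A = (\<Prod>i<n. A i i)"
    using assms unfolding elim_inv_def by (intro fun_det_triangular) auto
  then show ?thesis using assms unfolding elim_inv_def by simp
qed

section \<open>Total correctness with step counts\<close>

text \<open>A constant counts with its absolute value instead of its length. The excess is harmless
  since the program is fixed, and one number then governs both values and costs.\<close>

fun expr_weight :: "expr \<Rightarrow> nat" where
  "expr_weight (Const a) = nat \<bar>a\<bar> + 1"
| "expr_weight (Load x i) = 1 + expr_weight i"
| "expr_weight (Op f a b) = 1 + expr_weight a + expr_weight b"

text \<open>Bounds the weight of every expression occurring in the program, so that one cost bound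
  holds throughout a run.\<close>

fun prog_weight :: "prog \<Rightarrow> nat" where
  "prog_weight Skip = 1"
| "prog_weight (Store x i a) = expr_weight i + expr_weight a"
| "prog_weight (Seq c d) = prog_weight c + prog_weight d"
| "prog_weight (Cond b c d) = expr_weight b + prog_weight c + prog_weight d"
| "prog_weight (While b c) = expr_weight b + prog_weight c"

fun writes :: "prog \<Rightarrow> string set" where
  "writes Skip = {}"
| "writes (Store x i a) = {x}"
| "writes (Seq c d) = writes c \<union> writes d"
| "writes (Cond b c d) = writes c \<union> writes d"
| "writes (While b c) = writes c"

lemma bits_le: "\<bar>a\<bar> \<le> 2 ^ m \<Longrightarrow> bits a \<le> m + 1"
proof -
  assume "\<bar>a\<bar> \<le> 2 ^ m"
  also have "(2::int) ^ m < 2 ^ (m + 1)" by simp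
  finally have "bitlen \<bar>a\<bar> \<le> int (m + 1)"
    by (subst bitlen_le_iff_power) (simp_all only: nat_int of_nat_0_le_iff)
  then show ?thesis unfolding bits_def by simp
qed

lemma abs_div_le: "\<bar>a div b\<bar> \<le> \<bar>a :: int\<bar>"
proof -
  have pos: "\<bar>x div y\<bar> \<le> \<bar>x\<bar>" if "0 < y" for x y :: int
  proof (cases "0 \<le> x")
    case True
    then show ?thesis using that zdiv_mono2[of x 1 y] by (simp add: pos_imp_zdiv_nonneg_iff)
  next
    case False
    then show ?thesis using that zdiv_mono2_neg[of x 1 y] div_neg_pos_less0[of x y] by simp
  qed
  consider "0 < b" | "b = 0" | "0 < - b" by linarith
  then show ?thesis using pos[of b a] pos[of "- b" "- a"] by cases simp_all
qed

lemma abs_apply_op_le: "\<bar>apply_op f a b\<bar> \<le> max 1 (max (\<bar>a\<bar> + \<bar>b\<bar>) (\<bar>a\<bar> * \<bar>b\<bar>))"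
proof (cases f)
  case Div
  have "\<bar>a div b\<bar> \<le> \<bar>a\<bar>" by (rule abs_div_le)
  then show ?thesis using Div by simp
next
  case Mod
  have "\<bar>a mod b\<bar> \<le> \<bar>a\<bar> + \<bar>b\<bar>"
  proof (cases "b = 0")
    case False
    then show ?thesis using abs_mod_less[of b a] by linarith
  qed simp
  then show ?thesis using Mod by (simp add: le_max_iff_disj)
qed (auto simp: abs_mult le_max_iff_disj)

text \<open>Lengths at most add up under multiplication, and an addition costs one more bit, which
  the 1 in the weight of an operation pays for.\<close>

lemma val_le:
  fixes s :: state
  assumes s: "\<And>x i. \<bar>s x i\<bar> \<le> 2 ^ m" and m: "0 < m"
  shows "\<bar>val e s\<bar> \<le> 2 ^ (m * expr_weight e)"
proof (induction e)
  case (Const a)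
  have "\<bar>a\<bar> \<le> int (nat \<bar>a\<bar> + 1)" by simp
  also have "int (nat \<bar>a\<bar> + 1) \<le> int (2 ^ (nat \<bar>a\<bar> + 1))"
    using less_exp[of "nat \<bar>a\<bar> + 1"] by (intro zle_int[THEN iffD2]) simp
  also have "\<dots> = 2 ^ (nat \<bar>a\<bar> + 1)" by simp
  also have "\<dots> \<le> (2::int) ^ (m * (nat \<bar>a\<bar> + 1))"
    using m by (intro power_increasing) (cases m, auto)
  finally show ?case by simp
next
  case (Load x i)
  have "\<bar>s x (val i s)\<bar> \<le> 2 ^ m" by (rule s)
  also have "\<dots> \<le> (2::int) ^ (m * expr_weight (Load x i))"
    by (intro power_increasing) auto
  finally show ?case by simp
next
  case (Op f a b)
  define A B where "A = m * expr_weight a" and "B = m * expr_weight b"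
  have pos: "1 \<le> (2::int) ^ A" "1 \<le> (2::int) ^ B" by simp_all
  have prod: "(2::int) ^ A * 2 ^ B = 2 ^ (A + B)" by (simp add: power_add)
  have p1: "(1::int) \<le> 2 ^ (A + B)" by simp
  have p2: "(2::int) ^ A \<le> 2 ^ (A + B)" "(2::int) ^ B \<le> 2 ^ (A + B)" by simp_all
  have IH: "\<bar>val a s\<bar> \<le> 2 ^ A" "\<bar>val b s\<bar> \<le> 2 ^ B"
    using Op.IH unfolding A_def B_def by auto
  have "\<bar>val a s\<bar> * \<bar>val b s\<bar> \<le> 2 ^ (A + B)"
    unfolding prod[symmetric] using IH by (intro mult_mono) auto
  then have "max 1 (max (\<bar>val a s\<bar> + \<bar>val b s\<bar>) (\<bar>val a s\<bar> * \<bar>val b s\<bar>)) \<le> 2 * 2 ^ (A + B)"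
    using IH p1 p2 by (intro max.boundedI) linarith+
  then have "\<bar>apply_op f (val a s) (val b s)\<bar> \<le> 2 * 2 ^ (A + B)"
    by (rule order_trans[OF abs_apply_op_le])
  also have "\<dots> = (2::int) ^ (1 + (A + B))" by simp
  also have "\<dots> \<le> 2 ^ (m * expr_weight (Op f a b))"
    using m by (intro power_increasing) (auto simp: A_def B_def algebra_simps)
  finally show ?case by simp
qed

text \<open>At most \<open>expr_weight e\<close> nodes are charged, and by \<open>val_le\<close>
  each contributes at most \<open>m * expr_weight e + 2\<close>.\<close>

lemma cost_le:
  fixes s :: state
  assumes s: "\<And>x i. \<bar>s x i\<bar> \<le> 2 ^ m" and m: "0 < m"
  shows "cost e s \<le> expr_weight e * (2 + m * expr_weight e)"
proof (induction e)
  case (Const a)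
  have "\<bar>a\<bar> \<le> 2 ^ (m * expr_weight (Const a))"
    using val_le[OF s m, of "Const a"] by simp
  from bits_le[OF this] show ?case by simp
next
  case (Load x i)
  have "bits (s x (val i s)) \<le> m + 1" by (rule bits_le[OF s])
  then show ?case using Load by (simp add: algebra_simps)
next
  case (Op f a b)
  have b: "bits (apply_op f (val a s) (val b s)) \<le> m * expr_weight (Op f a b) + 1"
    using bits_le[OF val_le[OF s m, of "Op f a b"]] by simp
  have "m * expr_weight a \<le> m * expr_weight (Op f a b)"
    "m * expr_weight b \<le> m * expr_weight (Op f a b)"
    by (intro mult_le_mono2; simp)+
  then have "expr_weight a * (2 + m * expr_weight a)
      \<le> expr_weight a * (2 + m * expr_weight (Op f a b))"
    "expr_weight b * (2 + m * expr_weight b)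
      \<le> expr_weight b * (2 + m * expr_weight (Op f a b))"
    by (auto intro: mult_le_mono2 simp del: expr_weight.simps)
  then show ?case using Op b by (simp add: algebra_simps)
qed

text \<open>
  Counts steps instead of bits: \<open>ok\<close> is an invariant bounding the memory, which bounds the cost of
  every expression uniformly (lemma \<open>run_exec\<close>).
\<close>

inductive run :: "(state \<Rightarrow> bool) \<Rightarrow> prog \<Rightarrow> state \<Rightarrow> state \<Rightarrow> nat \<Rightarrow> bool" for ok where
  Skip: "ok s \<Longrightarrow> run ok Skip s s 1"
| Store: "ok s \<Longrightarrow> ok t \<Longrightarrow> t = s(x := (s x)(val i s := val a s)) \<Longrightarrow> run ok (Store x i a) s t 1"
| Seq: "run ok c s s' T1 \<Longrightarrow> run ok d s' t T2 \<Longrightarrow> run ok (Seq c d) s t (T1 + T2)"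
| CondTrue: "ok s \<Longrightarrow> val b s \<noteq> 0 \<Longrightarrow> run ok c s t T \<Longrightarrow> run ok (Cond b c d) s t (1 + T)"
| CondFalse: "ok s \<Longrightarrow> val b s = 0 \<Longrightarrow> run ok d s t T \<Longrightarrow> run ok (Cond b c d) s t (1 + T)"
| WhileFalse: "ok s \<Longrightarrow> val b s = 0 \<Longrightarrow> run ok (While b c) s s 1"
| WhileTrue: "ok s \<Longrightarrow> val b s \<noteq> 0 \<Longrightarrow> run ok c s s' T1 \<Longrightarrow> run ok (While b c) s' t T2 \<Longrightarrow>
    run ok (While b c) s t (1 + T1 + T2)"

lemma run_ok: "run ok c s t T \<Longrightarrow> ok s \<and> ok t"
  by (induction rule: run.induct; blast)

lemma run_frame: "run ok c s t T \<Longrightarrow> x \<notin> writes c \<Longrightarrow> t x = s x"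
  by (induction rule: run.induct) auto

text \<open>A step evaluates at most two expressions, namely address and value of an assignment.
  That is the factor \<open>1 + 2 * C\<close> in time and the surplus \<open>2 * C\<close> in
  space.\<close>

lemma run_exec:
  assumes "run ok c s t T"
    and "\<And>s e. ok s \<Longrightarrow> expr_weight e \<le> W \<Longrightarrow> cost e s \<le> C"
    and "\<And>s. ok s \<Longrightarrow> state_space s \<le> D"
    and "prog_weight c \<le> W"
  shows "\<exists>T' S. exec c s t T' S \<and> T' \<le> T * (1 + 2 * C) \<and> S \<le> D + 2 * C"
  using assms(1,4)
proof (induction rule: run.induct)
  case (Skip s)
  then show ?case using exec.Skip[of s] assms(3)[OF Skip(1)]
    by (intro exI[of _ 1] exI[of _ "state_space s"]) auto
next
  case (Store s t x i a)
  have "cost i s \<le> C" "cost a s \<le> C"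
    using Store assms(2)[of s] by auto
  moreover have "state_space s \<le> D" "state_space t \<le> D"
    using Store assms(3) by auto
  ultimately have "1 + cost i s + cost a s \<le> 1 * (1 + 2 * C)"
    "max (state_space s) (state_space t) + cost i s + cost a s \<le> D + 2 * C"
    by auto
  with exec.Store[OF Store(3)] show ?case by blast
next
  case (Seq c s s' T1 d t T2)
  then obtain U1 S1 U2 S2 where *: "exec c s s' U1 S1" "U1 \<le> T1 * (1 + 2 * C)" "S1 \<le> D + 2 * C"
    "exec d s' t U2 S2" "U2 \<le> T2 * (1 + 2 * C)" "S2 \<le> D + 2 * C"
    by auto
  have "U1 + U2 \<le> (T1 + T2) * (1 + 2 * C)" "max S1 S2 \<le> D + 2 * C"
    using * by (auto simp: algebra_simps)
  with exec.Seq[OF *(1,4)] show ?case by blast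
next
  case (CondTrue s b c t T d)
  then obtain U S where *: "exec c s t U S" "U \<le> T * (1 + 2 * C)" "S \<le> D + 2 * C"
    by auto
  have "cost b s \<le> C" "state_space s \<le> D" using CondTrue assms(2)[of s b] assms(3)[of s] by auto
  then have "1 + cost b s + U \<le> (1 + T) * (1 + 2 * C)"
    "max (state_space s + cost b s) S \<le> D + 2 * C"
    using * by auto
  with exec.CondTrue[OF CondTrue(2) *(1)] show ?case by blast
next
  case (CondFalse s b d t T c)
  then obtain U S where *: "exec d s t U S" "U \<le> T * (1 + 2 * C)" "S \<le> D + 2 * C"
    by auto
  have "cost b s \<le> C" "state_space s \<le> D" using CondFalse assms(2)[of s b] assms(3)[of s] by auto
  then have "1 + cost b s + U \<le> (1 + T) * (1 + 2 * C)"
    "max (state_space s + cost b s) S \<le> D + 2 * C"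
    using * by auto
  with exec.CondFalse[OF CondFalse(2) *(1)] show ?case by blast
next
  case (WhileFalse s b c)
  have "cost b s \<le> C" "state_space s \<le> D" using WhileFalse assms(2)[of s b] assms(3)[of s] by auto
  then have "1 + cost b s \<le> 1 * (1 + 2 * C)" "state_space s + cost b s \<le> D + 2 * C"
    by auto
  with exec.WhileFalse[OF WhileFalse(2)] show ?case by blast
next
  case (WhileTrue s b c s' T1 t T2)
  then obtain U1 S1 U2 S2 where *: "exec c s s' U1 S1" "U1 \<le> T1 * (1 + 2 * C)" "S1 \<le> D + 2 * C"
    "exec (While b c) s' t U2 S2" "U2 \<le> T2 * (1 + 2 * C)" "S2 \<le> D + 2 * C"
    by auto
  have "cost b s \<le> C" "state_space s \<le> D" using WhileTrue assms(2)[of s b] assms(3)[of s] by auto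
  then have "1 + cost b s + U1 + U2 \<le> (1 + T1 + T2) * (1 + 2 * C)"
    "max (state_space s + cost b s) (max S1 S2) \<le> D + 2 * C"
    using * by (auto simp: algebra_simps)
  with exec.WhileTrue[OF WhileTrue(2) *(1,4)] show ?case by blast
qed

text \<open>Uniform bounds on the memory: finitely many arrays, addresses below \<open>addr\<close>,
  contents up to \<open>2 ^ m\<close>. By \<open>addr \<le> 2 ^ m\<close> the length bound for
  contents covers addresses as well.\<close>

locale ram =
  fixes names :: "string set" and addr :: int and m :: nat
  assumes m_pos: "0 < m" and addr_pos: "0 < addr" and addr_le: "addr \<le> 2 ^ m"
    and finite_names: "finite names"
begin

definition ok :: "state \<Rightarrow> bool" where
  "ok s \<longleftrightarrow> (\<forall>x i. 0 \<le> s x i \<and> s x i \<le> 2 ^ m \<and> (s x i \<noteq> 0 \<longrightarrow> x \<in> names \<and> 0 \<le> i \<and> i < addr))"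

lemma ok_state_space:
  assumes "ok s"
  shows "state_space s \<le> card names * nat addr * (3 + 2 * m)"
proof -
  have "state_space s \<le> (\<Sum>(x, i)\<in>used_cells s. 3 + 2 * m)"
    unfolding state_space_def
  proof (rule sum_mono, clarify)
    fix x i assume "(x, i) \<in> used_cells s"
    then have "0 \<le> i" "i < addr" "s x i \<le> 2 ^ m" "0 \<le> s x i"
      using assms by (auto simp: ok_def used_cells_def)
    then have "bits i \<le> m + 1" "bits (s x i) \<le> m + 1"
      using addr_le bits_le[of i m] bits_le[of "s x i" m] by auto
    then show "1 + bits i + bits (s x i) \<le> 3 + 2 * m" by simp
  qed
  also have "\<dots> = card (used_cells s) * (3 + 2 * m)" by simp
  also have "card (used_cells s) \<le> card (names \<times> {0..<addr})"
    using assms finite_names by (intro card_mono) (auto simp: ok_def used_cells_def)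
  also have "\<dots> = card names * nat addr" by (simp add: card_cartesian_product)
  finally show ?thesis by simp
qed

lemma run_exec_ok:
  assumes "run ok c s t T"
  defines "C \<equiv> prog_weight c * (2 + m * prog_weight c)"
  shows "\<exists>T' S. exec c s t T' S \<and> T' \<le> T * (1 + 2 * C) \<and>
    S \<le> card names * nat addr * (3 + 2 * m) + 2 * C"
proof (rule run_exec[OF assms(1) _ ok_state_space order.refl])
  fix s e assume ok: "ok s" and e: "expr_weight e \<le> prog_weight c"
  have "cost e s \<le> expr_weight e * (2 + m * expr_weight e)"
    using ok by (intro cost_le m_pos) (auto simp: ok_def)
  also have "\<dots> \<le> C" unfolding C_def using e by (intro mult_mono add_mono) auto
  finally show "cost e s \<le> C" .
qed

text \<open>The budget \<open>T\<close> is an upper bound and not the exact step count, so both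
  branches of a conditional can share it.\<close>

definition wp :: "prog \<Rightarrow> state \<Rightarrow> nat \<Rightarrow> (state \<Rightarrow> bool) \<Rightarrow> bool" where
  "wp c s T Q \<longleftrightarrow> (\<exists>t T'. run ok c s t T' \<and> T' \<le> T \<and> Q t)"

text \<open>The frame condition is handed over here once and for all: specifications of subprograms
  then need only mention what changes.\<close>

lemma wp_conseq:
  assumes "wp c s T P"
    and "\<And>t. ok t \<Longrightarrow> P t \<Longrightarrow> (\<And>x. x \<notin> writes c \<Longrightarrow> t x = s x) \<Longrightarrow> Q t"
    and "T \<le> T'"
  shows "wp c s T' Q"
proof -
  obtain t U where t: "run ok c s t U" "U \<le> T" "P t"
    using assms(1) unfolding wp_def by blast
  have "Q t"
    using run_ok[OF t(1)] t(3) run_frame[OF t(1)] by (intro assms(2)) blast+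
  then show ?thesis unfolding wp_def using t(1,2) assms(3) order_trans by blast
qed

lemma wp_Skip: "ok s \<Longrightarrow> Q s \<Longrightarrow> 1 \<le> T \<Longrightarrow> wp Skip s T Q"
  unfolding wp_def using run.Skip[of ok s] by (intro exI[of _ s] exI[of _ 1]) simp

lemma ok_update:
  assumes "ok s" "x \<in> names" "0 \<le> i" "i < addr" "0 \<le> v" "v \<le> 2 ^ m"
  shows "ok (s(x := (s x)(i := v)))"
  using assms unfolding ok_def by auto

lemma wp_Store:
  assumes "ok s" "x \<in> names" "0 \<le> val i s" "val i s < addr" "0 \<le> val a s" "val a s \<le> 2 ^ m"
    and "Q (s(x := (s x)(val i s := val a s)))" and "1 \<le> T"
  shows "wp (Store x i a) s T Q"
  using run.Store[OF assms(1) ok_update[OF assms(1-6)] refl] assms(7,8)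
  unfolding wp_def by blast

lemma wp_Seq:
  assumes "wp c s T1 (\<lambda>t. wp d t T2 Q)" "T1 + T2 \<le> T"
  shows "wp (Seq c d) s T Q"
proof -
  obtain t T' where t: "run ok c s t T'" "T' \<le> T1" "wp d t T2 Q"
    using assms(1) unfolding wp_def by blast
  obtain u T'' where u: "run ok d t u T''" "T'' \<le> T2" "Q u"
    using t(3) unfolding wp_def by blast
  have "T' + T'' \<le> T" using t u assms(2) by linarith
  then show ?thesis unfolding wp_def using run.Seq[OF t(1) u(1)] u(3) by blast
qed

lemma wp_Cond:
  assumes "ok s" "val b s \<noteq> 0 \<Longrightarrow> wp c s T Q" "val b s = 0 \<Longrightarrow> wp d s T Q" "T < T'"
  shows "wp (Cond b c d) s T' Q"
proof (cases "val b s = 0")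
  case True
  then obtain t U where "run ok d s t U" "U \<le> T" "Q t" using assms(3) unfolding wp_def by blast
  moreover have "run ok (Cond b c d) s t (1 + U)"
    using assms(1) True calculation by (intro run.CondFalse)
  moreover have "1 + U \<le> T'" using calculation assms(4) by simp
  ultimately show ?thesis unfolding wp_def by blast
next
  case False
  then obtain t U where "run ok c s t U" "U \<le> T" "Q t" using assms(2) unfolding wp_def by blast
  moreover have "run ok (Cond b c d) s t (1 + U)"
    using assms(1) False calculation by (intro run.CondTrue)
  moreover have "1 + U \<le> T'" using calculation assms(4) by simp
  ultimately show ?thesis unfolding wp_def by blast
qed

end

abbreviation Var :: "string \<Rightarrow> expr" where
  "Var x \<equiv> Load x (Const 0)"

abbreviation Assign :: "string \<Rightarrow> expr \<Rightarrow> prog" where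
  "Assign x a \<equiv> Store x (Const 0) a"

definition For :: "string \<Rightarrow> expr \<Rightarrow> prog \<Rightarrow> prog" where
  "For x e c = Seq (Assign x (Const 0))
     (While (Op Less (Var x) e) (Seq c (Assign x (Op Plus (Var x) (Const 1)))))"

lemma writes_For [simp]: "writes (For x e c) = insert x (writes c)"
  unfolding For_def by auto

text \<open>A loop body ends before its counter is advanced. Its postcondition is thus the next
  invariant, taken in the state with the advanced counter.\<close>

abbreviation after :: "string \<Rightarrow> nat \<Rightarrow> (state \<Rightarrow> bool) \<Rightarrow> state \<Rightarrow> bool" where
  "after x i Q \<equiv> \<lambda>t. Q (t(x := (t x)(0 := int i)))"

context ram
begin

text \<open>Each round adds a test and an increment to the body; the initial assignment and the
  failing last test give the remaining 2. As the loop bound is evaluated anew in every round, it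
  must have the value \<open>N\<close> in all states that differ from \<open>s\<close> only in what
  the loop writes.\<close>

lemma wp_For:
  assumes "ok s" "x \<in> names" "x \<notin> writes c" "int N \<le> 2 ^ m"
    and bound: "\<And>t. (\<And>y. y \<notin> insert x (writes c) \<Longrightarrow> t y = s y) \<Longrightarrow> val e t = int N"
    and init: "Inv 0 (s(x := (s x)(0 := 0)))"
    and step: "\<And>i t. i < N \<Longrightarrow> ok t \<Longrightarrow> Inv i t \<Longrightarrow> t x 0 = int i \<Longrightarrow>
      (\<And>y. y \<notin> insert x (writes c) \<Longrightarrow> t y = s y) \<Longrightarrow>
      wp c t T (after x (Suc i) (Inv (Suc i)))"
    and final: "\<And>t. ok t \<Longrightarrow> Inv N t \<Longrightarrow> (\<And>y. y \<notin> insert x (writes c) \<Longrightarrow> t y = s y) \<Longrightarrow> Q t"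
    and time: "2 + N * (T + 2) \<le> T'"
  shows "wp (For x e c) s T' Q"
proof -
  let ?w = "While (Op Less (Var x) e) (Seq c (Assign x (Op Plus (Var x) (Const 1))))"
  have loop: "wp ?w t (1 + k * (T + 2)) Q"
    if "i + k = N" "ok t" "Inv i t" "t x 0 = int i" "\<And>y. y \<notin> insert x (writes c) \<Longrightarrow> t y = s y"
    for i k t
    using that
  proof (induction k arbitrary: i t)
    case 0
    have "val (Op Less (Var x) e) t = 0" using bound[OF 0(5)] 0 by simp
    then have "run ok ?w t t 1" by (intro run.WhileFalse 0(2))
    moreover have "Q t" using final 0 by simp
    ultimately show ?case unfolding wp_def by auto
  next
    case (Suc k)
    have b: "val (Op Less (Var x) e) t \<noteq> 0" using bound[OF Suc.prems(5)] Suc.prems by simp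
    have "wp c t T (after x (Suc i) (Inv (Suc i)))"
      using Suc.prems by (intro step) auto
    then obtain t' U where t': "run ok c t t' U" "U \<le> T"
      "Inv (Suc i) (t'(x := (t' x)(0 := int (Suc i))))"
      unfolding wp_def by blast
    have fr: "t' y = t y" if "y \<notin> writes c" for y using run_frame[OF t'(1) that] .
    let ?t = "t'(x := (t' x)(0 := int (Suc i)))"
    have ok': "ok t'" using run_ok[OF t'(1)] by blast
    have "int (Suc i) \<le> 2 ^ m" using assms(4) Suc.prems(1) by linarith
    then have ok: "ok ?t"
      using ok' assms(2) addr_pos by (intro ok_update) auto
    have "?t = t'(x := (t' x)(val (Const 0) t' := val (Op Plus (Var x) (Const 1)) t'))"
      using fr[OF assms(3)] Suc.prems(4) by (simp add: add.commute)
    from run.Store[OF ok' ok this]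
    have r1: "run ok (Seq c (Assign x (Op Plus (Var x) (Const 1)))) t ?t (U + 1)"
      using run.Seq[OF t'(1)] by blast
    have frame: "?t y = s y" if "y \<notin> insert x (writes c)" for y
      using that fr[of y] Suc.prems(5)[of y] by auto
    have "wp ?w ?t (1 + k * (T + 2)) Q"
      using Suc.prems(1) by (intro Suc.IH[OF _ ok t'(3) _ frame]) simp_all
    then obtain u U' where u: "run ok ?w ?t u U'" "U' \<le> 1 + k * (T + 2)" "Q u"
      unfolding wp_def by blast
    have "run ok ?w t u (1 + (U + 1) + U')"
      using run.WhileTrue[OF Suc.prems(2) b r1 u(1)] .
    moreover have "1 + (U + 1) + U' \<le> 1 + Suc k * (T + 2)" using t'(2) u(2) by simp
    ultimately show ?case unfolding wp_def using u(3) by blast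
  qed
  have ok0: "ok (s(x := (s x)(0 := 0)))"
    using assms(1,2) addr_pos by (intro ok_update) auto
  show ?thesis unfolding For_def
  proof (rule wp_Seq[of _ _ 1 _ "1 + N * (T + 2)"])
    show "wp (Assign x (Const 0)) s 1 (\<lambda>t. wp ?w t (1 + N * (T + 2)) Q)"
      using assms(1,2) addr_pos loop[OF _ ok0 init] by (intro wp_Store) auto
  qed (use time in simp)
qed

end

section \<open>The program\<close>

definition Ix :: "string \<Rightarrow> string \<Rightarrow> expr" where
  "Ix x y = Op Plus (Op Times (Var x) (Var ''n'')) (Var y)"

text \<open>Repeated doubling takes time linear in the exponent, which is affordable because for
  fixed \<open>c\<close> all exponents are polynomial in \<open>n\<close>.\<close>

definition Pow2 :: "string \<Rightarrow> expr \<Rightarrow> prog" where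
  "Pow2 x a = Seq (Assign x (Const 1)) (For ''t'' a (Assign x (Op Plus (Var x) (Var x))))"

text \<open>Here \<open>m\<close> holds the code of the current subset \<open>X\<close> and
  \<open>h[v]\<close> the power of two at the rank of \<open>v\<close>, so \<open>x\<close> becomes
  the characteristic vector of \<open>X\<close> and \<open>g\<close> its sign
  \<open>(-1) ^ card X\<close> modulo \<open>M\<close>.\<close>

definition Select_step :: prog where
  "Select_step = Seq (Store ''x'' (Var ''v'') (Op Times (Load ''nonterminal'' (Var ''v''))
        (Op Mod (Op Div (Var ''m'') (Load ''h'' (Var ''v''))) (Const 2))))
     (Assign ''g'' (Op Mod (Op Times (Var ''g'')
        (Op Minus (Const 1) (Op Times (Const 2) (Load ''x'' (Var ''v''))))) (Var ''M'')))"

definition Select :: prog where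
  "Select = Seq (Assign ''g'' (Const 1)) (For ''v'' (Var ''n'') Select_step)"

definition Row_step :: prog where
  "Row_step = Seq (Assign ''f'' (Op Times (Op Times (Op Minus (Const 1) (Load ''x'' (Var ''v'')))
        (Op Minus (Const 1) (Op Equal (Var ''u'') (Var ''r'')))) (Load ''b'' (Ix ''u'' ''v''))))
     (Seq (Store ''A'' (Ix ''u'' ''v'') (Op Mod (Op Minus (Const 0) (Var ''f'')) (Var ''M'')))
     (Assign ''d'' (Op Mod (Op Plus (Var ''d'') (Var ''f'')) (Var ''M''))))"

text \<open>The cell \<open>d\<close> starts with the weight 1 of the parentless value and ends as
  the row sum. It may overwrite \<open>A[u,u]\<close> because the loop weight to be subtracted there
  is zero.\<close>

definition Row :: prog where
  "Row = Seq (Assign ''d'' (Const 1)) (Seq (For ''v'' (Var ''n'') Row_step)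
     (Store ''A'' (Ix ''u'' ''u'') (Var ''d'')))"

definition Build :: prog where
  "Build = For ''u'' (Var ''n'') Row"

definition Inverse_step :: prog where
  "Inverse_step = Assign ''p'' (Op Mod (Op Plus (Const 1) (Op Times (Op Minus (Const 1)
        (Load ''A'' (Ix ''i'' ''i''))) (Var ''p''))) (Var ''M''))"

text \<open>The geometric series of \<open>mult_inverse_step\<close>, started with its first term
  1.\<close>

definition Inverse :: prog where
  "Inverse = Seq (Assign ''p'' (Const 1)) (For ''t'' (Var ''e'') Inverse_step)"

definition Row_op_step :: prog where
  "Row_op_step = Store ''A'' (Ix ''j'' ''v'') (Op Mod (Op Minus (Load ''A'' (Ix ''j'' ''v''))
     (Op Times (Var ''f'') (Load ''A'' (Ix ''i'' ''v'')))) (Var ''M''))"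

definition Row_op :: prog where
  "Row_op = Seq (Assign ''f'' (Op Mod (Op Times (Load ''A'' (Ix ''j'' ''i'')) (Var ''p'')) (Var ''M'')))
     (For ''v'' (Var ''n'') Row_op_step)"

definition Column_step :: prog where
  "Column_step = Cond (Op Less (Var ''i'') (Var ''j'')) Row_op Skip"

definition Column :: prog where
  "Column = Seq Inverse (Seq (For ''j'' (Var ''n'') Column_step)
     (Assign ''d'' (Op Mod (Op Times (Var ''d'') (Load ''A'' (Ix ''i'' ''i''))) (Var ''M''))))"

definition Eliminate :: prog where
  "Eliminate = Seq (Assign ''d'' (Const 1)) (For ''i'' (Var ''n'') Column)"

definition Mask_step :: prog where
  "Mask_step = Seq Select (Seq Build (Seq Eliminate
     (Assign ''S'' (Op Mod (Op Plus (Var ''S'') (Op Times (Var ''g'') (Var ''d''))) (Var ''M'')))))"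

text \<open>The subsets are treated one at a time in the same cells, which keeps the space
  polynomial. The final division by \<open>Y\<close> discards the proper forests.\<close>

definition Compute :: prog where
  "Compute = Seq (Assign ''S'' (Const 0)) (Seq (For ''m'' (Var ''H'') Mask_step)
     (Assign ''P'' (Op Div (Var ''S'') (Var ''Y''))))"

lemma writes_Pow2 [simp]: "writes (Pow2 x a) = {''t'', x}"
  by (auto simp: Pow2_def)

lemma writes_Select_step [simp]: "writes Select_step = {''g'', ''x''}"
  by (auto simp: Select_step_def)

lemma writes_Select [simp]: "writes Select = {''g'', ''v'', ''x''}"
  by (auto simp: Select_def)

lemma writes_Row_step [simp]: "writes Row_step = {''A'', ''d'', ''f''}"
  by (auto simp: Row_step_def)

lemma writes_Row [simp]: "writes Row = {''A'', ''d'', ''f'', ''v''}"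
  by (auto simp: Row_def)

lemma writes_Build [simp]: "writes Build = {''A'', ''d'', ''f'', ''u'', ''v''}"
  by (auto simp: Build_def)

lemma writes_Inverse_step [simp]: "writes Inverse_step = {''p''}"
  by (auto simp: Inverse_step_def)

lemma writes_Inverse [simp]: "writes Inverse = {''p'', ''t''}"
  by (auto simp: Inverse_def)

lemma writes_Row_op_step [simp]: "writes Row_op_step = {''A''}"
  by (auto simp: Row_op_step_def)

lemma writes_Row_op [simp]: "writes Row_op = {''A'', ''f'', ''v''}"
  by (auto simp: Row_op_def)

lemma writes_Column_step [simp]: "writes Column_step = {''A'', ''f'', ''v''}"
  by (auto simp: Column_step_def)

lemma writes_Column [simp]: "writes Column = {''A'', ''d'', ''f'', ''j'', ''p'', ''t'', ''v''}"
  by (auto simp: Column_def)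

lemma writes_Eliminate [simp]:
  "writes Eliminate = {''A'', ''d'', ''f'', ''i'', ''j'', ''p'', ''t'', ''v''}"
  by (auto simp: Eliminate_def)

lemma writes_Mask_step [simp]: "writes Mask_step =
  {''A'', ''S'', ''d'', ''f'', ''g'', ''i'', ''j'', ''p'', ''t'', ''u'', ''v'', ''x''}"
  by (auto simp: Mask_step_def)

lemma writes_Compute [simp]: "writes Compute =
  {''A'', ''P'', ''S'', ''d'', ''f'', ''g'', ''i'', ''j'', ''m'', ''p'', ''t'', ''u'', ''v'', ''x''}"
  by (auto simp: Compute_def)

definition alg_names :: "string set" where
  "alg_names = {''n'', ''weight'', ''nonterminal'', ''found'', ''tree'', ''A'', ''H'', ''K'', ''M'',
     ''P'', ''Q'', ''S'', ''Y'', ''a'', ''b'', ''c'', ''d'', ''e'', ''f'', ''g'', ''h'', ''i'', ''j'',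
     ''m'', ''o'', ''p'', ''q'', ''r'', ''t'', ''u'', ''v'', ''x'', ''z''}"

lemma in_alg_names [simp]:
  "''n'' \<in> alg_names" "''weight'' \<in> alg_names" "''nonterminal'' \<in> alg_names" "''found'' \<in> alg_names" "''tree'' \<in> alg_names"
  "''A'' \<in> alg_names" "''H'' \<in> alg_names" "''K'' \<in> alg_names" "''M'' \<in> alg_names" "''P'' \<in> alg_names"
  "''Q'' \<in> alg_names" "''S'' \<in> alg_names" "''Y'' \<in> alg_names" "''a'' \<in> alg_names" "''b'' \<in> alg_names"
  "''c'' \<in> alg_names" "''d'' \<in> alg_names" "''e'' \<in> alg_names" "''f'' \<in> alg_names" "''g'' \<in> alg_names"
  "''h'' \<in> alg_names" "''i'' \<in> alg_names" "''j'' \<in> alg_names" "''m'' \<in> alg_names" "''o'' \<in> alg_names"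
  "''p'' \<in> alg_names" "''q'' \<in> alg_names" "''r'' \<in> alg_names" "''t'' \<in> alg_names" "''u'' \<in> alg_names"
  "''v'' \<in> alg_names" "''x'' \<in> alg_names" "''z'' \<in> alg_names"
  by (simp_all add: alg_names_def)

section \<open>Choice of the root and numbering of the subsets\<close>

text \<open>The default 0 is reached only if all vertices below \<open>i\<close> lie in
  \<open>NT\<close>; for \<open>i = n\<close> there is then no feasible tree, so the choice does no
  harm.\<close>

primrec root_upto :: "nat set \<Rightarrow> nat \<Rightarrow> nat" where
  "root_upto NT 0 = 0"
| "root_upto NT (Suc i) = (if i \<in> NT then root_upto NT i else i)"

lemma root_upto_less: "0 < n \<Longrightarrow> i \<le> n \<Longrightarrow> root_upto NT i < n"
  by (induction i) auto

lemma root_upto_in: "root_upto NT i \<in> NT \<Longrightarrow> {..<i} \<subseteq> NT"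
  by (induction i) (auto simp: less_Suc_eq split: if_splits)

text \<open>
  Reads a number below \<open>2\<^sup>k\<close> as a subset of \<open>NT\<close>, bit \<open>i\<close> standing for the
  \<open>i\<close>-th smallest element (counted from 0).
\<close>

definition subset_code :: "nat set \<Rightarrow> nat \<Rightarrow> nat set" where
  "subset_code NT a = {v \<in> NT. odd (a div 2 ^ card (NT \<inter> {..<v}))}"

lemma sum_lessThan_add_split:
  fixes g :: "nat \<Rightarrow> int"
  shows "(\<Sum>a<b + d. g a) = (\<Sum>a<b. g a) + (\<Sum>a<d. g (a + b))"
  by (induction d) (auto simp: add.commute)

text \<open>Induction over the largest element \<open>v\<close>: its bit is the top one, so the
  lower half of the codes describes the sets without \<open>v\<close>, and adding
  \<open>2 ^ card A\<close> inserts \<open>v\<close> while leaving the bits of smaller elements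
  alone.\<close>

lemma sum_subset_code:
  fixes g :: "nat set \<Rightarrow> int"
  assumes "finite NT"
  shows "(\<Sum>a<2 ^ card NT. g (subset_code NT a)) = (\<Sum>X\<in>Pow NT. g X)"
  using assms
proof (induction NT arbitrary: g rule: finite_linorder_max_induct)
  case empty
  then show ?case by (simp add: subset_code_def)
next
  case (insert v A)
  have v: "v \<notin> A" using insert by auto
  have cv: "A \<inter> {..<v} = A" using insert by auto
  have cu: "insert v A \<inter> {..<u} = A \<inter> {..<u}" if "u \<in> A" for u using insert that by auto
  have low: "subset_code (insert v A) a = subset_code A a" if "a < 2 ^ card A" for a
    using that v unfolding subset_code_def by (auto simp: cu cv)
  have high: "subset_code (insert v A) (a + 2 ^ card A) = insert v (subset_code A a)"
    if a: "a < 2 ^ card A" for a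
  proof -
    have "odd ((a + 2 ^ card A) div 2 ^ card (A \<inter> {..<u})) \<longleftrightarrow> odd (a div 2 ^ card (A \<inter> {..<u}))"
      if "u \<in> A" for u
    proof -
      have "card (A \<inter> {..<u}) < card A"
        using that insert(1) by (intro psubset_card_mono) auto
      then obtain d where d: "card A = card (A \<inter> {..<u}) + Suc d"
        using less_imp_Suc_add by auto
      have "(2::nat) ^ card A = 2 * 2 ^ d * 2 ^ card (A \<inter> {..<u})"
        by (subst d) (simp add: power_add)
      then have "(a + 2 ^ card A) div 2 ^ card (A \<inter> {..<u})
          = 2 * 2 ^ d + a div 2 ^ card (A \<inter> {..<u})"
        by (simp only: div_mult_self3) simp
      then show ?thesis by simp
    qed
    moreover have "odd ((a + 2 ^ card A) div 2 ^ card A)" using a by simp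
    ultimately show ?thesis using v unfolding subset_code_def by (auto simp: cu cv)
  qed
  have "(\<Sum>a<2 ^ card (insert v A). g (subset_code (insert v A) a))
      = (\<Sum>a<2 ^ card A + 2 ^ card A. g (subset_code (insert v A) a))"
    using v insert(1) by (simp add: mult_2)
  also have "\<dots> = (\<Sum>a<2 ^ card A. g (subset_code (insert v A) a))
      + (\<Sum>a<2 ^ card A. g (subset_code (insert v A) (a + 2 ^ card A)))"
    by (rule sum_lessThan_add_split)
  also have "\<dots> = (\<Sum>X\<in>Pow A. g X) + (\<Sum>X\<in>Pow A. g (insert v X))"
    using insert.IH[of g] insert.IH[of "\<lambda>X. g (insert v X)"] by (simp add: low high)
  also have "\<dots> = (\<Sum>X\<in>Pow (insert v A). g X)"
  proof -
    have "(\<Sum>X\<in>Pow (insert v A). g X) = (\<Sum>X\<in>Pow A. g X) + (\<Sum>X\<in>insert v ` Pow A. g X)"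
      unfolding Pow_insert using v insert(1) by (intro sum.union_disjoint) auto
    moreover have "inj_on (insert v) (Pow A)" using v by (auto simp: inj_on_def)
    ultimately show ?thesis by (simp add: sum.reindex)
  qed
  finally show ?case .
qed

section \<open>Initialisation, search for the optimum, and output\<close>

definition Root_step :: prog where
  "Root_step = Cond (Load ''nonterminal'' (Var ''v'')) Skip (Assign ''r'' (Var ''v''))"

definition Find_root :: prog where
  "Find_root = For ''v'' (Var ''n'') Root_step"

text \<open>\<open>H\<close> doubles at every non-terminal, so that \<open>h[v]\<close> becomes 2 to
  the number of smaller non-terminals and \<open>H\<close> ends as the number of subsets.\<close>

definition Rank_step :: prog where
  "Rank_step = Seq (Store ''h'' (Var ''v'') (Var ''H''))
     (Cond (Load ''nonterminal'' (Var ''v'')) (Assign ''H'' (Op Plus (Var ''H'') (Var ''H''))) Skip)"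

definition Ranks :: prog where
  "Ranks = Seq (Assign ''H'' (Const 1)) (For ''v'' (Var ''n'') Rank_step)"

text \<open>The exponent is fixed with \<open>c\<close>, so the power can be unrolled. The program
  depends on \<open>c\<close> through this expression alone.\<close>

primrec power_expr :: "nat \<Rightarrow> expr" where
  "power_expr 0 = Const 1"
| "power_expr (Suc c) = Op Times (Var ''n'') (power_expr c)"

definition Params :: "nat \<Rightarrow> prog" where
  "Params c = Seq (Assign ''K'' (power_expr (c + 1)))
     (Seq (Assign ''q'' (Op Plus (Op Times (Var ''n'') (Var ''n'')) (Const 1)))
     (Seq (Assign ''e'' (Op Times (Op Times (Var ''q'') (Var ''K'')) (Var ''n'')))
     (Seq (Pow2 ''M'' (Var ''e''))
     (Pow2 ''Y'' (Op Times (Var ''q'') (Op Times (Var ''K'') (Op Minus (Var ''n'') (Const 1))))))))"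

definition Weight_step :: prog where
  "Weight_step = Cond (Load ''weight'' (Ix ''u'' ''v''))
     (Seq (Pow2 ''f'' (Op Times (Var ''q'') (Op Plus (Var ''K'') (Load ''weight'' (Ix ''u'' ''v'')))))
       (Store ''b'' (Ix ''u'' ''v'') (Var ''f''))) Skip"

definition Weight_row :: prog where
  "Weight_row = For ''v'' (Var ''n'') Weight_step"

definition Weights :: prog where
  "Weights = For ''u'' (Var ''n'') Weight_row"

definition Init :: "nat \<Rightarrow> prog" where
  "Init c = Seq Find_root (Seq Ranks (Seq (Params c) Weights))"

definition Threshold_step :: prog where
  "Threshold_step = Cond (Op Mod (Var ''P'') (Var ''Q'')) Skip
     (Assign ''Q'' (Op Times (Var ''Q'') (Var ''z'')))"

text \<open>\<open>P\<close> modulo \<open>z ^ (j + 1)\<close> is nonzero iff some feasible tree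
  weighs at most \<open>j\<close>. Hence \<open>Q\<close> stops at \<open>z ^ (W + 1)\<close>, with
  \<open>W\<close> the optimal weight, and the optimum is kept only in this form.\<close>

definition Threshold :: prog where
  "Threshold = Seq (Pow2 ''z'' (Var ''q'')) (Seq (Assign ''Q'' (Var ''z''))
     (For ''t'' (Var ''K'') Threshold_step))"

definition Restore :: prog where
  "Restore = Cond (Op Mod (Var ''P'') (Var ''Q'')) Skip
     (Seq (Store ''b'' (Ix ''a'' ''c'') (Var ''o'')) (Store ''b'' (Ix ''c'' ''a'') (Var ''o'')))"

text \<open>Non-edges, including the diagonal, need no separate case: their entry \<open>o\<close>
  is 0, so neither deleting nor restoring changes anything.\<close>

definition Delete_step :: prog where
  "Delete_step = Seq (Assign ''o'' (Load ''b'' (Ix ''a'' ''c'')))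
     (Seq (Store ''b'' (Ix ''a'' ''c'') (Const 0)) (Seq (Store ''b'' (Ix ''c'' ''a'') (Const 0))
     (Seq Compute Restore)))"

definition Delete_row :: prog where
  "Delete_row = For ''c'' (Var ''n'') Delete_step"

definition Delete :: prog where
  "Delete = For ''a'' (Var ''n'') Delete_row"

definition Output_step :: prog where
  "Output_step = Store ''tree'' (Ix ''a'' ''c'') (Op Less (Const 0) (Load ''b'' (Ix ''a'' ''c'')))"

definition Output_row :: prog where
  "Output_row = For ''c'' (Var ''n'') Output_step"

definition Output :: prog where
  "Output = For ''a'' (Var ''n'') Output_row"

definition Solve :: "nat \<Rightarrow> prog" where
  "Solve c = Seq (Init c) (Seq Compute (Cond (Var ''P'')
     (Seq (Assign ''found'' (Const 1)) (Seq Threshold (Seq Delete Output))) Skip))"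

lemma writes_Root_step [simp]: "writes Root_step = {''r''}"
  by (auto simp: Root_step_def)

lemma writes_Find_root [simp]: "writes Find_root = {''r'', ''v''}"
  by (auto simp: Find_root_def)

lemma writes_Rank_step [simp]: "writes Rank_step = {''H'', ''h''}"
  by (auto simp: Rank_step_def)

lemma writes_Ranks [simp]: "writes Ranks = {''H'', ''h'', ''v''}"
  by (auto simp: Ranks_def)

lemma writes_Params [simp]: "writes (Params c) = {''K'', ''M'', ''Y'', ''e'', ''q'', ''t''}"
  by (auto simp: Params_def)

lemma writes_Weight_step [simp]: "writes Weight_step = {''b'', ''f'', ''t''}"
  by (auto simp: Weight_step_def)

lemma writes_Weight_row [simp]: "writes Weight_row = {''b'', ''f'', ''t'', ''v''}"
  by (auto simp: Weight_row_def)

lemma writes_Weights [simp]: "writes Weights = {''b'', ''f'', ''t'', ''u'', ''v''}"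
  by (auto simp: Weights_def)

lemma writes_Init [simp]: "writes (Init c) =
  {''H'', ''K'', ''M'', ''Y'', ''b'', ''e'', ''f'', ''h'', ''q'', ''r'', ''t'', ''u'', ''v''}"
  by (auto simp: Init_def)

lemma writes_Threshold_step [simp]: "writes Threshold_step = {''Q''}"
  by (auto simp: Threshold_step_def)

lemma writes_Threshold [simp]: "writes Threshold = {''Q'', ''t'', ''z''}"
  by (auto simp: Threshold_def)

lemma writes_Restore [simp]: "writes Restore = {''b''}"
  by (auto simp: Restore_def)

lemma writes_Delete_step [simp]: "writes Delete_step = insert ''b'' (insert ''o'' (writes Compute))"
  by (auto simp: Delete_step_def)

lemma writes_Delete_row [simp]: "writes Delete_row = insert ''c'' (writes Delete_step)"
  by (simp add: Delete_row_def)

lemma writes_Delete [simp]: "writes Delete = insert ''a'' (writes Delete_row)"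
  by (simp add: Delete_def)

lemma writes_Output_step [simp]: "writes Output_step = {''tree''}"
  by (simp add: Output_step_def)

lemma writes_Output_row [simp]: "writes Output_row = {''c'', ''tree''}"
  by (simp add: Output_row_def)

lemma writes_Output [simp]: "writes Output = {''a'', ''c'', ''tree''}"
  by (simp add: Output_def)

section \<open>Correctness of the program\<close>

context ram
begin

text \<open>Meant for symbolic execution: address and value are supplied in evaluated form, and the
  rest of the proof may rely on the updated state being \<open>ok\<close>.\<close>

lemma wp_Store_at:
  assumes "val i s = a" "val e s = v" "ok s" "x \<in> names" "0 \<le> a" "a < addr" "0 \<le> v" "v \<le> 2 ^ m"
    and "ok (s(x := (s x)(a := v))) \<Longrightarrow> Q (s(x := (s x)(a := v)))" and "1 \<le> T"
  shows "wp (Store x i e) s T Q"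
  using assms ok_update[OF assms(3-8)] by (intro wp_Store) auto

lemma wp_Store_Seq:
  assumes "val i s = a" "val e s = v" "ok s" "x \<in> names" "0 \<le> a" "a < addr" "0 \<le> v" "v \<le> 2 ^ m"
    and "ok (s(x := (s x)(a := v))) \<Longrightarrow> wp d (s(x := (s x)(a := v))) T Q" and "Suc T \<le> T'"
  shows "wp (Seq (Store x i e) d) s T' Q"
  using assms by (intro wp_Seq[of _ _ 1 _ T] wp_Store_at[OF assms(1-8)]) auto

lemma ok_nonneg: "ok s \<Longrightarrow> 0 \<le> s x i"
  and ok_le: "ok s \<Longrightarrow> s x i \<le> 2 ^ m"
  unfolding ok_def by auto

end

locale nt_instance =
  fixes c n :: nat and E :: "nat set set" and w :: "nat set \<Rightarrow> nat" and NT :: "nat set"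
  assumes n_pos: "0 < n" and E: "simple_graph {..<n} E" and NT: "NT \<subseteq> {..<n}"
    and w: "\<And>e. e \<in> E \<Longrightarrow> 0 < w e \<and> w e \<le> n ^ c"
begin

text \<open>
  There are fewer than \<open>2\<^sup>q\<close> parent maps.  An edge \<open>e\<close> gets the weight \<open>(2\<^sup>q)\<^sup>K\<^sup>+\<^sup>w\<^sup>e\<close>, where \<open>K\<close> exceeds
  the weight of every forest, so that the spanning trees are separated from the smaller forests;
  \<open>2\<^sup>e\<^sup>b\<close> exceeds the resulting sum over all forests.
\<close>

definition K :: nat where "K = n ^ (c + 1)"
definition q :: nat where "q = n * n + 1"
definition eb :: nat where "eb = q * K * n"
definition M :: int where "M = 2 ^ eb"
definition root :: nat where "root = root_upto NT n"
definition cell :: "nat \<Rightarrow> nat \<Rightarrow> int" where "cell u v = int u * int n + int v"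

lemma K_pos: "0 < K" using n_pos unfolding K_def by simp
lemma q_pos: "0 < q" unfolding q_def by simp
lemma eb_pos: "0 < eb" using n_pos K_pos q_pos unfolding eb_def by simp
lemma n_le_eb: "n \<le> eb" using K_pos q_pos unfolding eb_def by simp
lemma K_le_eb: "K \<le> eb" using n_pos q_pos unfolding eb_def by simp
lemma q_le_eb: "q \<le> eb" using n_pos K_pos unfolding eb_def by simp
lemma qK_le_eb: "q * K \<le> eb" using n_pos unfolding eb_def by simp

lemma cell_nonneg [simp]: "0 \<le> cell u v" unfolding cell_def by simp

lemma cell_eq_iff: "v < n \<Longrightarrow> v' < n \<Longrightarrow> cell u v = cell u' v' \<longleftrightarrow> u = u' \<and> v = v'"
proof
  assume v: "v < n" "v' < n" and "cell u v = cell u' v'"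
  then have "int (u * n + v) = int (u' * n + v')" unfolding cell_def by simp
  then have eq: "u * n + v = u' * n + v'" by (simp only: of_nat_eq_iff)
  have "u = (u * n + v) div n" "u' = (u' * n + v') div n" using v by auto
  then have "u = u'" using eq by simp
  then show "u = u' \<and> v = v'" using eq by simp
qed simp

lemma val_Ix:
  "s ''n'' 0 = int n \<Longrightarrow> s x 0 = int u \<Longrightarrow> s y 0 = int v \<Longrightarrow> val (Ix x y) s = cell u v"
  unfolding Ix_def cell_def by simp

lemma cap_nat: "x \<le> 2 * eb \<Longrightarrow> x \<le> 2 ^ (2 * eb)"
  using less_exp[of "2 * eb"] by (meson le_trans less_imp_le)

lemma n_cap [simp]: "n \<le> 2 ^ (2 * eb)" using n_le_eb by (intro cap_nat) simp

lemma eb_cap [simp]: "eb \<le> 2 ^ (2 * eb)" by (intro cap_nat) simp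

lemma M_cap: "v < M \<Longrightarrow> v \<le> 2 ^ (2 * eb)"
proof -
  assume "v < M"
  also have "M \<le> 2 ^ (2 * eb)" unfolding M_def by (intro power_increasing) auto
  finally show ?thesis by simp
qed

lemma M_ge: "2 \<le> M"
proof -
  have "(2::int) ^ 1 \<le> 2 ^ eb" using eb_pos by (intro power_increasing) auto
  then show ?thesis unfolding M_def by simp
qed

lemma M_even: "even M" using eb_pos unfolding M_def by simp

lemma one_mod_M: "1 mod M = 1" using M_ge by simp

lemma mod_M_bounds: "0 \<le> x mod M" "x mod M < M" "x mod M \<le> 2 ^ (2 * eb)"
proof -
  show "0 \<le> x mod M" "x mod M < M" using M_ge by simp_all
  then show "x mod M \<le> 2 ^ (2 * eb)" using M_cap by simp
qed

definition cells :: int where "cells = int (n * n)"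

lemma less_cells [simp]: "v < n \<Longrightarrow> int v < cells"
  unfolding cells_def by (metis le_square less_le_trans of_nat_less_iff)

lemma cells_pos [simp]: "0 < cells" using n_pos unfolding cells_def by simp

lemma cell_less [simp]: "u < n \<Longrightarrow> v < n \<Longrightarrow> cell u v < cells"
proof -
  assume "u < n" "v < n"
  then have "u * n + v < Suc u * n" by simp
  also have "\<dots> \<le> n * n" using \<open>u < n\<close> by (intro mult_le_mono1) simp
  finally have "int (u * n + v) < int (n * n)" by (simp only: of_nat_less_iff)
  then show ?thesis unfolding cell_def cells_def by simp
qed

text \<open>The largest array is an n by n matrix, which gives the address bound. Residues stay
  below \<open>2 ^ eb\<close>; the doubled exponent makes room for the edge entries
  \<open>2 ^ (q * (K + w e))\<close>, since \<open>K + w e \<le> 2 * K\<close> and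
  \<open>q * K \<le> eb\<close>.\<close>

sublocale ram alg_names cells "2 * eb"
proof
  have "n * n \<le> q" unfolding q_def by simp
  then have "n * n \<le> 2 * eb" using q_le_eb by simp
  then have "n * n \<le> 2 ^ (2 * eb)" by (rule cap_nat)
  then show "cells \<le> 2 ^ (2 * eb)" unfolding cells_def by (simp del: of_nat_mult)
qed (use eb_pos in \<open>auto simp: alg_names_def\<close>)

definition base_names :: "string set" where
  "base_names = {''n'', ''nonterminal'', ''r'', ''K'', ''q'', ''e'', ''M'', ''Y'', ''h'', ''H''}"

text \<open>What the initialisation provides and all later parts only read. The weights
  \<open>b\<close> are kept apart in \<open>edges\<close>, since the search deletes edges.\<close>

definition base :: "state \<Rightarrow> bool" where
  "base s \<longleftrightarrow> s ''n'' 0 = int n \<and> (\<forall>v<n. s ''nonterminal'' (int v) = of_bool (v \<in> NT)) \<and>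
     s ''r'' 0 = int root \<and> s ''K'' 0 = int K \<and> s ''q'' 0 = int q \<and> s ''e'' 0 = int eb \<and>
     s ''M'' 0 = M \<and> s ''Y'' 0 = 2 ^ (q * (K * (n - 1))) \<and>
     (\<forall>v<n. s ''h'' (int v) = 2 ^ card (NT \<inter> {..<v})) \<and> s ''H'' 0 = 2 ^ card NT"

lemma base_cong: "base s \<Longrightarrow> (\<And>x. x \<in> base_names \<Longrightarrow> t x = s x) \<Longrightarrow> base t"
  unfolding base_def base_names_def by auto

lemma card_NT_le: "card NT \<le> n"
  using NT card_mono[of "{..<n}" NT] by simp

section \<open>One signed determinant modulo M\<close>

lemma wp_Select:
  assumes ok: "ok s" and base: "base s" and m: "s ''m'' 0 = int a"
  defines "X \<equiv> subset_code NT a"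
  shows "wp Select s (3 + n * 4) (\<lambda>t. (\<forall>v<n. t ''x'' (int v) = of_bool (v \<in> X)) \<and>
    t ''g'' 0 = (-1) ^ card X mod M)"
  unfolding Select_def
proof (rule wp_Store_Seq[where a = 0 and v = 1 and T = "2 + n * 4"])
  let ?s = "s(''g'' := (s ''g'')(0 := 1))"
  let ?Inv = "\<lambda>i t. (\<forall>v<i. t ''x'' (int v) = of_bool (v \<in> X)) \<and>
    t ''g'' 0 = (-1) ^ card (X \<inter> {..<i}) mod M"
  have Xn: "X \<subseteq> {..<n}" unfolding X_def subset_code_def using NT by auto
  assume ok1: "ok ?s"
  have base1: "base ?s" by (rule base_cong[OF base]) (auto simp: base_names_def)
  show "wp (For ''v'' (Var ''n'') Select_step) ?s (2 + n * 4)
    (\<lambda>t. (\<forall>v<n. t ''x'' (int v) = of_bool (v \<in> X)) \<and> t ''g'' 0 = (-1) ^ card X mod M)"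
  proof (rule wp_For[where N = n and Inv = ?Inv and T = 2])
    show "val (Var ''n'') t = int n"
      if "\<And>y. y \<notin> insert ''v'' (writes Select_step) \<Longrightarrow> t y = ?s y" for t
      using that[of "''n''"] base unfolding base_def by simp
    show "?Inv 0 (?s(''v'' := (?s ''v'')(0 := 0)))" by (simp add: one_mod_M)
    show "(\<forall>v<n. t ''x'' (int v) = of_bool (v \<in> X)) \<and> t ''g'' 0 = (-1) ^ card X mod M"
      if "?Inv n t" for t
      using that Xn by (simp add: Int_absorb2)
    show "wp Select_step t 2 (after ''v'' (Suc i) (?Inv (Suc i)))"
      if i: "i < n" and ok: "ok t" and inv: "?Inv i t" and v: "t ''v'' 0 = int i"
        and fr: "\<And>y. y \<notin> insert ''v'' (writes Select_step) \<Longrightarrow> t y = ?s y" for i t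
    proof -
      have bt: "base t" by (rule base_cong[OF base1 fr]) (auto simp: base_names_def)
      have mt: "t ''m'' 0 = int a" using fr[of "''m''"] m by simp
      have h: "t ''h'' (int i) = 2 ^ card (NT \<inter> {..<i})"
        and nt: "t ''nonterminal'' (int i) = of_bool (i \<in> NT)" and M: "t ''M'' 0 = M"
        using bt i unfolding base_def by auto
      have "int a div 2 ^ card (NT \<inter> {..<i}) mod 2 = of_bool (odd (a div 2 ^ card (NT \<inter> {..<i})))"
      proof -
        have "int a div 2 ^ card (NT \<inter> {..<i}) = int (a div 2 ^ card (NT \<inter> {..<i}))"
          by (simp add: zdiv_int)
        then show ?thesis by (simp only: even_of_nat mod2_eq_if) simp
      qed
      then have bit: "of_bool (i \<in> NT) * (int a div 2 ^ card (NT \<inter> {..<i}) mod 2) = of_bool (i \<in> X)"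
        unfolding X_def subset_code_def by simp
      have sign: "((-1) ^ card (X \<inter> {..<i}) mod M * (1 - 2 * of_bool (i \<in> X))) mod M
          = (-1) ^ card (X \<inter> {..<Suc i}) mod M"
      proof (cases "i \<in> X")
        case True
        then have "X \<inter> {..<Suc i} = insert i (X \<inter> {..<i})" by auto
        then have "card (X \<inter> {..<Suc i}) = Suc (card (X \<inter> {..<i}))" by simp
        then show ?thesis using True by (simp add: mod_minus_eq)
      next
        case False
        then have "X \<inter> {..<Suc i} = X \<inter> {..<i}" by (auto simp: less_Suc_eq)
        then show ?thesis using False by simp
      qed
      show ?thesis unfolding Select_step_def
      proof (rule wp_Store_Seq[where a = "int i" and v = "of_bool (i \<in> X)" and T = 1])
        let ?t = "t(''x'' := (t ''x'')(int i := of_bool (i \<in> X)))"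
        assume ok2: "ok ?t"
        show "wp (Assign ''g'' (Op Mod (Op Times (Var ''g'')
            (Op Minus (Const 1) (Op Times (Const 2) (Load ''x'' (Var ''v''))))) (Var ''M'')))
          ?t 1 (after ''v'' (Suc i) (?Inv (Suc i)))"
          by (rule wp_Store_at[where a = 0 and v = "(-1) ^ card (X \<inter> {..<Suc i}) mod M"])
            (use ok2 inv v M sign n_pos in \<open>auto simp: mod_M_bounds less_Suc_eq\<close>)
      qed (use ok v h nt mt bit i in auto)
    qed
  qed (use ok1 in auto)
qed (use ok n_pos in auto)

definition edge_weight :: "nat set set \<Rightarrow> nat \<Rightarrow> nat \<Rightarrow> int" where
  "edge_weight E' u v = (if {u, v} \<in> E' then (2 ^ q) ^ (K + w {u, v}) else 0)"

definition edges :: "nat set set \<Rightarrow> state \<Rightarrow> bool" where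
  "edges E' s \<longleftrightarrow> (\<forall>u<n. \<forall>v<n. s ''b'' (cell u v) = edge_weight E' u v)"

abbreviation avoid :: "nat set set \<Rightarrow> nat set \<Rightarrow> nat \<Rightarrow> nat \<Rightarrow> int" where
  "avoid E' X \<equiv> avoid_weight n root (edge_weight E') X"

definition laplace :: "nat set set \<Rightarrow> nat set \<Rightarrow> nat \<Rightarrow> nat \<Rightarrow> int" where
  "laplace E' X u v = (if u = v then (\<Sum>w\<le>n. avoid E' X u w) else 0) - avoid E' X u v"

lemma fun_det_laplace: "fun_det n (laplace E' X) = det (laplace_matrix n (avoid E' X))"
  unfolding fun_det_def laplace_matrix_def laplace_def ..

lemma no_loop: "E' \<subseteq> E \<Longrightarrow> {u} \<notin> E'"
  using E unfolding simple_graph_def by fastforce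

lemma avoid_loop: "E' \<subseteq> E \<Longrightarrow> u < n \<Longrightarrow> avoid E' X u u = 0"
  using no_loop[of E' u] unfolding avoid_weight_def edge_weight_def by auto

lemma avoid_even: "v < n \<Longrightarrow> even (avoid E' X u v)"
  using K_pos q_pos unfolding avoid_weight_def edge_weight_def by auto

lemma sum_avoid: "(\<Sum>v\<le>n. avoid E' X u v) = 1 + (\<Sum>v<n. avoid E' X u v)"
proof -
  have "{..n} = insert n {..<n}" by auto
  then show ?thesis by (simp add: avoid_weight_def)
qed

lemma even_mod_M [simp]: "even (x mod M) \<longleftrightarrow> even x"
  using M_even by (meson dvd_mod_iff)

text \<open>Edge weights are powers of two with positive exponent. The only odd term is the 1 for
  the parentless value, and it occurs in the diagonal alone.\<close>

lemma laplace_odd: "E' \<subseteq> E \<Longrightarrow> u < n \<Longrightarrow> v < n \<Longrightarrow> odd (laplace E' X u v) \<longleftrightarrow> u = v"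
proof -
  assume *: "E' \<subseteq> E" "u < n" "v < n"
  have "even (\<Sum>v<n. avoid E' X u v)" by (intro dvd_sum avoid_even) auto
  then show ?thesis using avoid_even[OF *(3), of E' X u] unfolding laplace_def sum_avoid
    by (cases "u = v") simp_all
qed

lemma wp_Row:
  assumes ok: "ok s" and base: "base s" and edges: "edges E' s" and E': "E' \<subseteq> E"
    and x: "\<And>v. v < n \<Longrightarrow> s ''x'' (int v) = of_bool (v \<in> X)"
    and u: "s ''u'' 0 = int u" "u < n"
  shows "wp Row s (4 + n * 5) (\<lambda>t.
    (\<forall>v<n. t ''A'' (cell u v) = laplace E' X u v mod M) \<and>
    (\<forall>u'<u. \<forall>v<n. t ''A'' (cell u' v) = s ''A'' (cell u' v)))" (is "wp _ _ _ ?Q")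
  unfolding Row_def
proof (rule wp_Store_Seq[where a = 0 and v = 1 and T = "3 + n * 5"])
  let ?s = "s(''d'' := (s ''d'')(0 := 1))"
  let ?Inv = "\<lambda>i t. (\<forall>v<i. t ''A'' (cell u v) = (- avoid E' X u v) mod M) \<and>
    t ''d'' 0 = (1 + (\<Sum>v<i. avoid E' X u v)) mod M \<and>
    (\<forall>u'<u. \<forall>v<n. t ''A'' (cell u' v) = s ''A'' (cell u' v))"
  assume ok1: "ok ?s"
  have base1: "base ?s" by (rule base_cong[OF base]) (auto simp: base_names_def)
  let ?last = "Store ''A'' (Ix ''u'' ''u'') (Var ''d'')"
  show "wp (Seq (For ''v'' (Var ''n'') Row_step) ?last) ?s (3 + n * 5) ?Q"
  proof (rule wp_Seq[of _ _ "2 + n * 5" _ 1])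
    show "wp (For ''v'' (Var ''n'') Row_step) ?s (2 + n * 5) (\<lambda>t. wp ?last t 1 ?Q)"
    proof (rule wp_For[where N = n and Inv = ?Inv and T = 3])
      show "val (Var ''n'') t = int n"
        if "\<And>y. y \<notin> insert ''v'' (writes Row_step) \<Longrightarrow> t y = ?s y" for t
        using that[of "''n''"] base unfolding base_def by simp
      show "?Inv 0 (?s(''v'' := (?s ''v'')(0 := 0)))" by (simp add: one_mod_M)
      show "wp ?last t 1 ?Q"
        if ok: "ok t" and inv: "?Inv n t"
          and fr: "\<And>y. y \<notin> insert ''v'' (writes Row_step) \<Longrightarrow> t y = ?s y" for t
      proof -
        have nt: "t ''n'' 0 = int n" using fr[of "''n''"] base unfolding base_def by simp
        have ut: "t ''u'' 0 = int u" using fr[of "''u''"] u by simp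
        \<comment> \<open>The Laplacian subtracts the loop weight from the row sum; it is zero
          because the graph has no loops, so \<open>d\<close> is the diagonal entry as it
          stands.\<close>
        have diag: "laplace E' X u u mod M = t ''d'' 0"
          using inv avoid_loop[OF E' u(2)] unfolding laplace_def sum_avoid by simp
        have off: "laplace E' X u v mod M = t ''A'' (cell u v)" if "v < n" "v \<noteq> u" for v
          using inv that unfolding laplace_def by simp
        show ?thesis
        proof (rule wp_Store_at[where a = "cell u u" and v = "t ''d'' 0"])
          show "?Q (t(''A'' := (t ''A'')(cell u u := t ''d'' 0)))"
            using inv diag off u(2) by (auto simp: cell_eq_iff)
        qed (use ok val_Ix[of t "''u''" u "''u''" u, OF nt ut ut] u(2) in \<open>auto simp: ok_nonneg ok_le\<close>)
      qed
      show "wp Row_step t 3 (after ''v'' (Suc i) (?Inv (Suc i)))"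
        if i: "i < n" and ok: "ok t" and inv: "?Inv i t" and v: "t ''v'' 0 = int i"
          and fr: "\<And>y. y \<notin> insert ''v'' (writes Row_step) \<Longrightarrow> t y = ?s y" for i t
      proof -
        have bt: "base t" by (rule base_cong[OF base1 fr]) (auto simp: base_names_def)
        have ut: "t ''u'' 0 = int u" using fr[of "''u''"] u by simp
        have nt: "t ''n'' 0 = int n" and rt: "t ''r'' 0 = int root" and M: "t ''M'' 0 = M"
          using bt unfolding base_def by auto
        have xt: "t ''x'' (int i) = of_bool (i \<in> X)" using fr[of "''x''"] x[OF i] by simp
        have bt: "t ''b'' (cell u i) = edge_weight E' u i"
          using fr[of "''b''"] edges u(2) i unfolding edges_def by simp
        have f: "(1 - of_bool (i \<in> X)) * (1 - of_bool (u = root)) * edge_weight E' u i = avoid E' X u i"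
          using i unfolding avoid_weight_def by auto
        have f0: "0 \<le> avoid E' X u i" "avoid E' X u i \<le> 2 ^ (2 * eb)"
          using ok_nonneg[OF ok, of "''b''" "cell u i"] ok_le[OF ok, of "''b''" "cell u i"] bt i
          unfolding avoid_weight_def by auto
        note ix = val_Ix[of _ "''u''" u "''v''" i]
        show ?thesis unfolding Row_step_def
        proof (rule wp_Store_Seq[where a = 0 and v = "avoid E' X u i" and T = 2])
          let ?t = "t(''f'' := (t ''f'')(0 := avoid E' X u i))"
          assume ok2: "ok ?t"
          let ?d = "Assign ''d'' (Op Mod (Op Plus (Var ''d'') (Var ''f'')) (Var ''M''))"
          show "wp (Seq (Store ''A'' (Ix ''u'' ''v'') (Op Mod (Op Minus (Const 0) (Var ''f'')) (Var ''M''))) ?d)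
            ?t 2 (after ''v'' (Suc i) (?Inv (Suc i)))"
          proof (rule wp_Store_Seq[where a = "cell u i" and v = "(- avoid E' X u i) mod M" and T = 1])
            let ?t2 = "?t(''A'' := (?t ''A'')(cell u i := (- avoid E' X u i) mod M))"
            assume ok3: "ok ?t2"
            show "wp ?d ?t2 1 (after ''v'' (Suc i) (?Inv (Suc i)))"
            proof (rule wp_Store_at[where a = 0 and v = "(1 + (\<Sum>v<Suc i. avoid E' X u v)) mod M"])
              let ?t3 = "?t2(''d'' := (?t2 ''d'')(0 := (1 + (\<Sum>v<Suc i. avoid E' X u v)) mod M))"
              show "?Inv (Suc i) (?t3(''v'' := (?t3 ''v'')(0 := int (Suc i))))"
                using inv i u(2) by (auto simp: cell_eq_iff less_Suc_eq)
            qed (use ok3 inv v M in \<open>auto simp: mod_M_bounds mod_simps add.assoc\<close>)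
          qed (use ok2 ix nt ut v M u(2) i in \<open>auto simp: mod_M_bounds\<close>)
        qed (use ok v xt ut rt bt f f0 ix nt i in auto)
      qed
    qed (use ok1 in auto)
  qed simp
qed (use ok in auto)

lemma edges_cong: "edges E' s \<Longrightarrow> t ''b'' = s ''b'' \<Longrightarrow> edges E' t"
  unfolding edges_def by simp

lemma wp_Build:
  assumes ok: "ok s" and base: "base s" and edges: "edges E' s" and E': "E' \<subseteq> E"
    and x: "\<And>v. v < n \<Longrightarrow> s ''x'' (int v) = of_bool (v \<in> X)"
  shows "wp Build s (2 + n * (6 + n * 5)) (\<lambda>t.
    \<forall>u<n. \<forall>v<n. t ''A'' (cell u v) = laplace E' X u v mod M)"
  unfolding Build_def
proof (rule wp_For[where N = n and T = "4 + n * 5" and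
      Inv = "\<lambda>i t. \<forall>u<i. \<forall>v<n. t ''A'' (cell u v) = laplace E' X u v mod M"])
  show "val (Var ''n'') t = int n"
    if "\<And>y. y \<notin> insert ''u'' (writes Row) \<Longrightarrow> t y = s y" for t
    using that[of "''n''"] base unfolding base_def by simp
  fix i t
  assume i: "i < n" and ok: "ok t" and u: "t ''u'' 0 = int i"
    and inv: "\<forall>u<i. \<forall>v<n. t ''A'' (cell u v) = laplace E' X u v mod M"
    and fr: "\<And>y. y \<notin> insert ''u'' (writes Row) \<Longrightarrow> t y = s y"
  have bt: "base t" by (rule base_cong[OF base fr]) (auto simp: base_names_def)
  have et: "edges E' t" by (rule edges_cong[OF edges], rule fr) simp
  have xt: "t ''x'' (int v) = of_bool (v \<in> X)" if "v < n" for v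
    using fr[of "''x''"] x[OF that] by simp
  show "wp Row t (4 + n * 5) (\<lambda>t'. \<forall>u<Suc i. \<forall>v<n.
      (t'(''u'' := (t' ''u'')(0 := int (Suc i)))) ''A'' (cell u v) = laplace E' X u v mod M)"
    by (rule wp_conseq[OF wp_Row[OF ok bt et E' xt u i]]) (use inv in \<open>auto simp: less_Suc_eq\<close>)
qed (use ok in auto)

abbreviation amat :: "state \<Rightarrow> nat \<Rightarrow> nat \<Rightarrow> int" where
  "amat s \<equiv> (\<lambda>u v. s ''A'' (cell u v))"

lemma wp_Inverse:
  assumes ok: "ok s" and base: "base s" and i: "s ''i'' 0 = int i" "i < n"
    and odd: "odd (amat s i i)"
  shows "wp Inverse s (3 + eb * 3) (\<lambda>t. [amat s i i * t ''p'' 0 = 1] (mod M))"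
  unfolding Inverse_def
proof (rule wp_Store_Seq[where a = 0 and v = 1 and T = "2 + eb * 3"])
  let ?s = "s(''p'' := (s ''p'')(0 := 1))"
  let ?a = "amat s i i"
  \<comment> \<open>\<open>Suc k\<close>, because the start value 1 already is the partial sum with
    one term.\<close>
  let ?Inv = "\<lambda>k t. (?a * t ''p'' 0) mod M = (1 - (1 - ?a) ^ Suc k) mod M"
  assume ok1: "ok ?s"
  show "wp (For ''t'' (Var ''e'') Inverse_step) ?s (2 + eb * 3) (\<lambda>t. [?a * t ''p'' 0 = 1] (mod M))"
  proof (rule wp_For[where N = eb and T = 1 and Inv = ?Inv])
    show "val (Var ''e'') t = int eb"
      if "\<And>y. y \<notin> insert ''t'' (writes Inverse_step) \<Longrightarrow> t y = ?s y" for t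
      using that[of "''e''"] base unfolding base_def by simp
    show "[?a * t ''p'' 0 = 1] (mod M)" if "?Inv eb t" for t
      using mult_inverse_final[OF that[unfolded M_def] odd] unfolding M_def by simp
    show "wp Inverse_step t 1 (after ''t'' (Suc k) (?Inv (Suc k)))"
      if k: "k < eb" and ok: "ok t" and inv: "?Inv k t"
        and fr: "\<And>y. y \<notin> insert ''t'' (writes Inverse_step) \<Longrightarrow> t y = ?s y" for k t
    proof -
      have nt: "t ''n'' 0 = int n" and M: "t ''M'' 0 = M"
        using fr[of "''n''"] fr[of "''M''"] base unfolding base_def by auto
      have it: "t ''i'' 0 = int i" using fr[of "''i''"] i by simp
      have at: "t ''A'' (cell i i) = ?a" using fr[of "''A''"] by simp
      show ?thesis unfolding Inverse_step_def
      proof (rule wp_Store_at[where a = 0 and v = "(1 + (1 - ?a) * t ''p'' 0) mod M"])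
        let ?t = "t(''p'' := (t ''p'')(0 := (1 + (1 - ?a) * t ''p'' 0) mod M))"
        show "?Inv (Suc k) (?t(''t'' := (?t ''t'')(0 := int (Suc k))))"
          using mult_inverse_step[OF inv] by simp
      qed (use ok val_Ix[of t "''i''" i "''i''" i, OF nt it it] at M in \<open>auto simp: mod_M_bounds\<close>)
    qed
  qed (use ok1 in auto)
qed (use ok in auto)

lemma wp_Row_op:
  assumes ok: "ok s" and base: "base s" and i: "s ''i'' 0 = int i" "i < n"
    and j: "s ''j'' 0 = int j" "j < n" and ij: "i \<noteq> j"
  defines "f \<equiv> (amat s j i * s ''p'' 0) mod M"
  shows "wp Row_op s (3 + n * 3) (\<lambda>t. \<forall>u<n. \<forall>v<n. amat t u v =
    (if u = j then (amat s j v - f * amat s i v) mod M else amat s u v))"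
    (is "wp _ _ _ (\<lambda>t. \<forall>u<n. \<forall>v<n. amat t u v = ?B u v)")
proof -
  have nt: "s ''n'' 0 = int n" and M: "s ''M'' 0 = M" using base unfolding base_def by auto
  let ?s = "s(''f'' := (s ''f'')(0 := f))"
  \<comment> \<open>The loop also overwrites the entry \<open>A[j,i]\<close> from which the
    multiplier was formed; \<open>f\<close> was saved beforehand, and the pivot row is unchanged
    because \<open>i \<noteq> j\<close>.\<close>
  let ?Inv = "\<lambda>k t. \<forall>u<n. \<forall>v<n. amat t u v = (if v < k then ?B u v else amat s u v)"
  show ?thesis unfolding Row_op_def
  proof (rule wp_Store_Seq[where a = 0 and v = f and T = "2 + n * 3"])
    assume ok1: "ok ?s"
    show "wp (For ''v'' (Var ''n'') Row_op_step) ?s (2 + n * 3) (\<lambda>t. \<forall>u<n. \<forall>v<n. amat t u v = ?B u v)"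
    proof (rule wp_For[where N = n and T = 1 and Inv = ?Inv])
      show "val (Var ''n'') t = int n"
        if "\<And>y. y \<notin> insert ''v'' (writes Row_op_step) \<Longrightarrow> t y = ?s y" for t
        using that[of "''n''"] nt by simp
      show "wp Row_op_step t 1 (after ''v'' (Suc k) (?Inv (Suc k)))"
        if k: "k < n" and ok: "ok t" and inv: "?Inv k t" and v: "t ''v'' 0 = int k"
          and fr: "\<And>y. y \<notin> insert ''v'' (writes Row_op_step) \<Longrightarrow> t y = ?s y" for k t
      proof -
        have nt': "t ''n'' 0 = int n" and M': "t ''M'' 0 = M" and it: "t ''i'' 0 = int i"
          and jt: "t ''j'' 0 = int j" and ft: "t ''f'' 0 = f"
          using fr[of "''n''"] fr[of "''M''"] fr[of "''i''"] fr[of "''j''"] fr[of "''f''"] nt M i j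
          by auto
        have "t ''A'' (cell j k) = amat s j k" "t ''A'' (cell i k) = amat s i k"
          using inv i j k by auto
        then have val: "val (Op Mod (Op Minus (Load ''A'' (Ix ''j'' ''v''))
            (Op Times (Var ''f'') (Load ''A'' (Ix ''i'' ''v'')))) (Var ''M'')) t = ?B j k"
          using val_Ix[of t "''j''" j "''v''" k, OF nt' jt v] val_Ix[of t "''i''" i "''v''" k, OF nt' it v] ft M' by simp
        show ?thesis unfolding Row_op_step_def
        proof (rule wp_Store_at[where a = "cell j k" and v = "?B j k", OF val_Ix[of t "''j''" j "''v''" k, OF nt' jt v] val])
          let ?t = "t(''A'' := (t ''A'')(cell j k := ?B j k))"
          show "?Inv (Suc k) (?t(''v'' := (?t ''v'')(0 := int (Suc k))))"
            using inv k j by (auto simp: cell_eq_iff less_Suc_eq)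
        qed (use ok k j in \<open>auto simp: mod_M_bounds\<close>)
      qed
    qed (use ok1 in auto)
  qed (use ok val_Ix[of s "''j''" j "''i''" i, OF nt j(1) i(1)] M in \<open>auto simp: f_def mod_M_bounds\<close>)
qed

lemma wp_Column:
  assumes ok: "ok s" and base: "base s" and i: "s ''i'' 0 = int i" "i < n"
    and inv: "elim_inv n M D i 0 (amat s)"
  shows "wp Column s (6 + eb * 3 + n * (6 + n * 3)) (\<lambda>t. elim_inv n M D (Suc i) 0 (amat t) \<and>
    (\<forall>u\<le>i. amat t u u = amat s u u) \<and> t ''d'' 0 = (s ''d'' 0 * amat s i i) mod M)"
    (is "wp _ _ _ ?Q")
  unfolding Column_def
proof (rule wp_Seq[of _ _ "3 + eb * 3" _ "3 + n * (6 + n * 3)"])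
  let ?last = "Assign ''d'' (Op Mod (Op Times (Var ''d'') (Load ''A'' (Ix ''i'' ''i''))) (Var ''M''))"
  have odd: "odd (amat s i i)" using inv i(2) unfolding elim_inv_def by auto
  show "wp Inverse s (3 + eb * 3)
    (\<lambda>t. wp (Seq (For ''j'' (Var ''n'') Column_step) ?last) t (3 + n * (6 + n * 3)) ?Q)"
  proof (rule wp_conseq[OF wp_Inverse[OF ok base i odd]])
    fix s1 assume ok1: "ok s1" and p: "[amat s i i * s1 ''p'' 0 = 1] (mod M)"
      and fr1: "\<And>x. x \<notin> writes Inverse \<Longrightarrow> s1 x = s x"
    have base1: "base s1" by (rule base_cong[OF base fr1]) (auto simp: base_names_def)
    have a1: "s1 ''A'' = s ''A''" and d1: "s1 ''d'' = s ''d''" using fr1 by auto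
    have i1: "s1 ''i'' 0 = int i" using fr1[of "''i''"] i by simp
    \<comment> \<open>Rows up to the pivot never change, so the inverse in \<open>p\<close> remains
      valid for all rows below, and the pivot can still be multiplied into \<open>d\<close> at the
      end.\<close>
    let ?Inv = "\<lambda>k t. elim_inv n M D i k (amat t) \<and> (\<forall>u\<le>i. \<forall>v<n. amat t u v = amat s u v)"
    show "wp (Seq (For ''j'' (Var ''n'') Column_step) ?last) s1 (3 + n * (6 + n * 3)) ?Q"
    proof (rule wp_Seq[of _ _ "2 + n * (6 + n * 3)" _ 1])
      show "wp (For ''j'' (Var ''n'') Column_step) s1 (2 + n * (6 + n * 3)) (\<lambda>t. wp ?last t 1 ?Q)"
      proof (rule wp_For[where N = n and T = "4 + n * 3" and Inv = ?Inv])
        show "val (Var ''n'') t = int n"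
          if "\<And>y. y \<notin> insert ''j'' (writes Column_step) \<Longrightarrow> t y = s1 y" for t
          using that[of "''n''"] base1 unfolding base_def by simp
        show "wp ?last t 1 ?Q"
          if ok: "ok t" and invt: "?Inv n t"
            and fr: "\<And>y. y \<notin> insert ''j'' (writes Column_step) \<Longrightarrow> t y = s1 y" for t
        proof -
          have nt: "t ''n'' 0 = int n" and M: "t ''M'' 0 = M"
            using fr[of "''n''"] fr[of "''M''"] base1 unfolding base_def by auto
          have it: "t ''i'' 0 = int i" using fr[of "''i''"] i1 by simp
          have dt: "t ''d'' 0 = s ''d'' 0" using fr[of "''d''"] d1 by simp
          have "elim_inv n M D (Suc i) 0 (amat t)" using invt elim_inv_Suc_col by blast
          then show ?thesis
            by (intro wp_Store_at[where a = 0 and v = "(s ''d'' 0 * amat s i i) mod M"])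
              (use ok invt i(2) dt M val_Ix[of t "''i''" i "''i''" i, OF nt it it] in \<open>auto simp: mod_M_bounds\<close>)
        qed
        show "wp Column_step t (4 + n * 3)
          (after ''j'' (Suc k) (?Inv (Suc k)))"
          if k: "k < n" and ok: "ok t" and invt: "?Inv k t" and j: "t ''j'' 0 = int k"
            and fr: "\<And>y. y \<notin> insert ''j'' (writes Column_step) \<Longrightarrow> t y = s1 y" for k t
          unfolding Column_step_def
        proof (rule wp_Cond[where T = "3 + n * 3"])
          have bt: "base t" by (rule base_cong[OF base1 fr]) (auto simp: base_names_def)
          have it: "t ''i'' 0 = int i" using fr[of "''i''"] i1 by simp
          show "wp Row_op t (3 + n * 3) (after ''j'' (Suc k) (?Inv (Suc k)))"
            if "val (Op Less (Var ''i'') (Var ''j'')) t \<noteq> 0"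
          proof -
            have ik: "i < k" using that it j by (auto split: if_splits)
            have pt: "[amat t i i * t ''p'' 0 = 1] (mod M)"
              using p fr[of "''p''"] invt i(2) by simp
            show ?thesis
            proof (rule wp_conseq[OF wp_Row_op[OF ok bt it i(2) j k]])
              fix t'
              let ?f = "(amat t k i * t ''p'' 0) mod M"
              let ?B = "\<lambda>u v. if u = k then (amat t k v - ?f * amat t i v) mod M else amat t u v"
              assume t': "\<forall>u<n. \<forall>v<n. amat t' u v = ?B u v"
              have inv_k: "elim_inv n M D i k (amat t)" and M0: "0 < M" using invt M_ge by auto
              have "elim_inv n M D i (Suc k) ?B"
                by (rule elim_inv_row[where A = "amat t", OF inv_k ik k pt M_even M0 refl])
              then have "elim_inv n M D i (Suc k) (amat t')"
                by (rule elim_inv_cong) (use t' i(2) k in simp_all)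
              moreover have "amat t' u v = amat s u v" if "u \<le> i" "v < n" for u v
                using that t' ik i(2) invt by auto
              ultimately show "?Inv (Suc k) (t'(''j'' := (t' ''j'')(0 := int (Suc k))))" by simp
            qed (use ik in auto)
          qed
          show "wp Skip t (3 + n * 3) (after ''j'' (Suc k) (?Inv (Suc k)))"
            if "val (Op Less (Var ''i'') (Var ''j'')) t = 0"
          proof -
            have "k \<le> i" using that it j by (auto split: if_splits)
            then have "elim_inv n M D i (Suc k) (amat t)" using invt elim_inv_skip by blast
            then show ?thesis using ok invt by (intro wp_Skip) auto
          qed
        qed (use ok in auto)
      qed (use ok1 inv a1 in auto)
    qed simp
  qed simp
qed simp

lemma wp_Eliminate:
  assumes ok: "ok s" and base: "base s" and inv: "elim_inv n M D 0 0 (amat s)"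
  shows "wp Eliminate s (3 + n * (8 + eb * 3 + n * (6 + n * 3))) (\<lambda>t. t ''d'' 0 = D mod M)"
  unfolding Eliminate_def
proof (rule wp_Store_Seq[where a = 0 and v = 1 and T = "2 + n * (8 + eb * 3 + n * (6 + n * 3))"])
  let ?s = "s(''d'' := (s ''d'')(0 := 1))"
  \<comment> \<open>Once its column is finished a pivot is final, so the product may be accumulated
    while the elimination proceeds.\<close>
  let ?Inv = "\<lambda>k t. elim_inv n M D k 0 (amat t) \<and> t ''d'' 0 = (\<Prod>l<k. amat t l l) mod M"
  assume ok1: "ok ?s"
  have base1: "base ?s" by (rule base_cong[OF base]) (auto simp: base_names_def)
  show "wp (For ''i'' (Var ''n'') Column) ?s (2 + n * (8 + eb * 3 + n * (6 + n * 3)))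
    (\<lambda>t. t ''d'' 0 = D mod M)"
  proof (rule wp_For[where N = n and T = "6 + eb * 3 + n * (6 + n * 3)" and Inv = ?Inv])
    show "val (Var ''n'') t = int n"
      if "\<And>y. y \<notin> insert ''i'' (writes Column) \<Longrightarrow> t y = ?s y" for t
      using that[of "''n''"] base1 unfolding base_def by simp
    show "t ''d'' 0 = D mod M" if "?Inv n t" for t
      using that elim_inv_final unfolding cong_def by auto
    show "wp Column t (6 + eb * 3 + n * (6 + n * 3))
      (after ''i'' (Suc k) (?Inv (Suc k)))"
      if k: "k < n" and ok: "ok t" and invt: "?Inv k t" and i: "t ''i'' 0 = int k"
        and fr: "\<And>y. y \<notin> insert ''i'' (writes Column) \<Longrightarrow> t y = ?s y" for k t
    proof -
      have bt: "base t" by (rule base_cong[OF base1 fr]) (auto simp: base_names_def)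
      show ?thesis
      proof (rule wp_conseq[OF wp_Column[OF ok bt i k, of D]])
        fix t' assume t': "elim_inv n M D (Suc k) 0 (amat t') \<and> (\<forall>u\<le>k. amat t' u u = amat t u u) \<and>
          t' ''d'' 0 = (t ''d'' 0 * amat t k k) mod M"
        have "(\<Prod>l<Suc k. amat t' l l) = (\<Prod>l<k. amat t l l) * amat t k k"
          using t' by simp
        then have "t' ''d'' 0 = (\<Prod>l<Suc k. amat t' l l) mod M"
          using t' invt by (simp add: mod_mult_left_eq)
        then show "?Inv (Suc k) (t'(''i'' := (t' ''i'')(0 := int (Suc k))))" using t' by simp
      qed (use invt in auto)
    qed
    show "2 + n * (6 + eb * 3 + n * (6 + n * 3) + 2) \<le> 2 + n * (8 + eb * 3 + n * (6 + n * 3))"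
      by (simp add: algebra_simps)
  qed (use ok1 inv one_mod_M in auto)
qed (use ok in auto)

section \<open>The whole alternating sum\<close>

lemma root_less: "root < n"
  unfolding root_def using n_pos by (intro root_upto_less) auto

lemma root_in_NT: "root \<in> NT \<Longrightarrow> NT = {..<n}"
  using root_upto_in[of NT n] NT unfolding root_def by auto

lemma weight_bound: "E' \<subseteq> E \<Longrightarrow> e \<in> E' \<Longrightarrow> w e \<le> n ^ c"
  using w by blast

lemma K_bound: "(n - 1) * n ^ c < K"
  using n_pos unfolding K_def by simp

definition forest_count :: "nat set set \<Rightarrow> int" where
  "forest_count E' = forest_sum n E' root NT w K"

text \<open>The signed determinants are known only modulo \<open>M\<close>. Their total is
  \<open>forest_count\<close>, and because it lies in the range of residues, the accumulated residue
  is the exact value.\<close>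

lemma forest_count_bounds: "E' \<subseteq> E \<Longrightarrow> 0 \<le> forest_count E' \<and> forest_count E' < M"
proof -
  assume E': "E' \<subseteq> E"
  have "(2::int) ^ eb = (2 ^ (n * n + 1)) ^ (K * n)"
    unfolding eb_def q_def by (simp only: power_mult[symmetric] mult.assoc)
  then show ?thesis
    using forest_sum_less[of root n E' w "n ^ c" K NT, OF root_less weight_bound[OF E'] K_bound] forest_sum_nonneg
    unfolding forest_count_def M_def by simp
qed

definition signed_det :: "nat set set \<Rightarrow> nat set \<Rightarrow> int" where
  "signed_det E' X = (-1) ^ card X * fun_det n (laplace E' X)"

lemma sum_signed_det:
  "(\<Sum>a<2 ^ card NT. signed_det E' (subset_code NT a)) = forest_count E'"
proof -
  have "finite NT" using NT finite_subset by blast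
  then have "(\<Sum>a<2 ^ card NT. signed_det E' (subset_code NT a)) = (\<Sum>X\<in>Pow NT. signed_det E' X)"
    by (rule sum_subset_code)
  also have "\<dots> = (\<Sum>f\<in>forest_maps n E' root NT. (2 ^ q) ^ forest_exponent n (\<lambda>e. K + w e) f)"
    unfolding signed_det_def fun_det_laplace
    by (rule inclusion_exclusion_forests[OF NT root_less]) (simp add: edge_weight_def)
  finally show ?thesis unfolding forest_count_def forest_sum_def q_def .
qed

lemma elim_inv_start:
  assumes "\<And>u v. u < n \<Longrightarrow> v < n \<Longrightarrow> A u v = laplace E' X u v mod M" "E' \<subseteq> E"
  shows "elim_inv n M (fun_det n (laplace E' X)) 0 0 A"
proof -
  have "fun_det n A mod M = fun_det n (laplace E' X) mod M"
    by (rule fun_det_cong_mod) (simp add: assms(1))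
  then show ?thesis
    unfolding elim_inv_def cong_def using assms laplace_odd by (simp add: mod_M_bounds)
qed

text \<open>Bracketed like the nested sequences of \<open>Mask_step\<close>, so that
  \<open>wp_Seq\<close> splits the budget by reflexivity.\<close>

definition mask_time :: nat where
  "mask_time = (3 + n * 4) + ((2 + n * (6 + n * 5)) + ((3 + n * (8 + eb * 3 + n * (6 + n * 3))) + 1))"

lemma wp_Mask_step:
  assumes ok: "ok s" and base: "base s" and edges: "edges E' s" and E': "E' \<subseteq> E"
    and m: "s ''m'' 0 = int a"
  shows "wp Mask_step s mask_time
    (\<lambda>t. t ''S'' 0 = (s ''S'' 0 + signed_det E' (subset_code NT a)) mod M)" (is "wp _ _ _ ?Q")
  unfolding Mask_step_def mask_time_def
proof (rule wp_Seq[OF _ order.refl], rule wp_conseq[OF wp_Select[OF ok base m] _ order.refl])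
  let ?X = "subset_code NT a"
  let ?D = "fun_det n (laplace E' ?X)"
  let ?last = "Assign ''S'' (Op Mod (Op Plus (Var ''S'') (Op Times (Var ''g'') (Var ''d''))) (Var ''M''))"
  fix s1 assume ok1: "ok s1"
    and 1: "(\<forall>v<n. s1 ''x'' (int v) = of_bool (v \<in> ?X)) \<and> s1 ''g'' 0 = (-1) ^ card ?X mod M"
    and fr1: "\<And>x. x \<notin> writes Select \<Longrightarrow> s1 x = s x"
  have base1: "base s1" by (rule base_cong[OF base fr1]) (auto simp: base_names_def)
  have edges1: "edges E' s1" by (rule edges_cong[OF edges], rule fr1) simp
  show "wp (Seq Build (Seq Eliminate ?last)) s1
    ((2 + n * (6 + n * 5)) + ((3 + n * (8 + eb * 3 + n * (6 + n * 3))) + 1)) ?Q"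
  proof (rule wp_Seq[OF _ order.refl], rule wp_conseq[OF wp_Build[OF ok1 base1 edges1 E'] _ order.refl])
    fix s2 assume ok2: "ok s2"
      and 2: "\<forall>u<n. \<forall>v<n. s2 ''A'' (cell u v) = laplace E' ?X u v mod M"
      and fr2: "\<And>x. x \<notin> writes Build \<Longrightarrow> s2 x = s1 x"
    have base2: "base s2" by (rule base_cong[OF base1 fr2]) (auto simp: base_names_def)
    have inv: "elim_inv n M ?D 0 0 (amat s2)" using 2 by (intro elim_inv_start E') auto
    show "wp (Seq Eliminate ?last) s2 ((3 + n * (8 + eb * 3 + n * (6 + n * 3))) + 1) ?Q"
    proof (rule wp_Seq[OF _ order.refl], rule wp_conseq[OF wp_Eliminate[OF ok2 base2 inv] _ order.refl])
      fix s3 assume ok3: "ok s3" and 3: "s3 ''d'' 0 = ?D mod M"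
        and fr3: "\<And>x. x \<notin> writes Eliminate \<Longrightarrow> s3 x = s2 x"
      have M: "s3 ''M'' 0 = M"
        using fr3[of "''M''"] base2 unfolding base_def by simp
      have S: "s3 ''S'' 0 = s ''S'' 0" and g: "s3 ''g'' 0 = (-1) ^ card ?X mod M"
        using fr1[of "''S''"] fr2[of "''S''"] fr3[of "''S''"] fr2[of "''g''"] fr3[of "''g''"] 1 by auto
      have "(s ''S'' 0 + ((-1) ^ card ?X mod M) * (?D mod M)) mod M = (s ''S'' 0 + signed_det E' ?X) mod M"
        unfolding signed_det_def by (metis mod_add_right_eq mod_mult_eq)
      then show "wp ?last s3 1 ?Q"
        by (intro wp_Store_at[where a = 0 and v = "(s ''S'' 0 + signed_det E' ?X) mod M"])
          (use ok3 M S g 3 in \<open>auto simp: mod_M_bounds\<close>)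
    qed
  qed (use 1 in auto)
qed

definition compute_time :: nat where
  "compute_time = 4 + 2 ^ card NT * (mask_time + 2)"

lemma wp_Compute:
  assumes ok: "ok s" and base: "base s" and edges: "edges E' s" and E': "E' \<subseteq> E"
  shows "wp Compute s compute_time (\<lambda>t. t ''P'' 0 = forest_count E' div (2 ^ q) ^ (K * (n - 1)))"
    (is "wp _ _ _ ?Q")
  unfolding Compute_def
proof (rule wp_Store_Seq[where a = 0 and v = 0 and T = "3 + 2 ^ card NT * (mask_time + 2)"])
  let ?s = "s(''S'' := (s ''S'')(0 := 0))"
  let ?last = "Assign ''P'' (Op Div (Var ''S'') (Var ''Y''))"
  let ?Inv = "\<lambda>i t. t ''S'' 0 = (\<Sum>a<i. signed_det E' (subset_code NT a)) mod M"
  assume ok1: "ok ?s"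
  have base1: "base ?s" by (rule base_cong[OF base]) (auto simp: base_names_def)
  have edges1: "edges E' ?s" by (rule edges_cong[OF edges]) simp
  show "wp (Seq (For ''m'' (Var ''H'') Mask_step) ?last) ?s (3 + 2 ^ card NT * (mask_time + 2)) ?Q"
  proof (rule wp_Seq[of _ _ "2 + 2 ^ card NT * (mask_time + 2)" _ 1])
    show "wp (For ''m'' (Var ''H'') Mask_step) ?s (2 + 2 ^ card NT * (mask_time + 2)) (\<lambda>t. wp ?last t 1 ?Q)"
    proof (rule wp_For[where N = "2 ^ card NT" and T = mask_time and Inv = ?Inv])
      show "val (Var ''H'') t = int (2 ^ card NT)"
        if "\<And>y. y \<notin> insert ''m'' (writes Mask_step) \<Longrightarrow> t y = ?s y" for t
        using that[of "''H''"] base1 unfolding base_def by simp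
      show "wp ?last t 1 ?Q"
        if ok: "ok t" and inv: "?Inv (2 ^ card NT) t"
          and fr: "\<And>y. y \<notin> insert ''m'' (writes Mask_step) \<Longrightarrow> t y = ?s y" for t
      proof -
        have S: "t ''S'' 0 = forest_count E'"
          using inv forest_count_bounds[OF E'] by (simp add: sum_signed_det)
        have Y: "t ''Y'' 0 = (2 ^ q) ^ (K * (n - 1))"
          using fr[of "''Y''"] base1 unfolding base_def by (simp add: power_mult)
        have "forest_count E' div (2 ^ q) ^ (K * (n - 1)) \<le> forest_count E'"
          using forest_count_bounds[OF E'] zdiv_mono2[of "forest_count E'" 1 "(2 ^ q) ^ (K * (n - 1))"] by simp
        then show ?thesis
          using forest_count_bounds[OF E'] M_cap[of "forest_count E'"]
          by (intro wp_Store_at[where a = 0 and v = "forest_count E' div (2 ^ q) ^ (K * (n - 1))"])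
            (use ok S Y in \<open>auto simp: pos_imp_zdiv_nonneg_iff\<close>)
      qed
      show "wp Mask_step t mask_time (after ''m'' (Suc i) (?Inv (Suc i)))"
        if i: "i < 2 ^ card NT" and ok: "ok t" and inv: "?Inv i t" and m: "t ''m'' 0 = int i"
          and fr: "\<And>y. y \<notin> insert ''m'' (writes Mask_step) \<Longrightarrow> t y = ?s y" for i t
      proof -
        have bt: "base t" by (rule base_cong[OF base1 fr]) (auto simp: base_names_def)
        have et: "edges E' t" by (rule edges_cong[OF edges1], rule fr) simp
        show ?thesis
          by (rule wp_conseq[OF wp_Mask_step[OF ok bt et E' m]]) (use inv in \<open>auto simp: mod_simps\<close>)
      qed
      \<comment> \<open>The loop counter runs up to \<open>2 ^ card NT\<close>, which fits into a
        cell because \<open>card NT \<le> n \<le> eb\<close>.\<close>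
      have "card NT \<le> 2 * eb" using card_NT_le n_le_eb by simp
      then show "int (2 ^ card NT) \<le> 2 ^ (2 * eb)" by simp
    qed (use ok1 in auto)
  qed simp
qed (use ok in \<open>auto simp: compute_time_def\<close>)

lemma compute_digits:
  assumes "E' \<subseteq> E"
  shows "forest_count E' div (2 ^ q) ^ (K * (n - 1)) mod (2 ^ q) ^ N \<noteq> 0 \<longleftrightarrow>
    (\<exists>F. nt_spanning_tree {..<n} E' NT F \<and> sum w F < N)"
  using forest_sum_digits[of NT n root E' w "n ^ c" K N, OF NT root_less root_in_NT weight_bound[OF assms] K_bound]
  unfolding forest_count_def q_def by simp

lemma compute_zero:
  assumes "E' \<subseteq> E"
  shows "forest_count E' div (2 ^ q) ^ (K * (n - 1)) = 0 \<longleftrightarrow> (\<nexists>F. nt_spanning_tree {..<n} E' NT F)"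
  using forest_sum_div_eq_0_iff(1)[of NT n root E' w "n ^ c" K, OF NT root_less root_in_NT weight_bound[OF assms] K_bound]
  unfolding forest_count_def q_def by simp

lemma tree_weight_less: "nt_spanning_tree {..<n} E NT F \<Longrightarrow> sum w F < K"
  using forest_sum_div_eq_0_iff(2)[of NT n root E w "n ^ c" K, OF NT root_less root_in_NT weight_bound[OF order.refl] K_bound]
  by simp

section \<open>Initialisation of the parameters and weights\<close>

lemma wp_Pow2:
  assumes ok: "ok s" and x: "x \<in> alg_names" "x \<noteq> ''t''" and N: "N \<le> 2 * eb"
    and val: "\<And>t. (\<And>y. y \<noteq> x \<Longrightarrow> y \<noteq> ''t'' \<Longrightarrow> t y = s y) \<Longrightarrow> val a t = int N"
  shows "wp (Pow2 x a) s (3 + N * 3) (\<lambda>t. t x 0 = 2 ^ N)"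
  unfolding Pow2_def
proof (rule wp_Store_Seq[where a = 0 and v = 1 and T = "2 + N * 3"])
  let ?s = "s(x := (s x)(0 := 1))"
  assume ok1: "ok ?s"
  show "wp (For ''t'' a (Assign x (Op Plus (Var x) (Var x)))) ?s (2 + N * 3) (\<lambda>t. t x 0 = 2 ^ N)"
  proof (rule wp_For[where N = N and T = 1 and Inv = "\<lambda>i t. t x 0 = 2 ^ i"])
    show "val a t = int N"
      if fr: "\<And>y. y \<notin> insert ''t'' (writes (Assign x (Op Plus (Var x) (Var x)))) \<Longrightarrow> t y = ?s y" for t
    proof (rule val)
      show "t y = s y" if "y \<noteq> x" "y \<noteq> ''t''" for y using fr[of y] that by simp
    qed
    show "wp (Assign x (Op Plus (Var x) (Var x))) t 1
        (\<lambda>t'. (t'(''t'' := (t' ''t'')(0 := int (Suc i)))) x 0 = 2 ^ Suc i)"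
      if "i < N" "ok t" "t x 0 = 2 ^ i" for i t
    proof (rule wp_Store_at[where a = 0 and v = "2 ^ Suc i"])
      show "(2::int) ^ Suc i \<le> 2 ^ (2 * eb)" using that(1) N by (intro power_increasing) auto
    qed (use that x in auto)
    have "N \<le> 2 ^ (2 * eb)" using N by (rule cap_nat)
    then show "int N \<le> 2 ^ (2 * eb)" by simp
  qed (use ok1 x in auto)
qed (use ok x in auto)

definition input :: "state \<Rightarrow> bool" where
  "input s \<longleftrightarrow> s ''n'' 0 = int n \<and> (\<forall>v<n. s ''nonterminal'' (int v) = of_bool (v \<in> NT)) \<and>
     (\<forall>u<n. \<forall>v<n. s ''weight'' (cell u v) = (if {u, v} \<in> E then int (w {u, v}) else 0))"

lemma input_cong:
  "input s \<Longrightarrow> (\<And>x. x \<in> {''n'', ''nonterminal'', ''weight''} \<Longrightarrow> t x = s x) \<Longrightarrow> input t"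
  unfolding input_def by auto

text \<open>The loop starts without an assignment to \<open>r\<close>; the initial content 0 is
  \<open>root_upto NT 0\<close>.\<close>

lemma wp_Find_root:
  assumes ok: "ok s" and inp: "input s" and r: "s ''r'' 0 = 0"
  shows "wp Find_root s (2 + n * 4) (\<lambda>t. t ''r'' 0 = int root)"
  unfolding Find_root_def
proof (rule wp_For[where N = n and T = 2 and Inv = "\<lambda>i t. t ''r'' 0 = int (root_upto NT i)"])
  show "val (Var ''n'') t = int n"
    if "\<And>y. y \<notin> insert ''v'' (writes Root_step) \<Longrightarrow> t y = s y" for t
    using that[of "''n''"] inp unfolding input_def by simp
  show "wp Root_step t 2
      (\<lambda>t'. (t'(''v'' := (t' ''v'')(0 := int (Suc i)))) ''r'' 0 = int (root_upto NT (Suc i)))"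
    if i: "i < n" and ok: "ok t" and inv: "t ''r'' 0 = int (root_upto NT i)" and v: "t ''v'' 0 = int i"
      and fr: "\<And>y. y \<notin> insert ''v'' (writes Root_step) \<Longrightarrow> t y = s y" for i t
    unfolding Root_step_def
  proof (rule wp_Cond[OF ok, where T = 1])
    have nt: "t ''nonterminal'' (int i) = of_bool (i \<in> NT)"
      using fr[of "''nonterminal''"] inp i unfolding input_def by simp
    show "wp Skip t 1
      (\<lambda>t'. (t'(''v'' := (t' ''v'')(0 := int (Suc i)))) ''r'' 0 = int (root_upto NT (Suc i)))"
      if "val (Load ''nonterminal'' (Var ''v'')) t \<noteq> 0"
      using that nt v inv ok by (intro wp_Skip) auto
    have "i \<le> 2 ^ (2 * eb)" using i n_cap by linarith
    then show "wp (Assign ''r'' (Var ''v'')) t 1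
      (\<lambda>t'. (t'(''v'' := (t' ''v'')(0 := int (Suc i)))) ''r'' 0 = int (root_upto NT (Suc i)))"
      if "val (Load ''nonterminal'' (Var ''v'')) t = 0"
      using that nt v ok by (intro wp_Store_at[where a = 0 and v = "int i"]) auto
  qed simp
  show "t ''r'' 0 = int root" if "t ''r'' 0 = int (root_upto NT n)" for t
    using that unfolding root_def .
qed (use ok r in auto)

lemma wp_Ranks:
  assumes ok: "ok s" and inp: "input s"
  shows "wp Ranks s (3 + n * 5) (\<lambda>t. (\<forall>v<n. t ''h'' (int v) = 2 ^ card (NT \<inter> {..<v})) \<and>
    t ''H'' 0 = 2 ^ card NT)" (is "wp _ _ _ ?Q")
  unfolding Ranks_def
proof (rule wp_Store_Seq[where a = 0 and v = 1 and T = "2 + n * 5"])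
  let ?s = "s(''H'' := (s ''H'')(0 := 1))"
  let ?Inv = "\<lambda>i t. (\<forall>v<i. t ''h'' (int v) = 2 ^ card (NT \<inter> {..<v})) \<and>
    t ''H'' 0 = 2 ^ card (NT \<inter> {..<i})"
  assume ok1: "ok ?s"
  show "wp (For ''v'' (Var ''n'') Rank_step) ?s (2 + n * 5) ?Q"
  proof (rule wp_For[where N = n and T = 3 and Inv = ?Inv])
    show "val (Var ''n'') t = int n"
      if "\<And>y. y \<notin> insert ''v'' (writes Rank_step) \<Longrightarrow> t y = ?s y" for t
      using that[of "''n''"] inp unfolding input_def by simp
    show "?Q t" if "?Inv n t" for t
      using that NT by (simp add: Int_absorb2)
    show "wp Rank_step t 3 (after ''v'' (Suc i) (?Inv (Suc i)))"
      if i: "i < n" and ok: "ok t" and inv: "?Inv i t" and v: "t ''v'' 0 = int i"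
        and fr: "\<And>y. y \<notin> insert ''v'' (writes Rank_step) \<Longrightarrow> t y = ?s y" for i t
    proof -
      have nt: "t ''nonterminal'' (int i) = of_bool (i \<in> NT)"
        using fr[of "''nonterminal''"] inp i unfolding input_def by simp
      have card: "card (NT \<inter> {..<Suc i}) = (if i \<in> NT then Suc (card (NT \<inter> {..<i})) else card (NT \<inter> {..<i}))"
        by (simp add: lessThan_Suc)
      have "card (NT \<inter> {..<Suc i}) \<le> card NT"
        using NT finite_subset by (intro card_mono) auto
      then have le: "card (NT \<inter> {..<Suc i}) \<le> 2 * eb" using card_NT_le n_le_eb by simp
      show ?thesis unfolding Rank_step_def
      proof (rule wp_Store_Seq[where a = "int i" and v = "2 ^ card (NT \<inter> {..<i})" and T = 2])
        let ?t = "t(''h'' := (t ''h'')(int i := 2 ^ card (NT \<inter> {..<i})))"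
        assume ok2: "ok ?t"
        show "wp (Cond (Load ''nonterminal'' (Var ''v'')) (Assign ''H'' (Op Plus (Var ''H'') (Var ''H''))) Skip)
          ?t 2 (after ''v'' (Suc i) (?Inv (Suc i)))"
        proof (rule wp_Cond[OF ok2, where T = 1])
          show "wp (Assign ''H'' (Op Plus (Var ''H'') (Var ''H''))) ?t 1
              (after ''v'' (Suc i) (?Inv (Suc i)))"
            if "val (Load ''nonterminal'' (Var ''v'')) ?t \<noteq> 0"
          proof -
            have "i \<in> NT" using that nt v by (auto split: if_splits)
            then have c: "(2::int) ^ card (NT \<inter> {..<Suc i}) = 2 * 2 ^ card (NT \<inter> {..<i})"
              using card by simp
            have "(2::int) ^ card (NT \<inter> {..<Suc i}) \<le> 2 ^ (2 * eb)"
              using le by (intro power_increasing) auto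
            then show ?thesis
              using ok2 inv c by (intro wp_Store_at[where a = 0 and v = "2 ^ card (NT \<inter> {..<Suc i})"])
                (auto simp: less_Suc_eq)
          qed
          show "wp Skip ?t 1 (after ''v'' (Suc i) (?Inv (Suc i)))"
            if "val (Load ''nonterminal'' (Var ''v'')) ?t = 0"
            using that nt v inv card ok2 by (intro wp_Skip) (auto simp: less_Suc_eq)
        qed simp
      next
        have "card (NT \<inter> {..<i}) \<le> 2 * eb" using le card by (auto split: if_splits)
        then show "(2::int) ^ card (NT \<inter> {..<i}) \<le> 2 ^ (2 * eb)"
          by (intro power_increasing) auto
      qed (use ok v inv i in auto)
    qed
  qed (use ok1 in auto)
qed (use ok in auto)

lemma val_power_expr: "s ''n'' 0 = int n \<Longrightarrow> val (power_expr d) s = int n ^ d"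
  by (induction d) auto

lemma wp_Params:
  assumes ok: "ok s" and n: "s ''n'' 0 = int n"
  shows "wp (Params c) s (9 + eb * 6) (\<lambda>t. t ''K'' 0 = int K \<and> t ''q'' 0 = int q \<and>
    t ''e'' 0 = int eb \<and> t ''M'' 0 = M \<and> t ''Y'' 0 = 2 ^ (q * (K * (n - 1))))" (is "wp _ _ _ ?Q")
  unfolding Params_def
proof (rule wp_Store_Seq[where a = 0 and v = "int K" and T = "8 + eb * 6"])
  let ?s1 = "s(''K'' := (s ''K'')(0 := int K))"
  let ?s2 = "?s1(''q'' := (?s1 ''q'')(0 := int q))"
  let ?s3 = "?s2(''e'' := (?s2 ''e'')(0 := int eb))"
  let ?y = "Op Times (Var ''q'') (Op Times (Var ''K'') (Op Minus (Var ''n'') (Const 1)))"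
  assume ok1: "ok ?s1"
  show "wp (Seq (Assign ''q'' (Op Plus (Op Times (Var ''n'') (Var ''n'')) (Const 1)))
     (Seq (Assign ''e'' (Op Times (Op Times (Var ''q'') (Var ''K'')) (Var ''n'')))
     (Seq (Pow2 ''M'' (Var ''e'')) (Pow2 ''Y'' ?y)))) ?s1 (8 + eb * 6) ?Q"
  proof (rule wp_Store_Seq[where a = 0 and v = "int q" and T = "7 + eb * 6"])
    assume ok2: "ok ?s2"
    show "wp (Seq (Assign ''e'' (Op Times (Op Times (Var ''q'') (Var ''K'')) (Var ''n'')))
      (Seq (Pow2 ''M'' (Var ''e'')) (Pow2 ''Y'' ?y))) ?s2 (7 + eb * 6) ?Q"
    proof (rule wp_Store_Seq[where a = 0 and v = "int eb" and T = "6 + eb * 6"])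
      assume ok3: "ok ?s3"
      show "wp (Seq (Pow2 ''M'' (Var ''e'')) (Pow2 ''Y'' ?y)) ?s3 (6 + eb * 6) ?Q"
      proof (rule wp_Seq[of _ _ "3 + eb * 3" _ "3 + eb * 3"])
        show "wp (Pow2 ''M'' (Var ''e'')) ?s3 (3 + eb * 3) (\<lambda>t. wp (Pow2 ''Y'' ?y) t (3 + eb * 3) ?Q)"
        proof (rule wp_conseq[OF wp_Pow2[OF ok3, where N = eb] _ order.refl])
          show "val (Var ''e'') t = int eb" if "\<And>y. y \<noteq> ''M'' \<Longrightarrow> y \<noteq> ''t'' \<Longrightarrow> t y = ?s3 y" for t
            using that[of "''e''"] by simp
          fix t assume ok4: "ok t" and M: "t ''M'' 0 = 2 ^ eb"
            and fr: "\<And>x. x \<notin> writes (Pow2 ''M'' (Var ''e'')) \<Longrightarrow> t x = ?s3 x"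
          have facts: "t ''n'' 0 = int n" "t ''K'' 0 = int K" "t ''q'' 0 = int q" "t ''e'' 0 = int eb"
            using fr[of "''n''"] fr[of "''K''"] fr[of "''q''"] fr[of "''e''"] n by auto
          have le: "q * (K * (n - 1)) \<le> eb" unfolding eb_def by (simp add: mult.assoc)
          show "wp (Pow2 ''Y'' ?y) t (3 + eb * 3) ?Q"
          proof (rule wp_conseq[OF wp_Pow2[OF ok4, where N = "q * (K * (n - 1))"]])
            show "val ?y t' = int (q * (K * (n - 1)))"
              if "\<And>y. y \<noteq> ''Y'' \<Longrightarrow> y \<noteq> ''t'' \<Longrightarrow> t' y = t y" for t'
              using that[of "''n''"] that[of "''K''"] that[of "''q''"] facts n_pos
              by (simp add: of_nat_diff)
            fix t' assume "t' ''Y'' 0 = 2 ^ (q * (K * (n - 1)))"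
              and fr': "\<And>x. x \<notin> writes (Pow2 ''Y'' ?y) \<Longrightarrow> t' x = t x"
            then show "?Q t'"
              using fr'[of "''K''"] fr'[of "''q''"] fr'[of "''e''"] fr'[of "''M''"] facts M
              unfolding M_def by simp
          qed (use le in auto)
        qed auto
      qed simp
    next
      show "val (Op Times (Op Times (Var ''q'') (Var ''K'')) (Var ''n'')) ?s2 = int eb"
        using n by (simp add: eb_def)
    qed (use ok2 in auto)
  next
    have "q \<le> 2 ^ (2 * eb)" using q_le_eb by (intro cap_nat) simp
    then show "int q \<le> 2 ^ (2 * eb)" by simp
    show "val (Op Plus (Op Times (Var ''n'') (Var ''n'')) (Const 1)) ?s1 = int q"
      using n by (simp add: q_def)
  qed (use ok1 in auto)
next
  have "K \<le> 2 ^ (2 * eb)" using K_le_eb by (intro cap_nat) simp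
  then show "int K \<le> 2 ^ (2 * eb)" by simp
  show "val (power_expr (c + 1)) s = int K" using val_power_expr[of s "c + 1", OF n] by (simp add: K_def)
qed (use ok in auto)

definition params :: "state \<Rightarrow> bool" where
  "params s \<longleftrightarrow> input s \<and> s ''K'' 0 = int K \<and> s ''q'' 0 = int q"

lemma params_cong:
  "params s \<Longrightarrow> (\<And>x. x \<in> {''n'', ''nonterminal'', ''weight'', ''K'', ''q''} \<Longrightarrow> t x = s x) \<Longrightarrow> params t"
  unfolding params_def using input_cong[of s t] by auto

lemma q_weight_le: "e \<in> E \<Longrightarrow> q * (K + w e) \<le> 2 * eb"
proof -
  assume "e \<in> E"
  then have "w e \<le> n ^ c" by (rule weight_bound[OF order.refl])
  also have "\<dots> \<le> K" using n_pos unfolding K_def by simp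
  finally have "q * (K + w e) \<le> q * (K + K)" by (intro mult_le_mono2) simp
  then show ?thesis using qK_le_eb unfolding distrib_left by linarith
qed

lemma wp_Weight_step:
  assumes ok: "ok s" and par: "params s" and u: "s ''u'' 0 = int u" "u < n"
    and v: "s ''v'' 0 = int v" "v < n" and b: "s ''b'' (cell u v) = 0"
  shows "wp Weight_step s (5 + eb * 6) (\<lambda>t. t ''b'' = (s ''b'')(cell u v := edge_weight E u v))"
  unfolding Weight_step_def
proof (rule wp_Cond[OF ok, where T = "4 + eb * 6"])
  have nt: "s ''n'' 0 = int n" and wt: "s ''weight'' (cell u v) = (if {u, v} \<in> E then int (w {u, v}) else 0)"
    using par u v unfolding params_def input_def by auto
  note ix = val_Ix[of s "''u''" u "''v''" v, OF nt u(1) v(1)]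
  let ?e = "Op Times (Var ''q'') (Op Plus (Var ''K'') (Load ''weight'' (Ix ''u'' ''v'')))"
  show "wp (Seq (Pow2 ''f'' ?e) (Store ''b'' (Ix ''u'' ''v'') (Var ''f''))) s (4 + eb * 6)
      (\<lambda>t. t ''b'' = (s ''b'')(cell u v := edge_weight E u v))"
    if "val (Load ''weight'' (Ix ''u'' ''v'')) s \<noteq> 0"
  proof (rule wp_Seq[of _ _ "3 + eb * 6" _ 1])
    have e: "{u, v} \<in> E" using that ix wt by (auto split: if_splits)
    let ?N = "q * (K + w {u, v})"
    show "wp (Pow2 ''f'' ?e) s (3 + eb * 6) (\<lambda>t. wp (Store ''b'' (Ix ''u'' ''v'') (Var ''f'')) t 1
        (\<lambda>t. t ''b'' = (s ''b'')(cell u v := edge_weight E u v)))"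
    proof (rule wp_conseq[OF wp_Pow2[OF ok, where N = ?N]])
      show "val ?e t = int ?N" if fr: "\<And>y. y \<noteq> ''f'' \<Longrightarrow> y \<noteq> ''t'' \<Longrightarrow> t y = s y" for t
      proof -
        have "val (Ix ''u'' ''v'') t = cell u v"
          using fr[of "''n''"] fr[of "''u''"] fr[of "''v''"] nt u v by (intro val_Ix) auto
        then show ?thesis
          using fr[of "''q''"] fr[of "''K''"] fr[of "''weight''"] par wt e unfolding params_def by simp
      qed
      fix t assume ok': "ok t" and f: "t ''f'' 0 = 2 ^ ?N"
        and fr: "\<And>x. x \<notin> writes (Pow2 ''f'' ?e) \<Longrightarrow> t x = s x"
      have ix': "val (Ix ''u'' ''v'') t = cell u v"
        using fr[of "''n''"] fr[of "''u''"] fr[of "''v''"] nt u v by (intro val_Ix) auto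
      have "edge_weight E u v = 2 ^ ?N" using e by (simp add: edge_weight_def power_mult)
      moreover have "(2::int) ^ ?N \<le> 2 ^ (2 * eb)"
        using q_weight_le[OF e] by (intro power_increasing) auto
      moreover have "t ''b'' = s ''b''" using fr by simp
      ultimately show "wp (Store ''b'' (Ix ''u'' ''v'') (Var ''f'')) t 1
          (\<lambda>t. t ''b'' = (s ''b'')(cell u v := edge_weight E u v))"
        using ok' f ix' u v by (intro wp_Store_at[where a = "cell u v" and v = "2 ^ ?N"]) auto
    qed (use q_weight_le[OF e] in auto)
  qed simp
  show "wp Skip s (4 + eb * 6) (\<lambda>t. t ''b'' = (s ''b'')(cell u v := edge_weight E u v))"
    if "val (Load ''weight'' (Ix ''u'' ''v'')) s = 0"
  proof -
    \<comment> \<open>Positive weights make the zero entry a reliable mark of a non-edge, and the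
      cell of \<open>b\<close> still holds its initial 0.\<close>
    have "{u, v} \<notin> E" using that ix wt w[of "{u, v}"] by (auto split: if_splits)
    then have "(s ''b'')(cell u v := edge_weight E u v) = s ''b''"
      using b by (auto simp: edge_weight_def)
    then show ?thesis using ok by (intro wp_Skip) auto
  qed
qed simp

text \<open>Progress in lexicographic order: rows before \<open>i\<close> are complete, row
  \<open>i\<close> up to column \<open>j\<close>. The invariants for deletion and output have the
  same form.\<close>

definition weights_inv :: "nat \<Rightarrow> nat \<Rightarrow> state \<Rightarrow> bool" where
  "weights_inv i j s \<longleftrightarrow> (\<forall>u<n. \<forall>v<n. s ''b'' (cell u v) =
     (if u < i \<or> u = i \<and> v < j then edge_weight E u v else 0))"

lemma wp_Weight_row:
  assumes ok: "ok s" and par: "params s" and u: "s ''u'' 0 = int u" "u < n" and inv: "weights_inv u 0 s"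
  shows "wp Weight_row s (2 + n * (7 + eb * 6)) (weights_inv (Suc u) 0)"
  unfolding Weight_row_def
proof (rule wp_For[where N = n and T = "5 + eb * 6" and Inv = "weights_inv u"])
  show "val (Var ''n'') t = int n"
    if "\<And>y. y \<notin> insert ''v'' (writes Weight_step) \<Longrightarrow> t y = s y" for t
    using that[of "''n''"] par unfolding params_def input_def by simp
  show "wp Weight_step t (5 + eb * 6)
      (after ''v'' (Suc i) (weights_inv u (Suc i)))"
    if i: "i < n" and ok: "ok t" and inv: "weights_inv u i t" and v: "t ''v'' 0 = int i"
      and fr: "\<And>y. y \<notin> insert ''v'' (writes Weight_step) \<Longrightarrow> t y = s y" for i t
  proof -
    have par': "params t" by (rule params_cong[OF par fr]) auto
    have u': "t ''u'' 0 = int u" using fr[of "''u''"] u by simp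
    have b: "t ''b'' (cell u i) = 0" using inv u i unfolding weights_inv_def by simp
    show ?thesis
      by (rule wp_conseq[OF wp_Weight_step[OF ok par' u' u(2) v i b]])
        (use inv i u(2) in \<open>auto simp: weights_inv_def cell_eq_iff less_Suc_eq\<close>)
  qed
  show "weights_inv (Suc u) 0 t" if "weights_inv u n t" for t
    using that unfolding weights_inv_def by (auto simp: less_Suc_eq)
qed (use ok inv in \<open>auto simp: weights_inv_def\<close>)

lemma wp_Weights:
  assumes ok: "ok s" and par: "params s" and b: "\<And>i. s ''b'' i = 0"
  shows "wp Weights s (2 + n * (4 + n * (7 + eb * 6))) (edges E)"
  unfolding Weights_def
proof (rule wp_For[where N = n and T = "2 + n * (7 + eb * 6)" and Inv = "\<lambda>i. weights_inv i 0"])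
  show "val (Var ''n'') t = int n"
    if "\<And>y. y \<notin> insert ''u'' (writes Weight_row) \<Longrightarrow> t y = s y" for t
    using that[of "''n''"] par unfolding params_def input_def by simp
  show "wp Weight_row t (2 + n * (7 + eb * 6))
      (after ''u'' (Suc i) (weights_inv (Suc i) 0))"
    if i: "i < n" and ok: "ok t" and inv: "weights_inv i 0 t" and u: "t ''u'' 0 = int i"
      and fr: "\<And>y. y \<notin> insert ''u'' (writes Weight_row) \<Longrightarrow> t y = s y" for i t
  proof -
    have par': "params t" by (rule params_cong[OF par fr]) auto
    show ?thesis
      by (rule wp_conseq[OF wp_Weight_row[OF ok par' u i inv]]) (auto simp: weights_inv_def)
  qed
  show "edges E t" if "weights_inv n 0 t" for t
    using that unfolding weights_inv_def edges_def by simp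
  show "2 + n * (2 + n * (7 + eb * 6) + 2) \<le> 2 + n * (4 + n * (7 + eb * 6))"
    by (simp add: algebra_simps)
qed (use ok b in \<open>auto simp: weights_inv_def\<close>)

definition init_time :: nat where
  "init_time = (2 + n * 4) + ((3 + n * 5) + ((9 + eb * 6) + (2 + n * (4 + n * (7 + eb * 6)))))"

lemma wp_Init:
  assumes ok: "ok s" and inp: "input s" and r: "s ''r'' 0 = 0" and b: "\<And>i. s ''b'' i = 0"
  shows "wp (Init c) s init_time (\<lambda>t. base t \<and> edges E t)" (is "wp _ _ _ ?Q")
  unfolding Init_def init_time_def
proof (rule wp_Seq[OF _ order.refl], rule wp_conseq[OF wp_Find_root[OF ok inp r] _ order.refl])
  fix s1 assume ok1: "ok s1" and 1: "s1 ''r'' 0 = int root"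
    and fr1: "\<And>x. x \<notin> writes Find_root \<Longrightarrow> s1 x = s x"
  have inp1: "input s1" by (rule input_cong[OF inp fr1]) auto
  show "wp (Seq Ranks (Seq (Params c) Weights)) s1
    ((3 + n * 5) + ((9 + eb * 6) + (2 + n * (4 + n * (7 + eb * 6))))) ?Q"
  proof (rule wp_Seq[OF _ order.refl], rule wp_conseq[OF wp_Ranks[OF ok1 inp1] _ order.refl])
    fix s2 assume ok2: "ok s2" and 2: "(\<forall>v<n. s2 ''h'' (int v) = 2 ^ card (NT \<inter> {..<v})) \<and>
      s2 ''H'' 0 = 2 ^ card NT" and fr2: "\<And>x. x \<notin> writes Ranks \<Longrightarrow> s2 x = s1 x"
    have inp2: "input s2" by (rule input_cong[OF inp1 fr2]) auto
    then have n2: "s2 ''n'' 0 = int n" unfolding input_def by simp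
    show "wp (Seq (Params c) Weights) s2 ((9 + eb * 6) + (2 + n * (4 + n * (7 + eb * 6)))) ?Q"
    proof (rule wp_Seq[OF _ order.refl], rule wp_conseq[OF wp_Params[OF ok2 n2] _ order.refl])
      fix s3 assume ok3: "ok s3" and 3: "s3 ''K'' 0 = int K \<and> s3 ''q'' 0 = int q \<and>
          s3 ''e'' 0 = int eb \<and> s3 ''M'' 0 = M \<and> s3 ''Y'' 0 = 2 ^ (q * (K * (n - 1)))"
        and fr3: "\<And>x. x \<notin> writes (Params c) \<Longrightarrow> s3 x = s2 x"
      have inp3: "input s3" by (rule input_cong[OF inp2 fr3]) auto
      then have par3: "params s3" using 3 unfolding params_def by simp
      have b3: "s3 ''b'' i = 0" for i
        using fr1[of "''b''"] fr2[of "''b''"] fr3[of "''b''"] b by simp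
      have "s3 ''r'' 0 = int root" using fr2[of "''r''"] fr3[of "''r''"] 1 by simp
      moreover have "s3 ''h'' = s2 ''h''" "s3 ''H'' = s2 ''H''" using fr3 by simp_all
      ultimately have base3: "base s3" using inp3 2 3 unfolding base_def input_def by simp
      show "wp Weights s3 (2 + n * (4 + n * (7 + eb * 6))) ?Q"
      proof (rule wp_conseq[OF wp_Weights[OF ok3 par3 b3] _ order.refl])
        fix t assume "edges E t" and fr: "\<And>x. x \<notin> writes Weights \<Longrightarrow> t x = s3 x"
        moreover have "base t" by (rule base_cong[OF base3 fr]) (auto simp: base_names_def)
        ultimately show "?Q t" by simp
      qed
    qed
  qed
qed

section \<open>Optimal weight and deletion of edges\<close>

text \<open>The bound is written \<open>< W + 1\<close> because this is what the remainder modulo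
  \<open>z ^ (W + 1)\<close> detects.\<close>

definition feasible :: "nat \<Rightarrow> nat set set \<Rightarrow> bool" where
  "feasible W E' \<longleftrightarrow> (\<exists>F. nt_spanning_tree {..<n} E' NT F \<and> sum w F < W + 1)"

lemma feasible_mono: "feasible W E1 \<Longrightarrow> E1 \<subseteq> E2 \<Longrightarrow> feasible W E2"
  unfolding feasible_def nt_spanning_tree_def spanning_tree_def by blast

definition optimal :: "nat \<Rightarrow> bool" where
  "optimal W \<longleftrightarrow> feasible W E \<and> (\<forall>F. nt_spanning_tree {..<n} E NT F \<longrightarrow> W \<le> sum w F)"

lemma optimal_exists:
  assumes "nt_spanning_tree {..<n} E NT F"
  shows "\<exists>W. optimal W"
proof -
  let ?P = "\<lambda>W. \<exists>F. nt_spanning_tree {..<n} E NT F \<and> sum w F = W"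
  have "\<exists>W. ?P W" using assms by blast
  then have "?P (LEAST W. ?P W)" by (rule LeastI_ex)
  then have "feasible (LEAST W. ?P W) E" unfolding feasible_def by fastforce
  moreover have "(LEAST W. ?P W) \<le> sum w F" if "nt_spanning_tree {..<n} E NT F" for F
  proof (rule Least_le)
    show "?P (sum w F)" using that by blast
  qed
  ultimately show ?thesis unfolding optimal_def by blast
qed

lemma optimal_less: "optimal W \<Longrightarrow> W < K"
  unfolding optimal_def feasible_def using tree_weight_less by fastforce

lemma optimal_digits:
  assumes "optimal W"
  shows "forest_count E div (2 ^ q) ^ (K * (n - 1)) mod (2 ^ q) ^ (j + 1) \<noteq> 0 \<longleftrightarrow> W \<le> j"
proof -
  have "(\<exists>F. nt_spanning_tree {..<n} E NT F \<and> sum w F < j + 1) \<longleftrightarrow> W \<le> j"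
    using assms unfolding optimal_def feasible_def by fastforce
  then show ?thesis using compute_digits[OF order.refl, of "j + 1"] by simp
qed

lemma z_power_cap: "j \<le> K \<Longrightarrow> (2 ^ q) ^ j \<le> (2::int) ^ (2 * eb)"
proof -
  assume "j \<le> K"
  then have "q * j \<le> q * K" by (rule mult_le_mono2)
  then have "q * j \<le> 2 * eb" using qK_le_eb by linarith
  then have "(2::int) ^ (q * j) \<le> 2 ^ (2 * eb)" by (intro power_increasing) auto
  then show ?thesis by (simp add: power_mult)
qed

lemma wp_Threshold:
  assumes ok: "ok s" and base: "base s" and P: "s ''P'' 0 = forest_count E div (2 ^ q) ^ (K * (n - 1))"
    and W: "optimal W"
  shows "wp Threshold s (6 + eb * 3 + K * 4) (\<lambda>t. t ''Q'' 0 = (2 ^ q) ^ (W + 1))" (is "wp _ _ _ ?R")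
  unfolding Threshold_def
proof (rule wp_Seq[of _ _ "3 + q * 3" _ "3 + K * 4"])
  let ?rest = "Seq (Assign ''Q'' (Var ''z'')) (For ''t'' (Var ''K'') Threshold_step)"
  show "wp (Pow2 ''z'' (Var ''q'')) s (3 + q * 3) (\<lambda>t. wp ?rest t (3 + K * 4) ?R)"
  proof (rule wp_conseq[OF wp_Pow2[OF ok, where N = q] _ order.refl])
    show "val (Var ''q'') t = int q" if "\<And>y. y \<noteq> ''z'' \<Longrightarrow> y \<noteq> ''t'' \<Longrightarrow> t y = s y" for t
      using that[of "''q''"] base unfolding base_def by simp
    show "q \<le> 2 * eb" using q_le_eb by simp
    fix s1 assume ok1: "ok s1" and z: "s1 ''z'' 0 = 2 ^ q"
      and fr1: "\<And>x. x \<notin> writes (Pow2 ''z'' (Var ''q'')) \<Longrightarrow> s1 x = s x"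
    have base1: "base s1" by (rule base_cong[OF base fr1]) (auto simp: base_names_def)
    have P1: "s1 ''P'' 0 = forest_count E div (2 ^ q) ^ (K * (n - 1))" using fr1[of "''P''"] P by simp
    show "wp ?rest s1 (3 + K * 4) ?R"
    proof (rule wp_Store_Seq[where a = 0 and v = "2 ^ q" and T = "2 + K * 4"])
      let ?s = "s1(''Q'' := (s1 ''Q'')(0 := 2 ^ q))"
      \<comment> \<open>The loop runs for \<open>K\<close> rounds whatever \<open>W\<close> is; the
        minimum records that \<open>Q\<close> no longer grows once a nonzero digit has
        appeared.\<close>
      let ?Inv = "\<lambda>i t. t ''Q'' 0 = (2 ^ q) ^ (min i W + 1)"
      assume ok2: "ok ?s"
      show "wp (For ''t'' (Var ''K'') Threshold_step) ?s (2 + K * 4) ?R"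
      proof (rule wp_For[where N = K and T = 2 and Inv = ?Inv])
        show "val (Var ''K'') t = int K"
          if "\<And>y. y \<notin> insert ''t'' (writes Threshold_step) \<Longrightarrow> t y = ?s y" for t
          using that[of "''K''"] base1 unfolding base_def by simp
        have "K \<le> 2 ^ (2 * eb)" using K_le_eb by (intro cap_nat) simp
        then show "int K \<le> 2 ^ (2 * eb)" by simp
        show "?R t" if "?Inv K t" for t
          using that optimal_less[OF W] by (simp add: min_def)
        show "wp Threshold_step t 2 (after ''t'' (Suc i) (?Inv (Suc i)))"
          if i: "i < K" and ok: "ok t" and inv: "?Inv i t"
            and fr: "\<And>y. y \<notin> insert ''t'' (writes Threshold_step) \<Longrightarrow> t y = ?s y" for i t
        proof -
          have Pt: "t ''P'' 0 = forest_count E div (2 ^ q) ^ (K * (n - 1))" using fr[of "''P''"] P1 by simp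
          have zt: "t ''z'' 0 = 2 ^ q" using fr[of "''z''"] z by simp
          have test: "val (Op Mod (Var ''P'') (Var ''Q'')) t \<noteq> 0 \<longleftrightarrow> W \<le> min i W"
            using optimal_digits[OF W, of "min i W"] Pt inv by simp
          show ?thesis unfolding Threshold_step_def
          proof (rule wp_Cond[OF ok, where T = 1])
            show "wp Skip t 1 (after ''t'' (Suc i) (?Inv (Suc i)))"
              if "val (Op Mod (Var ''P'') (Var ''Q'')) t \<noteq> 0"
            proof -
              have "min (Suc i) W = min i W" using that test by simp
              then show ?thesis using ok inv by (intro wp_Skip) auto
            qed
            show "wp (Assign ''Q'' (Op Times (Var ''Q'') (Var ''z''))) t 1
                (after ''t'' (Suc i) (?Inv (Suc i)))"
              if "val (Op Mod (Var ''P'') (Var ''Q'')) t = 0"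
            proof -
              have "i < W" using that test by simp
              then have Q: "t ''Q'' 0 = (2 ^ q) ^ (i + 1)" and m: "min (Suc i) W = Suc i" using inv by auto
              show ?thesis
              proof (rule wp_Store_at[where a = 0 and v = "(2 ^ q) ^ (i + 2)"])
                \<comment> \<open>A new factor is multiplied in only while \<open>i < W\<close>, so
                  the exponent is at most \<open>W + 1 \<le> K\<close>.\<close>
                show "(2 ^ q) ^ (i + 2) \<le> (2::int) ^ (2 * eb)"
                  using \<open>i < W\<close> optimal_less[OF W] by (intro z_power_cap) simp
              qed (use ok Q m zt in auto)
            qed
          qed simp
        qed
      qed (use ok2 in auto)
    next
      have "1 \<le> K" using K_pos by simp
      from z_power_cap[OF this] show "(2::int) ^ q \<le> 2 ^ (2 * eb)" by simp
    qed (use ok1 z in auto)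
  qed auto
qed (use q_le_eb in simp)

lemma edge_weight_delete:
  "edge_weight (E' - {{a, b}}) u v = (if u = a \<and> v = b \<or> u = b \<and> v = a then 0 else edge_weight E' u v)"
  unfolding edge_weight_def by (auto simp: doubleton_eq_iff)

lemma wp_Restore:
  assumes ok: "ok s" and base: "base s" and E': "E' \<subseteq> E"
    and ac: "s ''a'' 0 = int a" "s ''c'' 0 = int d" "a < n" "d < n"
    and edges: "edges (E' - {{a, d}}) s" and o: "s ''o'' 0 = edge_weight E' a d"
    and P: "s ''P'' 0 = forest_count (E' - {{a, d}}) div (2 ^ q) ^ (K * (n - 1))"
    and Q: "s ''Q'' 0 = (2 ^ q) ^ (W + 1)"
  shows "wp Restore s 3 (edges (if feasible W (E' - {{a, d}}) then E' - {{a, d}} else E'))"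
    (is "wp _ _ _ ?R")
  unfolding Restore_def
proof (rule wp_Cond[OF ok, where T = 2])
  have sub: "E' - {{a, d}} \<subseteq> E" using E' by blast
  have test: "val (Op Mod (Var ''P'') (Var ''Q'')) s \<noteq> 0 \<longleftrightarrow> feasible W (E' - {{a, d}})"
    using compute_digits[OF sub, of "W + 1"] P Q unfolding feasible_def by simp
  have nt: "s ''n'' 0 = int n" using base unfolding base_def by simp
  show "wp Skip s 2 ?R" if "val (Op Mod (Var ''P'') (Var ''Q'')) s \<noteq> 0"
    using that test edges ok by (intro wp_Skip) auto
  show "wp (Seq (Store ''b'' (Ix ''a'' ''c'') (Var ''o'')) (Store ''b'' (Ix ''c'' ''a'') (Var ''o''))) s 2 ?R"
    if "val (Op Mod (Var ''P'') (Var ''Q'')) s = 0"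
  proof (rule wp_Store_Seq[where a = "cell a d" and v = "s ''o'' 0" and T = 1])
    let ?s = "s(''b'' := (s ''b'')(cell a d := s ''o'' 0))"
    assume ok1: "ok ?s"
    show "wp (Store ''b'' (Ix ''c'' ''a'') (Var ''o'')) ?s 1 ?R"
    proof (rule wp_Store_at[where a = "cell d a" and v = "s ''o'' 0"])
      have "\<not> feasible W (E' - {{a, d}})" using that test by simp
      moreover have "edge_weight E' d a = edge_weight E' a d"
        unfolding edge_weight_def by (simp add: insert_commute)
      ultimately show "?R (?s(''b'' := (?s ''b'')(cell d a := s ''o'' 0)))"
        using edges o ac unfolding edges_def edge_weight_delete by (auto simp: cell_eq_iff)
      show "val (Ix ''c'' ''a'') ?s = cell d a" using nt ac by (intro val_Ix) auto
    qed (use ok1 ac ok in \<open>auto simp: ok_nonneg ok_le\<close>)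
  next
    show "val (Ix ''a'' ''c'') s = cell a d" using nt ac by (intro val_Ix) auto
  qed (use ok ac in \<open>auto simp: ok_nonneg ok_le\<close>)
qed simp

lemma wp_Delete_step:
  assumes ok: "ok s" and base: "base s" and E': "E' \<subseteq> E"
    and ac: "s ''a'' 0 = int a" "s ''c'' 0 = int d" "a < n" "d < n"
    and edges: "edges E' s" and Q: "s ''Q'' 0 = (2 ^ q) ^ (W + 1)"
  shows "wp Delete_step s (6 + compute_time)
    (edges (if feasible W (E' - {{a, d}}) then E' - {{a, d}} else E'))" (is "wp _ _ _ ?R")
  unfolding Delete_step_def
proof (rule wp_Store_Seq[where a = 0 and v = "edge_weight E' a d" and T = "5 + compute_time"])
  let ?E = "E' - {{a, d}}"
  have nt: "s ''n'' 0 = int n" using base unfolding base_def by simp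
  have b: "s ''b'' (cell a d) = edge_weight E' a d" using edges ac unfolding edges_def by simp
  show "val (Load ''b'' (Ix ''a'' ''c'')) s = edge_weight E' a d"
    using val_Ix[of s "''a''" a "''c''" d, OF nt ac(1,2)] b by simp
  show "0 \<le> edge_weight E' a d" "edge_weight E' a d \<le> 2 ^ (2 * eb)"
    using ok_nonneg[OF ok, of "''b''" "cell a d"] ok_le[OF ok, of "''b''" "cell a d"] b by auto
  let ?s1 = "s(''o'' := (s ''o'')(0 := edge_weight E' a d))"
  let ?s2 = "?s1(''b'' := (?s1 ''b'')(cell a d := 0))"
  let ?s3 = "?s2(''b'' := (?s2 ''b'')(cell d a := 0))"
  show "wp (Seq (Store ''b'' (Ix ''a'' ''c'') (Const 0)) (Seq (Store ''b'' (Ix ''c'' ''a'') (Const 0))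
     (Seq Compute Restore))) ?s1 (5 + compute_time) ?R" if ok1: "ok ?s1"
  proof (rule wp_Store_Seq[where a = "cell a d" and v = 0 and T = "4 + compute_time"])
    show "val (Ix ''a'' ''c'') ?s1 = cell a d" using nt ac by (intro val_Ix) auto
    show "wp (Seq (Store ''b'' (Ix ''c'' ''a'') (Const 0)) (Seq Compute Restore)) ?s2 (4 + compute_time) ?R"
      if ok2: "ok ?s2"
    proof (rule wp_Store_Seq[where a = "cell d a" and v = 0 and T = "3 + compute_time"])
      show "val (Ix ''c'' ''a'') ?s2 = cell d a" using nt ac by (intro val_Ix) auto
      show "wp (Seq Compute Restore) ?s3 (3 + compute_time) ?R" if ok3: "ok ?s3"
      proof (rule wp_Seq[of _ _ compute_time _ 3])
        have base3: "base ?s3" by (rule base_cong[OF base]) (auto simp: base_names_def)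
        have edges3: "edges ?E ?s3"
          unfolding edges_def
        proof (intro allI impI)
          fix u v assume uv: "u < n" "v < n"
          have c: "cell u v = cell a d \<longleftrightarrow> u = a \<and> v = d" "cell u v = cell d a \<longleftrightarrow> u = d \<and> v = a"
            using uv ac by (simp_all add: cell_eq_iff)
          have "s ''b'' (cell u v) = edge_weight E' u v" using edges uv unfolding edges_def by blast
          moreover have "?s3 ''b'' = (s ''b'')(cell a d := 0, cell d a := 0)" by simp
          ultimately show "?s3 ''b'' (cell u v) = edge_weight ?E u v"
            by (simp only: edge_weight_delete fun_upd_apply c if_False if_True) (simp only: split: if_split, blast)
        qed
        have sub: "?E \<subseteq> E" using E' by blast
        show "wp Compute ?s3 compute_time (\<lambda>t. wp Restore t 3 ?R)"
        proof (rule wp_conseq[OF wp_Compute[OF ok3 base3 edges3 sub] _ order.refl])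
          fix t assume okt: "ok t" and P: "t ''P'' 0 = forest_count ?E div (2 ^ q) ^ (K * (n - 1))"
            and fr: "\<And>x. x \<notin> writes Compute \<Longrightarrow> t x = ?s3 x"
          have bt: "base t" by (rule base_cong[OF base3 fr]) (auto simp: base_names_def)
          have et: "edges ?E t" by (rule edges_cong[OF edges3], rule fr) simp
          have at: "t ''a'' 0 = int a" and ct: "t ''c'' 0 = int d" and ot: "t ''o'' 0 = edge_weight E' a d"
            and Qt: "t ''Q'' 0 = (2 ^ q) ^ (W + 1)"
            using fr[of "''a''"] fr[of "''c''"] fr[of "''o''"] fr[of "''Q''"] ac Q by auto
          show "wp Restore t 3 ?R"
            by (rule wp_Restore[OF okt bt E' at ct ac(3,4) et ot P Qt])
        qed
      qed simp
    qed (use ok2 ac in auto)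
  qed (use ok1 ac in auto)
qed (use ok in auto)

text \<open>Edges that were kept stay critical under later deletions, since a smaller edge set
  cannot be feasible when a larger one is not. One pass over all pairs is therefore enough.\<close>

definition delete_inv :: "nat \<Rightarrow> nat \<Rightarrow> nat \<Rightarrow> state \<Rightarrow> bool" where
  "delete_inv W i j s \<longleftrightarrow> (\<exists>E'\<subseteq>E. edges E' s \<and> feasible W E' \<and>
     (\<forall>u v. u < i \<and> v < n \<or> u = i \<and> v < j \<longrightarrow> {u, v} \<in> E' \<longrightarrow> \<not> feasible W (E' - {{u, v}})))"

lemma delete_inv_cong: "delete_inv W i j s \<Longrightarrow> t ''b'' = s ''b'' \<Longrightarrow> delete_inv W i j t"
  unfolding delete_inv_def edges_def by simp

lemma wp_Delete_row:
  assumes ok: "ok s" and base: "base s" and a: "s ''a'' 0 = int a" "a < n"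
    and Q: "s ''Q'' 0 = (2 ^ q) ^ (W + 1)" and inv: "delete_inv W a 0 s"
  shows "wp Delete_row s (2 + n * (8 + compute_time)) (delete_inv W (Suc a) 0)"
  unfolding Delete_row_def
proof (rule wp_For[where N = n and T = "6 + compute_time" and Inv = "delete_inv W a"])
  show "val (Var ''n'') t = int n"
    if "\<And>y. y \<notin> insert ''c'' (writes Delete_step) \<Longrightarrow> t y = s y" for t
    using that[of "''n''"] base unfolding base_def by simp
  show "delete_inv W a 0 (s(''c'' := (s ''c'')(0 := 0)))"
    by (rule delete_inv_cong[OF inv]) simp
  show "delete_inv W (Suc a) 0 t" if "delete_inv W a n t" for t
    using that unfolding delete_inv_def by (simp add: less_Suc_eq) blast
  show "wp Delete_step t (6 + compute_time)
      (after ''c'' (Suc i) (delete_inv W a (Suc i)))"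
    if i: "i < n" and ok: "ok t" and inv: "delete_inv W a i t" and c: "t ''c'' 0 = int i"
      and fr: "\<And>y. y \<notin> insert ''c'' (writes Delete_step) \<Longrightarrow> t y = s y" for i t
  proof -
    have bt: "base t" by (rule base_cong[OF base fr]) (auto simp: base_names_def)
    have at: "t ''a'' 0 = int a" and Qt: "t ''Q'' 0 = (2 ^ q) ^ (W + 1)"
      using fr[of "''a''"] fr[of "''Q''"] a Q by auto
    obtain E' where E': "E' \<subseteq> E" "edges E' t" "feasible W E'"
      and crit: "\<And>u v. u < a \<and> v < n \<or> u = a \<and> v < i \<Longrightarrow> {u, v} \<in> E' \<Longrightarrow> \<not> feasible W (E' - {{u, v}})"
      using inv unfolding delete_inv_def by blast
    let ?E = "if feasible W (E' - {{a, i}}) then E' - {{a, i}} else E'"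
    show ?thesis
    proof (rule wp_conseq[OF wp_Delete_step[OF ok bt E'(1) at c a(2) i E'(2) Qt] _ order.refl])
      fix t' assume "edges ?E t'"
      moreover have "?E \<subseteq> E" "feasible W ?E" using E' by auto
      moreover have "\<not> feasible W (?E - {{u, v}})"
        if uv: "u < a \<and> v < n \<or> u = a \<and> v < Suc i" "{u, v} \<in> ?E" for u v
      proof (cases "u = a \<and> v = i")
        case True
        then show ?thesis using uv by (auto split: if_splits)
      next
        case False
        then have "u < a \<and> v < n \<or> u = a \<and> v < i" using uv by auto
        moreover have "{u, v} \<in> E'" using uv by (auto split: if_splits)
        ultimately have "\<not> feasible W (E' - {{u, v}})" by (rule crit)
        moreover have "?E - {{u, v}} \<subseteq> E' - {{u, v}}" by auto
        ultimately show ?thesis using feasible_mono by blast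
      qed
      ultimately have "delete_inv W a (Suc i) t'" unfolding delete_inv_def by blast
      then show "delete_inv W a (Suc i) (t'(''c'' := (t' ''c'')(0 := int (Suc i))))"
        by (rule delete_inv_cong) simp
    qed
  qed
  show "2 + n * (6 + compute_time + 2) \<le> 2 + n * (8 + compute_time)" by simp
qed (use ok in auto)

lemma wp_Delete:
  assumes ok: "ok s" and base: "base s" and Q: "s ''Q'' 0 = (2 ^ q) ^ (W + 1)"
    and edges: "edges E s" and W: "optimal W"
  shows "wp Delete s (2 + n * (4 + n * (8 + compute_time)))
    (\<lambda>t. \<exists>E'. edges E' t \<and> min_nt_spanning_tree {..<n} E w NT E')"
  unfolding Delete_def
proof (rule wp_For[where N = n and T = "2 + n * (8 + compute_time)" and Inv = "\<lambda>i. delete_inv W i 0"])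
  show "val (Var ''n'') t = int n"
    if "\<And>y. y \<notin> insert ''a'' (writes Delete_row) \<Longrightarrow> t y = s y" for t
    using that[of "''n''"] base unfolding base_def by simp
  have "delete_inv W 0 0 s"
    unfolding delete_inv_def using edges W unfolding optimal_def by auto
  then show "delete_inv W 0 0 (s(''a'' := (s ''a'')(0 := 0)))" by (rule delete_inv_cong) simp
  show "wp Delete_row t (2 + n * (8 + compute_time))
      (after ''a'' (Suc i) (delete_inv W (Suc i) 0))"
    if i: "i < n" and ok: "ok t" and inv: "delete_inv W i 0 t" and a: "t ''a'' 0 = int i"
      and fr: "\<And>y. y \<notin> insert ''a'' (writes Delete_row) \<Longrightarrow> t y = s y" for i t
  proof -
    have bt: "base t" by (rule base_cong[OF base fr]) (auto simp: base_names_def)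
    have Qt: "t ''Q'' 0 = (2 ^ q) ^ (W + 1)" using fr[of "''Q''"] Q by simp
    show ?thesis
      by (rule wp_conseq[OF wp_Delete_row[OF ok bt a i Qt inv] _ order.refl])
        (erule delete_inv_cong, simp)
  qed
  show "\<exists>E'. edges E' t \<and> min_nt_spanning_tree {..<n} E w NT E'" if inv: "delete_inv W n 0 t" for t
  proof -
    obtain E' where E': "E' \<subseteq> E" "edges E' t" "feasible W E'"
      and crit: "\<And>u v. u < n \<Longrightarrow> v < n \<Longrightarrow> {u, v} \<in> E' \<Longrightarrow> \<not> feasible W (E' - {{u, v}})"
      using inv unfolding delete_inv_def by blast
    obtain F where F: "nt_spanning_tree {..<n} E' NT F" "sum w F \<le> W"
      using E'(3) unfolding feasible_def by auto
    have "min_nt_spanning_tree {..<n} E w NT E'"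
    proof (rule min_nt_spanning_tree_if_critical[OF E'(1) F])
      show "W \<le> sum w F'" if "nt_spanning_tree {..<n} E NT F'" for F'
        using that W unfolding optimal_def by blast
      show "W < sum w F'" if e: "e \<in> E'" and F': "nt_spanning_tree {..<n} (E' - {e}) NT F'" for e F'
      proof -
        have "e \<subseteq> {..<n}" "card e = 2" using e E'(1) E unfolding simple_graph_def by auto
        then obtain u v where "e = {u, v}" "u < n" "v < n" by (auto simp: card_2_iff)
        then have "\<not> feasible W (E' - {e})" using crit e by blast
        then show ?thesis using F' unfolding feasible_def by force
      qed
    qed
    then show ?thesis using E'(2) by blast
  qed
  show "2 + n * (2 + n * (8 + compute_time) + 2) \<le> 2 + n * (4 + n * (8 + compute_time))"
    by (simp add: algebra_simps)
qed (use ok in auto)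

section \<open>Output and the complete program\<close>

definition output_inv :: "(int \<Rightarrow> int) \<Rightarrow> nat \<Rightarrow> nat \<Rightarrow> state \<Rightarrow> bool" where
  "output_inv b i j s \<longleftrightarrow> (\<forall>u<n. \<forall>v<n. u < i \<or> u = i \<and> v < j \<longrightarrow>
     s ''tree'' (cell u v) = of_bool (0 < b (cell u v)))"

lemma wp_Output_row:
  assumes ok: "ok s" and n: "s ''n'' 0 = int n" and a: "s ''a'' 0 = int a" "a < n"
    and b: "s ''b'' = b" and inv: "output_inv b a 0 s"
  shows "wp Output_row s (2 + n * 3) (output_inv b (Suc a) 0)"
  unfolding Output_row_def
proof (rule wp_For[where N = n and T = 1 and Inv = "output_inv b a"])
  show "val (Var ''n'') t = int n"
    if "\<And>y. y \<notin> insert ''c'' (writes Output_step) \<Longrightarrow> t y = s y" for t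
    using that[of "''n''"] n by simp
  show "output_inv b a 0 (s(''c'' := (s ''c'')(0 := 0)))" using inv unfolding output_inv_def by simp
  show "output_inv b (Suc a) 0 t" if "output_inv b a n t" for t
    using that unfolding output_inv_def by (auto simp: less_Suc_eq)
  show "wp Output_step t 1 (after ''c'' (Suc i) (output_inv b a (Suc i)))"
    if i: "i < n" and ok: "ok t" and inv: "output_inv b a i t" and c: "t ''c'' 0 = int i"
      and fr: "\<And>y. y \<notin> insert ''c'' (writes Output_step) \<Longrightarrow> t y = s y" for i t
  proof -
    have ix: "val (Ix ''a'' ''c'') t = cell a i"
      using fr[of "''n''"] fr[of "''a''"] n a c by (intro val_Ix) auto
    show ?thesis unfolding Output_step_def
    proof (rule wp_Store_at[where a = "cell a i" and v = "of_bool (0 < b (cell a i))"])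
      let ?t = "t(''tree'' := (t ''tree'')(cell a i := of_bool (0 < b (cell a i))))"
      show "output_inv b a (Suc i) (?t(''c'' := (?t ''c'')(0 := int (Suc i))))"
        using inv i a unfolding output_inv_def by (auto simp: cell_eq_iff less_Suc_eq)
    qed (use ok ix i a b fr[of "''b''"] in auto)
  qed
qed (use ok in auto)

lemma wp_Output:
  assumes ok: "ok s" and n: "s ''n'' 0 = int n"
  shows "wp Output s (2 + n * (4 + n * 3))
    (\<lambda>t. \<forall>u<n. \<forall>v<n. t ''tree'' (cell u v) = of_bool (0 < s ''b'' (cell u v)))"
  unfolding Output_def
proof (rule wp_For[where N = n and T = "2 + n * 3" and Inv = "\<lambda>i. output_inv (s ''b'') i 0"])
  show "val (Var ''n'') t = int n"
    if "\<And>y. y \<notin> insert ''a'' (writes Output_row) \<Longrightarrow> t y = s y" for t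
    using that[of "''n''"] n by simp
  show "wp Output_row t (2 + n * 3)
      (\<lambda>t'. output_inv (s ''b'') (Suc i) 0 (t'(''a'' := (t' ''a'')(0 := int (Suc i)))))"
    if i: "i < n" and ok: "ok t" and inv: "output_inv (s ''b'') i 0 t" and a: "t ''a'' 0 = int i"
      and fr: "\<And>y. y \<notin> insert ''a'' (writes Output_row) \<Longrightarrow> t y = s y" for i t
  proof -
    have nt: "t ''n'' 0 = int n" and b: "t ''b'' = s ''b''" using fr[of "''n''"] fr[of "''b''"] n by auto
    show ?thesis
      by (rule wp_conseq[OF wp_Output_row[OF ok nt a i b inv] _ order.refl]) (simp add: output_inv_def)
  qed
  show "2 + n * (2 + n * 3 + 2) \<le> 2 + n * (4 + n * 3)" by (simp add: algebra_simps)
qed (use ok in \<open>auto simp: output_inv_def\<close>)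

definition solve_time :: nat where
  "solve_time = init_time + (compute_time + (1 + (1 + ((6 + eb * 3 + K * 4) +
     ((2 + n * (4 + n * (8 + compute_time))) + (2 + n * (4 + n * 3)))))))"

text \<open>Entries of edges are powers of two, hence positive, so the sign test recovers the edge
  set. Reading only \<open>u < v\<close> loses nothing because edges are unordered pairs of distinct
  vertices.\<close>

lemma decode_tree_edges:
  assumes tree: "\<And>u v. u < n \<Longrightarrow> v < n \<Longrightarrow> t ''tree'' (cell u v) = of_bool (0 < edge_weight E' u v)"
    and E': "E' \<subseteq> E"
  shows "decode_tree n t = E'"
proof -
  have "decode_tree n t = {{u, v} |u v. u < v \<and> v < n \<and> {u, v} \<in> E'}"
    unfolding decode_tree_def
  proof (intro Collect_cong ex_cong1 conj_cong refl)
    fix u v :: nat assume "u < v" "v < n"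
    then have "t ''tree'' (int (u * n + v)) = of_bool (0 < edge_weight E' u v)"
      using tree[of u v] unfolding cell_def by simp
    then show "t ''tree'' (int (u * n + v)) = 1 \<longleftrightarrow> {u, v} \<in> E'" by (simp add: edge_weight_def)
  qed
  also have "\<dots> = E'"
  proof (intro equalityI subsetI)
    fix e assume e: "e \<in> E'"
    then have "e \<subseteq> {..<n}" "card e = 2" using E' E unfolding simple_graph_def by auto
    then obtain u v where uv: "e = {u, v}" "u < n" "v < n" "u \<noteq> v" by (auto simp: card_2_iff)
    show "e \<in> {{u, v} |u v. u < v \<and> v < n \<and> {u, v} \<in> E'}"
    proof (cases "u < v")
      case True
      then show ?thesis using e uv by blast
    next
      case False
      then have "v < u" "e = {v, u}" using uv by auto
      then show ?thesis using e uv by blast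
    qed
  qed auto
  finally show ?thesis .
qed

lemma wp_Solve:
  assumes ok: "ok s" and inp: "input s" and r: "s ''r'' 0 = 0" and b: "\<And>i. s ''b'' i = 0"
    and found: "s ''found'' 0 = 0"
  shows "wp (Solve c) s solve_time (correct_answer n E w NT)"
  unfolding Solve_def solve_time_def
proof (rule wp_Seq[OF _ order.refl], rule wp_conseq[OF wp_Init[OF ok inp r b] _ order.refl])
  let ?R = "correct_answer n E w NT"
  let ?P = "forest_count E div (2 ^ q) ^ (K * (n - 1))"
  let ?tail = "Seq Threshold (Seq Delete Output)"
  let ?t4 = "2 + n * (4 + n * 3)"
  let ?t3 = "(2 + n * (4 + n * (8 + compute_time))) + ?t4"
  let ?t2 = "(6 + eb * 3 + K * 4) + ?t3"
  fix s1 assume ok1: "ok s1" and be: "base s1 \<and> edges E s1"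
    and fr1: "\<And>x. x \<notin> writes (Init c) \<Longrightarrow> s1 x = s x"
  have base1: "base s1" and edges1: "edges E s1" using be by auto
  show "wp (Seq Compute (Cond (Var ''P'') (Seq (Assign ''found'' (Const 1)) ?tail) Skip)) s1
    (compute_time + (1 + (1 + ?t2))) ?R"
  proof (rule wp_Seq[OF _ order.refl], rule wp_conseq[OF wp_Compute[OF ok1 base1 edges1 order.refl] _ order.refl])
    fix s2 assume ok2: "ok s2" and P: "s2 ''P'' 0 = ?P"
      and fr2: "\<And>x. x \<notin> writes Compute \<Longrightarrow> s2 x = s1 x"
    have base2: "base s2" by (rule base_cong[OF base1 fr2]) (auto simp: base_names_def)
    have edges2: "edges E s2" by (rule edges_cong[OF edges1], rule fr2) simp
    show "wp (Cond (Var ''P'') (Seq (Assign ''found'' (Const 1)) ?tail) Skip) s2 (1 + (1 + ?t2)) ?R"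
    proof (rule wp_Cond[OF ok2, where T = "1 + ?t2"])
      show "wp Skip s2 (1 + ?t2) ?R" if "val (Var ''P'') s2 = 0"
      proof -
        have "\<nexists>F. nt_spanning_tree {..<n} E NT F" using that P compute_zero[OF order.refl] by simp
        moreover have "s2 ''found'' 0 = 0" using fr1[of "''found''"] fr2[of "''found''"] found by simp
        ultimately show ?thesis using ok2 unfolding correct_answer_def by (intro wp_Skip) auto
      qed
      show "wp (Seq (Assign ''found'' (Const 1)) ?tail) s2 (1 + ?t2) ?R" if nz: "val (Var ''P'') s2 \<noteq> 0"
      proof (rule wp_Store_Seq[where a = 0 and v = 1 and T = ?t2])
        obtain W where W: "optimal W" and ex: "\<exists>F. nt_spanning_tree {..<n} E NT F"
          using nz P compute_zero[OF order.refl] optimal_exists by auto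
        let ?s3 = "s2(''found'' := (s2 ''found'')(0 := 1))"
        assume ok3: "ok ?s3"
        have base3: "base ?s3" by (rule base_cong[OF base2]) (auto simp: base_names_def)
        have P3: "?s3 ''P'' 0 = ?P" using P by simp
        have edges3: "edges E ?s3" by (rule edges_cong[OF edges2]) simp
        show "wp ?tail ?s3 ?t2 ?R"
        proof (rule wp_Seq[OF _ order.refl], rule wp_conseq[OF wp_Threshold[OF ok3 base3 P3 W] _ order.refl])
          fix s4 assume ok4: "ok s4" and Q: "s4 ''Q'' 0 = (2 ^ q) ^ (W + 1)"
            and fr4: "\<And>x. x \<notin> writes Threshold \<Longrightarrow> s4 x = ?s3 x"
          have base4: "base s4" by (rule base_cong[OF base3 fr4]) (auto simp: base_names_def)
          have edges4: "edges E s4" by (rule edges_cong[OF edges3], rule fr4) simp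
          show "wp (Seq Delete Output) s4 ?t3 ?R"
          proof (rule wp_Seq[OF _ order.refl], rule wp_conseq[OF wp_Delete[OF ok4 base4 Q edges4 W] _ order.refl])
            fix s5 assume ok5: "ok s5"
              and ex5: "\<exists>E'. edges E' s5 \<and> min_nt_spanning_tree {..<n} E w NT E'"
              and fr5: "\<And>x. x \<notin> writes Delete \<Longrightarrow> s5 x = s4 x"
            obtain E' where E': "edges E' s5" "min_nt_spanning_tree {..<n} E w NT E'" using ex5 by blast
            then have sub: "E' \<subseteq> E"
              unfolding min_nt_spanning_tree_def nt_spanning_tree_def spanning_tree_def by blast
            have n5: "s5 ''n'' 0 = int n" using fr5[of "''n''"] base4 unfolding base_def by simp
            show "wp Output s5 ?t4 ?R"
            proof (rule wp_conseq[OF wp_Output[OF ok5 n5] _ order.refl])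
              fix t assume tree: "\<forall>u<n. \<forall>v<n. t ''tree'' (cell u v) = of_bool (0 < s5 ''b'' (cell u v))"
                and fr: "\<And>x. x \<notin> writes Output \<Longrightarrow> t x = s5 x"
              have "decode_tree n t = E'"
                using tree E'(1) sub unfolding edges_def by (intro decode_tree_edges) auto
              moreover have "t ''found'' 0 = 1"
                using fr[of "''found''"] fr5[of "''found''"] fr4[of "''found''"] by simp
              ultimately show "?R t" using ex E'(2) unfolding correct_answer_def by simp
            qed
          qed
        qed
      qed (use ok2 in auto)
    qed simp
  qed
qed

section \<open>Initial state and resource bounds\<close>

lemma n_power_le_K: "n ^ c \<le> K"
  using n_pos unfolding K_def by simp

text \<open>The polynomial bound on the weights enters here:
  \<open>w e \<le> n ^ c \<le> K \<le> eb\<close> makes every input entry fit into a cell.\<close>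

lemma ok_encode: "ok (encode n E w NT)"
  unfolding ok_def
proof (intro allI)
  fix x i
  let ?s = "encode n E w NT"
  consider "x = ''n''" "i = 0" "?s x i = int n"
    | u v where "x = ''weight''" "u < n" "v < n" "i = int (u * n + v)" "{u, v} \<in> E"
        "?s x i = int (w {u, v})"
    | v where "x = ''nonterminal''" "v \<in> NT" "i = int v" "?s x i = 1"
    | "?s x i = 0"
  proof -
    have "nat (int (u * n + v)) div n = u" "nat (int (u * n + v)) mod n = v" if "v < n" for u v
      using that by (simp_all only: nat_int) auto
    then show ?thesis using that unfolding encode_def by (smt (verit))
  qed
  then show "0 \<le> ?s x i \<and> ?s x i \<le> 2 ^ (2 * eb) \<and> (?s x i \<noteq> 0 \<longrightarrow> x \<in> alg_names \<and> 0 \<le> i \<and> i < cells)"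
  proof cases
    case 1
    then show ?thesis by simp
  next
    case 2
    have "w {u, v} \<le> K" using weight_bound[OF order.refl 2(5)] n_power_le_K by simp
    then have "w {u, v} \<le> 2 ^ (2 * eb)" using K_le_eb by (intro cap_nat) simp
    moreover have "i = cell u v" unfolding 2(4) cell_def by simp
    ultimately show ?thesis using 2(1-3,6) by simp
  next
    case 3
    then have "v < n" using NT by auto
    then show ?thesis using 3 by simp
  next
    case 4
    then show ?thesis by simp
  qed
qed

lemma input_encode: "input (encode n E w NT)"
proof -
  have "encode n E w NT ''weight'' (cell u v) = (if {u, v} \<in> E then int (w {u, v}) else 0)"
    if "u < n" "v < n" for u v
  proof -
    have c: "cell u v = int (u * n + v)" unfolding cell_def by simp
    have dm: "nat (cell u v) div n = u" "nat (cell u v) mod n = v"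
      unfolding c using that by (simp_all only: nat_int) auto
    have "(\<exists>u'<n. \<exists>v'<n. cell u v = int (u' * n + v') \<and> {u', v'} \<in> E) \<longleftrightarrow> {u, v} \<in> E"
    proof
      assume "\<exists>u'<n. \<exists>v'<n. cell u v = int (u' * n + v') \<and> {u', v'} \<in> E"
      then obtain u' v' where *: "u' < n" "v' < n" "cell u v = int (u' * n + v')" "{u', v'} \<in> E" by blast
      have "cell u v = cell u' v'" using *(3) unfolding cell_def by simp
      then have "u = u'" "v = v'" using that *(2) by (simp_all add: cell_eq_iff)
      then show "{u, v} \<in> E" using *(4) by simp
    qed (use that c in blast)
    then show ?thesis using dm unfolding encode_def by simp
  qed
  then show ?thesis
    unfolding input_def using NT by (auto simp: encode_def)
qed

text \<open>Only \<open>compute_time\<close> contains the factor \<open>2 ^ card NT\<close>, and it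
  enters linearly, through the \<open>n * n + 1\<close> calls of \<open>Compute\<close>. All other
  summands may be multiplied by that factor, which is at least 1.\<close>

lemma solve_time_le:
  "solve_time \<le> 2 ^ card NT * (init_time + (mask_time + 6) + 2 + (6 + eb * 3 + K * 4)
     + (2 + n * (4 + n * (14 + mask_time))) + (2 + n * (4 + n * 3)))"
proof -
  define X where "X = (2::nat) ^ card NT"
  have X: "1 \<le> X" unfolding X_def by simp
  have le: "Y \<le> X * Y" for Y using X by simp
  have ct: "compute_time \<le> X * (mask_time + 6)"
    unfolding compute_time_def X_def[symmetric] using X by (simp add: algebra_simps)
  \<comment> \<open>The 14 is 8 plus the 6 of the previous bound, all absorbed into multiples of
    \<open>X\<close>.\<close>
  have "8 + compute_time \<le> X * (14 + mask_time)"
    using ct le[of 8] by (simp add: algebra_simps)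
  then have "n * (8 + compute_time) \<le> X * (n * (14 + mask_time))"
    using mult_le_mono2 by (metis mult.left_commute)
  then have "4 + n * (8 + compute_time) \<le> X * (4 + n * (14 + mask_time))"
    using le[of 4] by (simp add: algebra_simps)
  then have "n * (4 + n * (8 + compute_time)) \<le> X * (n * (4 + n * (14 + mask_time)))"
    using mult_le_mono2 by (metis mult.left_commute)
  then have "2 + n * (4 + n * (8 + compute_time)) \<le> X * (2 + n * (4 + n * (14 + mask_time)))"
    using le[of 2] unfolding distrib_left by linarith
  then have "solve_time \<le> X * init_time + X * (mask_time + 6) + X * 2 + X * (6 + eb * 3 + K * 4)
      + X * (2 + n * (4 + n * (14 + mask_time))) + X * (2 + n * (4 + n * 3))"
    unfolding solve_time_def
    using ct le[of init_time] le[of 2] le[of "6 + eb * 3 + K * 4"] le[of "2 + n * (4 + n * 3)"]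
    by linarith
  then show ?thesis unfolding X_def by (simp only: distrib_left)
qed

theorem Solve_exec:
  defines "C \<equiv> prog_weight (Solve c) * (2 + 2 * eb * prog_weight (Solve c))"
  shows "\<exists>t T S. exec (Solve c) (encode n E w NT) t T S \<and> correct_answer n E w NT t \<and>
    T \<le> solve_time * (1 + 2 * C) \<and> S \<le> card alg_names * (n * n) * (3 + 2 * (2 * eb)) + 2 * C"
proof -
  have "wp (Solve c) (encode n E w NT) solve_time (correct_answer n E w NT)"
    by (rule wp_Solve[OF ok_encode input_encode]) (simp_all add: encode_def)
  then obtain t T where t: "run ok (Solve c) (encode n E w NT) t T" "T \<le> solve_time"
    "correct_answer n E w NT t" unfolding wp_def by blast
  obtain T' S where e: "exec (Solve c) (encode n E w NT) t T' S" "T' \<le> T * (1 + 2 * C)"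
    "S \<le> card alg_names * nat cells * (3 + 2 * (2 * eb)) + 2 * C"
    using run_exec_ok[OF t(1)] unfolding C_def by blast
  have "T * (1 + 2 * C) \<le> solve_time * (1 + 2 * C)" using t(2) by (rule mult_le_mono1)
  then have "T' \<le> solve_time * (1 + 2 * C)" using e(2) by (rule order_trans[rotated])
  moreover have "nat cells = n * n" unfolding cells_def by (simp only: nat_int)
  ultimately show ?thesis using e(1,3) t(3) by (intro exI[of _ t] exI[of _ T'] exI[of _ S]) simp
qed

end

text \<open>The polynomials of the final bounds are obtained from closure properties and never
  written out.\<close>

definition is_poly :: "(nat \<Rightarrow> nat) \<Rightarrow> bool" where
  "is_poly f \<longleftrightarrow> (\<exists>p. \<forall>x. f x = poly p x)"

lemma is_poly_const: "is_poly (\<lambda>_. a)"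
  unfolding is_poly_def by (intro exI[of _ "[:a:]"]) simp

lemma is_poly_id: "is_poly (\<lambda>x. x)"
  unfolding is_poly_def by (intro exI[of _ "[:0, 1:]"]) simp

lemma is_poly_add: "is_poly f \<Longrightarrow> is_poly g \<Longrightarrow> is_poly (\<lambda>x. f x + g x)"
  unfolding is_poly_def by (metis poly_add)

lemma is_poly_mult: "is_poly f \<Longrightarrow> is_poly g \<Longrightarrow> is_poly (\<lambda>x. f x * g x)"
  unfolding is_poly_def by (metis poly_mult)

lemma is_poly_power: "is_poly f \<Longrightarrow> is_poly (\<lambda>x. f x ^ k)"
  unfolding is_poly_def by (metis poly_power)

lemmas is_poly_intros = is_poly_const is_poly_id is_poly_add is_poly_mult is_poly_power

text \<open>The coefficients are natural numbers, so every monomial is monotone.\<close>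

lemma poly_nat_mono: "a \<le> b \<Longrightarrow> poly p a \<le> poly p (b :: nat)"
  by (induction p) (auto intro!: add_mono mult_mono)

theorem theorem8:
  shows "\<forall>c::nat. \<exists>(A::prog) (p::nat poly) (q::nat poly).
    \<forall>(n::nat) (E::nat set set) (w::nat set \<Rightarrow> nat) (NT::nat set).
      connected_graph {..<n} E \<and> NT \<subseteq> {..<n} \<and> (\<forall>e\<in>E. 0 < w e \<and> w e \<le> n ^ c) \<longrightarrow>
      (\<exists>t T S. exec A (encode n E w NT) t T S \<and>
        correct_answer n E w NT t \<and>
        T \<le> 2 ^ card NT * poly p (input_size n E w) \<and>
        S \<le> poly q (input_size n E w))"
proof
  fix c :: nat
  let ?W = "prog_weight (Solve c)"
  \<comment> \<open>The constants of the locale are written out as functions of \<open>n\<close>, so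
    that the witness polynomials can be fixed before the instance and depend on \<open>c\<close>
    only.\<close>
  let ?K = "\<lambda>n::nat. n ^ (c + 1)"
  let ?e = "\<lambda>n. (n * n + 1) * ?K n * n"
  let ?C = "\<lambda>n. ?W * (2 + 2 * ?e n * ?W)"
  let ?mask = "\<lambda>n. (3 + n * 4) + ((2 + n * (6 + n * 5)) + ((3 + n * (8 + ?e n * 3 + n * (6 + n * 3))) + 1))"
  let ?init = "\<lambda>n. (2 + n * 4) + ((3 + n * 5) + ((9 + ?e n * 6) + (2 + n * (4 + n * (7 + ?e n * 6)))))"
  let ?T = "\<lambda>n. (?init n + (?mask n + 6) + 2 + (6 + ?e n * 3 + ?K n * 4)
     + (2 + n * (4 + n * (14 + ?mask n))) + (2 + n * (4 + n * 3))) * (1 + 2 * ?C n)"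
  let ?S = "\<lambda>n. card alg_names * (n * n) * (3 + 2 * (2 * ?e n)) + 2 * ?C n"
  have "is_poly ?T" by (intro is_poly_intros)
  then obtain p where p: "\<And>n. ?T n = poly p n" unfolding is_poly_def by blast
  have "is_poly ?S" by (intro is_poly_intros)
  then obtain r where r: "\<And>n. ?S n = poly r n" unfolding is_poly_def by blast
  show "\<exists>(A::prog) (p::nat poly) (q::nat poly).
    \<forall>(n::nat) (E::nat set set) (w::nat set \<Rightarrow> nat) (NT::nat set).
      connected_graph {..<n} E \<and> NT \<subseteq> {..<n} \<and> (\<forall>e\<in>E. 0 < w e \<and> w e \<le> n ^ c) \<longrightarrow>
      (\<exists>t T S. exec A (encode n E w NT) t T S \<and>
        correct_answer n E w NT t \<and>
        T \<le> 2 ^ card NT * poly p (input_size n E w) \<and>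
        S \<le> poly q (input_size n E w))"
  proof (rule exI[of _ "Solve c"], rule exI[of _ p], rule exI[of _ r], intro allI impI)
    fix n :: nat and E :: "nat set set" and w :: "nat set \<Rightarrow> nat" and NT :: "nat set"
    assume *: "connected_graph {..<n} E \<and> NT \<subseteq> {..<n} \<and> (\<forall>e\<in>E. 0 < w e \<and> w e \<le> n ^ c)"
    then have "{..<n} \<noteq> {}" "simple_graph {..<n} E"
      unfolding connected_graph_def simple_graph_def by auto
    then interpret nt_instance c n E w NT
      using * by unfold_locales auto
    have eb: "eb = ?e n" and K: "K = ?K n" by (simp_all add: eb_def q_def K_def)
    obtain t T S where t: "exec (Solve c) (encode n E w NT) t T S" "correct_answer n E w NT t"
      and T: "T \<le> solve_time * (1 + 2 * ?C n)" and S: "S \<le> ?S n"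
      using Solve_exec unfolding eb by blast
    \<comment> \<open>Polynomials in \<open>n\<close> alone suffice, because \<open>n\<close> never
      exceeds the input size and the polynomials are monotone.\<close>
    have size: "n \<le> input_size n E w" unfolding input_size_def by simp
    have "T \<le> solve_time * (1 + 2 * ?C n)" by (rule T)
    also have "\<dots> \<le> 2 ^ card NT * (?init n + (?mask n + 6) + 2 + (6 + ?e n * 3 + ?K n * 4)
       + (2 + n * (4 + n * (14 + ?mask n))) + (2 + n * (4 + n * 3))) * (1 + 2 * ?C n)"
      using solve_time_le unfolding init_time_def mask_time_def eb K by (rule mult_le_mono1)
    also have "\<dots> = 2 ^ card NT * poly p n" unfolding p[symmetric] by (simp only: mult.assoc)
    also have "\<dots> \<le> 2 ^ card NT * poly p (input_size n E w)"
      by (intro mult_le_mono2 poly_nat_mono size)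
    finally have "T \<le> 2 ^ card NT * poly p (input_size n E w)" .
    moreover have "S \<le> poly r (input_size n E w)"
      using S poly_nat_mono[OF size, of r] unfolding r by (rule order_trans)
    ultimately show "\<exists>t T S. exec (Solve c) (encode n E w NT) t T S \<and> correct_answer n E w NT t \<and>
        T \<le> 2 ^ card NT * poly p (input_size n E w) \<and> S \<le> poly r (input_size n E w)"
      using t by blast
  qed
qed

end
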